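(* Under the standing assumptions and with the notation of the context, let $\delta\in(0,\omega\wedge\eta)$. Then the operator $\Lambda=I+L^*R^*RL$ admits a bounded inverse $$\Lambda^{-1}:L^q_\delta(0,\infty;U)\longrightarrow L^q_{\delta-\sigma_0}(0,\infty;U)$$ with appropriate $\sigma_0\in(0,\delta)$; that is, for some $\sigma_0\in(0,\delta)$, for every $h\in L^q_\delta(0,\infty;U)$ the equation $g+L^*R^*RLg=h$ has a unique solution $g=\Lambda^{-1}h\in L^q_{\delta-\sigma_0}(0,\infty;U)$, and $h\mapsto g$ is bounded between these spaces.
   Context: Standing assumptions. $Y,U,Z$ are separable complex Hilbert spaces. $A:\mathcal D(A)\subseteq Y\to Y$ is a closed linear operator generating a strongly continuous semigroup $e^{At}$ on $Y$ with $\|e^{At}\|_{\mathcal L(Y)}\le Me^{-\omega t}$ for all $t\ge0$ ($M\ge1$, $\omega>0$); then $A^{-1}\in\mathcal L(Y)$. $A^\alpha$ and ${A^*}^\alpha$ denote the fractional powers $(-A)^\alpha$, $(-A^* )^\alpha$. $[\mathcal D(A^* )]'$ is the dual with respect to the pivot space $Y$; $e^{At}$ extends to it. $B\in\mathcal L(U,[\mathcal D(A^* )]')$, equivalently $A^{-1}B\in\mathcal L(U,Y)$, and $B^*\in\mathcal L(\mathcal D(A^* ),U)$ is its adjoint. $R\in\mathcal L(Y,Z)$. One has $B^*e^{A^*t}x=F(t)x+G(t)x$ for $t\ge0$, $x\in\mathcal D(A^* )$, where $F(t):Y\to U$ and $G(t):\mathcal D(A^* )\to U$, $t>0$, are bounded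 linear operators such that: (i) there are $\gamma\in(0,1)$, $\eta,N>0$ with $\|F(t)\|_{\mathcal L(Y,U)}\le Nt^{-\gamma}e^{-\eta t}$ for all $t>0$; (ii) there is $T>0$ such that $G(\cdot)\in\mathcal L(Y,L^p(0,T;U))$ for all $p\in[1,\infty)$; (iii) there are $T>0$ and $\epsilon\in(0,1)$ such that: (a) $G(\cdot){A^*}^{-\epsilon}\in\mathcal L(Y,C([0,T];U))$, in particular $\sup_{t\in[0,T]}\|G(t){A^*}^{-\epsilon}\|_{\mathcal L(Y,U)}<\infty$; (b) $R^*R\in\mathcal L(\mathcal D(A^\epsilon),\mathcal D({A^*}^\epsilon))$; (c) there is $q\in(1,2)$ such that $B^*e^{A^*\cdot}{A^*}^\epsilon$, defined on $\mathcal D({A^*}^{1+\epsilon})$, has an extension belonging to $\mathcal L(Y,L^q(0,T;U))$. The exponent $q$ in the claim is the one in (iii)(c). Notation. $\omega\wedge\eta=\min\{\omega,\eta\}$. $L^p_\delta(0,\infty;X)=\{f:(0,\infty)\to X:\ e^{\delta\cdot}f(\cdot)\in L^p(0,\infty;X)\}$ with norm $\|e^{\delta\cdot}f\|_{L^p(0,\infty;X)}$. $(Lu)(t)=\int_0^te^{A(t-s)}Bu(s)\,ds$ and $(L^*v)(s)=\int_s^\infty B^*e^{A^*(t-s)}v(t)\,dt$; for $p\in(1,\infty)$, $L$ maps $L^p(0,\infty;U)$ boundedly to $L^p(0,\infty;Y)$ and $L^*$ maps $L^p(0,\infty;Y)$ boundedly to $L^p(0,\infty;U)$. *)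

theory Defs
  imports "HOL-Analysis.Analysis"
begin

section \<open>Complex Hilbert spaces\<close>

text \<open>The inner product is linear in the first and conjugate-linear in the second argument. The
  real inner product of the superclass is its real part, so that the norm is the usual one.\<close>

class complex_hilbert = real_inner + banach +
  fixes scaleC :: "complex \<Rightarrow> 'a \<Rightarrow> 'a" (infixr "*\<^sub>C" 75)
    and cinner :: "'a \<Rightarrow> 'a \<Rightarrow> complex"
  assumes scaleC_add_right: "c *\<^sub>C (x + y) = c *\<^sub>C x + c *\<^sub>C y"
    and scaleC_add_left: "(c + d) *\<^sub>C x = c *\<^sub>C x + d *\<^sub>C x"
    and scaleC_scaleC: "c *\<^sub>C (d *\<^sub>C x) = (c * d) *\<^sub>C x"
    and scaleC_of_real: "complex_of_real r *\<^sub>C x = r *\<^sub>R x"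
    and cinner_commute: "cinner x y = cnj (cinner y x)"
    and cinner_add_left: "cinner (x + y) z = cinner x z + cinner y z"
    and cinner_scaleC_left: "cinner (c *\<^sub>C x) y = c * cinner x y"
    and Re_cinner: "Re (cinner x y) = inner x y"

instantiation complex :: complex_hilbert
begin
definition scaleC_complex :: "complex \<Rightarrow> complex \<Rightarrow> complex" where "scaleC_complex c x = c * x"
definition cinner_complex :: "complex \<Rightarrow> complex \<Rightarrow> complex" where "cinner_complex x y = x * cnj y"
instance
  by standard
    (auto simp: scaleC_complex_def cinner_complex_def algebra_simps inner_complex_def
      scaleR_conv_of_real)
end

section \<open>Linear operators\<close>

definition clinear_on :: "'a::complex_hilbert set \<Rightarrow> ('a \<Rightarrow> 'b::complex_hilbert) \<Rightarrow> bool" where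
  "clinear_on D T \<longleftrightarrow> 0 \<in> D \<and>
     (\<forall>c. \<forall>x\<in>D. \<forall>y\<in>D. c *\<^sub>C x + y \<in> D \<and> T (c *\<^sub>C x + y) = c *\<^sub>C T x + T y)"

definition bounded_clinear :: "('a::complex_hilbert \<Rightarrow> 'b::complex_hilbert) \<Rightarrow> bool" where
  "bounded_clinear T \<longleftrightarrow> clinear_on UNIV T \<and> (\<exists>C. \<forall>x. norm (T x) \<le> C * norm x)"

text \<open>An unbounded operator is a domain \<open>D\<close> together with a function that is only relevant on \<open>D\<close>.\<close>

definition closed_clinear :: "'a::complex_hilbert set \<Rightarrow> ('a \<Rightarrow> 'b::complex_hilbert) \<Rightarrow> bool" where
  "closed_clinear D T \<longleftrightarrow> clinear_on D T \<and> closed ((\<lambda>x. (x, T x)) ` D)"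

definition graph_norm :: "('a::complex_hilbert \<Rightarrow> 'b::complex_hilbert) \<Rightarrow> 'a \<Rightarrow> real" where
  "graph_norm T x = norm x + norm (T x)"

definition adj_dom :: "'a::complex_hilbert set \<Rightarrow> ('a \<Rightarrow> 'b::complex_hilbert) \<Rightarrow> 'b set" where
  "adj_dom D T = {y. \<exists>z. \<forall>x\<in>D. cinner (T x) y = cinner x z}"

definition adj :: "'a::complex_hilbert set \<Rightarrow> ('a \<Rightarrow> 'b::complex_hilbert) \<Rightarrow> 'b \<Rightarrow> 'a" where
  "adj D T y = (THE z. \<forall>x\<in>D. cinner (T x) y = cinner x z)"

section \<open>Semigroups and fractional powers\<close>

definition C0_semigroup :: "(real \<Rightarrow> 'a::complex_hilbert \<Rightarrow> 'a) \<Rightarrow> bool" where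
  "C0_semigroup S \<longleftrightarrow> (\<forall>t\<ge>0. bounded_clinear (S t)) \<and> S 0 = id \<and>
     (\<forall>s\<ge>0. \<forall>t\<ge>0. S (s + t) = S s \<circ> S t) \<and>
     (\<forall>x. ((\<lambda>t. S t x) \<longlongrightarrow> x) (at_right 0))"

definition generates ::
  "'a::complex_hilbert set \<Rightarrow> ('a \<Rightarrow> 'a) \<Rightarrow> (real \<Rightarrow> 'a \<Rightarrow> 'a) \<Rightarrow> bool" where
  "generates D A S \<longleftrightarrow> C0_semigroup S \<and>
     D = {x. \<exists>y. ((\<lambda>h. (S h x - x) /\<^sub>R h) \<longlongrightarrow> y) (at_right 0)} \<and>
     (\<forall>x\<in>D. ((\<lambda>h. (S h x - x) /\<^sub>R h) \<longlongrightarrow> A x) (at_right 0))"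

text \<open>The semigroup generated by the adjoint of the generator of \<open>S\<close>; on a Hilbert space this is
  the family of adjoint operators.\<close>

definition adj_semigroup :: "(real \<Rightarrow> 'a::complex_hilbert \<Rightarrow> 'a) \<Rightarrow> real \<Rightarrow> 'a \<Rightarrow> 'a" where
  "adj_semigroup S t = adj UNIV (S t)"

text \<open>Fractional powers of \<open>-A\<close>, where \<open>A\<close> generates the exponentially stable semigroup \<open>S\<close>:
  for \<open>\<alpha> > 0\<close>, the power of exponent \<open>-\<alpha>\<close> is given by the Gamma integral, and the power of exponent
  \<open>\<alpha>\<close> is the inverse of this injective operator, defined on its range.\<close>

definition frac_neg_power ::
  "(real \<Rightarrow> 'a::{complex_hilbert, second_countable_topology} \<Rightarrow> 'a) \<Rightarrow> real \<Rightarrow> 'a \<Rightarrow> 'a" where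
  "frac_neg_power S \<alpha> x =
     (1 / Gamma \<alpha>) *\<^sub>R (LINT t:{0<..}|lebesgue. t powr (\<alpha> - 1) *\<^sub>R S t x)"

definition frac_dom ::
  "(real \<Rightarrow> 'a::{complex_hilbert, second_countable_topology} \<Rightarrow> 'a) \<Rightarrow> real \<Rightarrow> 'a set" where
  "frac_dom S \<alpha> = range (frac_neg_power S \<alpha>)"

definition frac_power ::
  "(real \<Rightarrow> 'a::{complex_hilbert, second_countable_topology} \<Rightarrow> 'a) \<Rightarrow> real \<Rightarrow> 'a \<Rightarrow> 'a" where
  "frac_power S \<alpha> = inv (frac_neg_power S \<alpha>)"

section \<open>Lebesgue spaces of vector-valued functions\<close>

text \<open>Elements are functions; identification up to null sets is made explicit where it matters.\<close>

definition Lp_space ::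
  "real \<Rightarrow> real set \<Rightarrow> (real \<Rightarrow> 'a::{complex_hilbert, second_countable_topology}) set" where
  "Lp_space p I = {f \<in> borel_measurable (lebesgue_on I).
     integrable (lebesgue_on I) (\<lambda>t. norm (f t) powr p)}"

definition Lp_norm ::
  "real \<Rightarrow> real set \<Rightarrow> (real \<Rightarrow> 'a::{complex_hilbert, second_countable_topology}) \<Rightarrow> real" where
  "Lp_norm p I f = (LINT t|lebesgue_on I. norm (f t) powr p) powr (1 / p)"

definition weighted_Lp ::
  "real \<Rightarrow> real \<Rightarrow> (real \<Rightarrow> 'a::{complex_hilbert, second_countable_topology}) set" where
  "weighted_Lp p \<delta> = {f. (\<lambda>t. exp (\<delta> * t) *\<^sub>R f t) \<in> Lp_space p {0<..}}"

definition weighted_Lp_norm ::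
  "real \<Rightarrow> real \<Rightarrow> (real \<Rightarrow> 'a::{complex_hilbert, second_countable_topology}) \<Rightarrow> real" where
  "weighted_Lp_norm p \<delta> f = Lp_norm p {0<..} (\<lambda>t. exp (\<delta> * t) *\<^sub>R f t)"

definition Lp_tendsto ::
  "real \<Rightarrow> real set \<Rightarrow> (nat \<Rightarrow> real \<Rightarrow> 'a::{complex_hilbert, second_countable_topology}) \<Rightarrow>
   (real \<Rightarrow> 'a) \<Rightarrow> bool" where
  "Lp_tendsto p I fs f \<longleftrightarrow> (\<forall>n. fs n \<in> Lp_space p I) \<and> f \<in> Lp_space p I \<and>
     (\<lambda>n. Lp_norm p I (\<lambda>t. fs n t - f t)) \<longlonglongrightarrow> 0"

text \<open>\<open>extends_to_Lp D \<Psi> p I\<close> says that \<open>\<Psi>\<close>, given on \<open>D\<close>, has an extension to a bounded linear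
  operator from the whole space to \<open>L\<^sup>p(I)\<close>; similarly for continuous functions on \<open>[0,T]\<close>, where
  \<open>\<Psi>\<close> is only given for positive times.\<close>

definition extends_to_Lp ::
  "'a::complex_hilbert set \<Rightarrow>
   ('a \<Rightarrow> real \<Rightarrow> 'b::{complex_hilbert, second_countable_topology}) \<Rightarrow>
   real \<Rightarrow> real set \<Rightarrow> bool" where
  "extends_to_Lp D \<Psi> p I \<longleftrightarrow> (\<exists>\<Phi>.
     (\<forall>x. \<Phi> x \<in> Lp_space p I) \<and>
     (\<forall>c x y. AE t in lebesgue_on I. \<Phi> (c *\<^sub>C x + y) t = c *\<^sub>C \<Phi> x t + \<Phi> y t) \<and>
     (\<exists>C. \<forall>x. Lp_norm p I (\<Phi> x) \<le> C * norm x) \<and>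
     (\<forall>x\<in>D. AE t in lebesgue_on I. \<Phi> x t = \<Psi> x t))"

definition extends_to_C ::
  "'a::complex_hilbert set \<Rightarrow> ('a \<Rightarrow> real \<Rightarrow> 'b::complex_hilbert) \<Rightarrow> real \<Rightarrow> bool" where
  "extends_to_C D \<Psi> T \<longleftrightarrow> (\<exists>\<Phi>.
     (\<forall>x. continuous_on {0..T} (\<Phi> x)) \<and>
     (\<forall>t\<in>{0..T}. clinear_on UNIV (\<lambda>x. \<Phi> x t)) \<and>
     (\<exists>C. \<forall>x. \<forall>t\<in>{0..T}. norm (\<Phi> x t) \<le> C * norm x) \<and>
     (\<forall>x\<in>D. \<forall>t\<in>{0<..T}. \<Phi> x t = \<Psi> x t))"

section \<open>The control operator and the input map\<close>

text \<open>The dual of \<open>\<D>(A\<^sup>*)\<close> (graph norm) with respect to the pivot space \<open>Y\<close> consists of the bounded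
  conjugate-linear functionals on \<open>\<D>(A\<^sup>*)\<close>, and \<open>y \<in> Y\<close> is identified with \<open>\<lambda>x. cinner y x\<close>.
  Functionals are total functions whose values outside of \<open>\<D>(A\<^sup>*)\<close> are irrelevant. Throughout this section
  \<open>D\<close> and \<open>A\<close> are the original operator, not its adjoint.\<close>

definition pivot_dual :: "'y::complex_hilbert set \<Rightarrow> ('y \<Rightarrow> 'y) \<Rightarrow> ('y \<Rightarrow> complex) set" where
  "pivot_dual D A = {\<phi>.
     (\<forall>c. \<forall>x\<in>adj_dom D A. \<forall>y\<in>adj_dom D A. \<phi> (c *\<^sub>C x + y) = cnj c * \<phi> x + \<phi> y) \<and>
     (\<exists>C. \<forall>x\<in>adj_dom D A. cmod (\<phi> x) \<le> C * graph_norm (adj D A) x)}"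

definition control_operator ::
  "'y::complex_hilbert set \<Rightarrow> ('y \<Rightarrow> 'y) \<Rightarrow> ('u::complex_hilbert \<Rightarrow> 'y \<Rightarrow> complex) \<Rightarrow> bool" where
  "control_operator D A B \<longleftrightarrow> (\<forall>u. B u \<in> pivot_dual D A) \<and>
     (\<forall>c u v. \<forall>x\<in>adj_dom D A. B (c *\<^sub>C u + v) x = c * B u x + B v x) \<and>
     (\<exists>C. \<forall>u. \<forall>x\<in>adj_dom D A. cmod (B u x) \<le> C * norm u * graph_norm (adj D A) x)"

definition control_adj ::
  "('u::complex_hilbert \<Rightarrow> 'y::complex_hilbert \<Rightarrow> complex) \<Rightarrow> 'y \<Rightarrow> 'u" where
  "control_adj B x = (THE v. \<forall>u. B u x = cinner u v)"

text \<open>The extension of the semigroup to the dual, by transposition.\<close>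

definition semigroup_ext ::
  "(real \<Rightarrow> 'y::complex_hilbert \<Rightarrow> 'y) \<Rightarrow> real \<Rightarrow> ('y \<Rightarrow> complex) \<Rightarrow> 'y \<Rightarrow> complex" where
  "semigroup_ext S t \<phi> x = \<phi> (adj_semigroup S t x)"

text \<open>The integral defining \<open>(Lu)(t)\<close> lives in the dual of \<open>\<D>(A\<^sup>*)\<close>; \<open>(Lu)(t)\<close> is the element of \<open>Y\<close>
  that represents it. For \<open>u\<close> in \<open>L\<^sup>p(0,\<infinity>;U)\<close> with \<open>1 < p < \<infinity>\<close> it exists for almost every \<open>t\<close>.\<close>

definition input_map ::
  "'y::complex_hilbert set \<Rightarrow> ('y \<Rightarrow> 'y) \<Rightarrow> (real \<Rightarrow> 'y \<Rightarrow> 'y) \<Rightarrow>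
   ('u::complex_hilbert \<Rightarrow> 'y \<Rightarrow> complex) \<Rightarrow> (real \<Rightarrow> 'u) \<Rightarrow> real \<Rightarrow> 'y" where
  "input_map D A S B u t = (THE y. \<forall>x\<in>adj_dom D A.
     cinner y x = (LINT s:{0..t}|lebesgue. semigroup_ext S (t - s) (B (u s)) x))"

text \<open>The formula for \<open>L\<^sup>*v\<close> makes sense pointwise for \<open>v\<close> in \<open>L\<^sup>p(0,\<infinity>;\<D>(A\<^sup>*))\<close>, because \<open>B\<^sup>*\<close> is
  defined on \<open>\<D>(A\<^sup>*)\<close> only. On \<open>L\<^sup>p(0,\<infinity>;Y)\<close> the operator is the continuous extension from this dense
  subspace; its values are unique up to null sets.\<close>

definition adj_input_integral ::
  "(real \<Rightarrow> 'y::complex_hilbert \<Rightarrow> 'y) \<Rightarrow>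
   ('u::{complex_hilbert, second_countable_topology} \<Rightarrow> 'y \<Rightarrow> complex) \<Rightarrow>
   (real \<Rightarrow> 'y) \<Rightarrow> real \<Rightarrow> 'u" where
  "adj_input_integral S B v s =
     (LINT t:{s..}|lebesgue. control_adj B (adj_semigroup S (t - s) (v t)))"

definition adj_input_map ::
  "'y::{complex_hilbert, second_countable_topology} set \<Rightarrow> ('y \<Rightarrow> 'y) \<Rightarrow> (real \<Rightarrow> 'y \<Rightarrow> 'y) \<Rightarrow>
   ('u::{complex_hilbert, second_countable_topology} \<Rightarrow> 'y \<Rightarrow> complex) \<Rightarrow> real \<Rightarrow>
   (real \<Rightarrow> 'y) \<Rightarrow> real \<Rightarrow> 'u" where
  "adj_input_map D A S B p v = (SOME w. \<exists>vs.
     (\<forall>n. (\<forall>t>0. vs n t \<in> adj_dom D A) \<and> (\<lambda>t. adj D A (vs n t)) \<in> Lp_space p {0<..}) \<and>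
     Lp_tendsto p {0<..} vs v \<and>
     Lp_tendsto p {0<..} (\<lambda>n. adj_input_integral S B (vs n)) w)"

definition Lambda_op ::
  "'y::{complex_hilbert, second_countable_topology} set \<Rightarrow> ('y \<Rightarrow> 'y) \<Rightarrow> (real \<Rightarrow> 'y \<Rightarrow> 'y) \<Rightarrow>
   ('u::{complex_hilbert, second_countable_topology} \<Rightarrow> 'y \<Rightarrow> complex) \<Rightarrow>
   ('y \<Rightarrow> 'z::complex_hilbert) \<Rightarrow> real \<Rightarrow> (real \<Rightarrow> 'u) \<Rightarrow> real \<Rightarrow> 'u" where
  "Lambda_op D A S B R p g t =
     g t + adj_input_map D A S B p (\<lambda>\<tau>. adj UNIV R (R (input_map D A S B g \<tau>))) t"

end

theory Submission
  imports Defs "HOL-Analysis.Analysis"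
begin

text \<open>Let \<open>K = L\<^sup>* R\<^sup>* R L\<close>. The kernel \<open>B\<^sup>* e\<^sup>A\<^sup>*\<^sup>t\<close> of the input map is, on every bounded time interval, the sum of
  a part with an integrable power singularity and of a part that is bounded from \<open>Y\<close> to every \<open>L\<^sup>p\<close>, and
  it decays exponentially. Hence
  \<open>\<parallel>(Lu)(t)\<parallel>\<^sup>p\<close> is bounded by the convolution of \<open>\<parallel>u\<parallel>\<^sup>p\<close> with a kernel that lies in \<open>L\<^sup>r\<close> for some \<open>r > 1\<close>, so that
  \<open>L\<close>, and by duality \<open>K\<close>, maps a weighted \<open>L\<^sup>p\<close> to a weighted \<open>L\<^sup>p\<^sup>r\<close>, and some power of \<open>K\<close> maps the
  weighted \<open>L\<^sup>q\<close> to the weighted \<open>L\<^sup>2\<close>. On the unweighted \<open>L\<^sup>2\<close> the operator \<open>K\<close> is nonnegative; since the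
  conjugates of \<open>L\<close> by the weights \<open>e\<^sup>\<sigma>\<^sup>t\<close> and \<open>e\<^sup>-\<^sup>\<sigma>\<^sup>t\<close> differ by \<open>O(\<sigma>)\<close>, the operator \<open>I + K\<close> stays coercive on
  the weighted \<open>L\<^sup>2\<close> for small \<open>\<sigma>\<close>, where a Neumann series inverts it. The equation \<open>g + K g = h\<close> is
  solved by \<open>g = h - K h + K\<^sup>2 h - \<dots> + w\<close> with \<open>w\<close> in the weighted \<open>L\<^sup>2\<close>, which embeds into \<open>L\<^sup>q\<close>
  with a smaller weight.\<close>

text \<open>The part \<open>G\<close> of the kernel is controlled only as an operator from Y to
  L^p(0,T;U), not in operator norm at fixed times, so a convolution inequality for operator norms is
  not at hand. Instead (Lu)(t) is paired with a fixed vector: Hoelder for \<open>G\<close> and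
  Jensen for the singular part bound the pairing by the 1/p-th power of a scalar convolution. The
  gain in exponent, any r \<ge> 1 with \<gamma> r < 1, is then the same for every p, so finitely
  many gains lead from q to 2. On the half-line L^2 embeds into L^q only with a loss of weight, and
  the L^2 theory works only for weights below a threshold set by the kernel and \<open>R\<close>.
  Hence the solution has some weight \<tau> that may be much smaller than \<delta>, and \<sigma>_0 =
  \<delta> - \<tau>. Uniqueness rests on the same gains: the difference d of two solutions satisfies
  d = - K d, hence lies in the unweighted L^2, where coercivity forces d = 0.\<close>

section \<open>Weighted Lebesgue spaces on the half-line\<close>

lemma nn_integral_Hoelder:
  fixes f g :: "'a \<Rightarrow> real"
  assumes [measurable]: "f \<in> borel_measurable M" "g \<in> borel_measurable M"
    and nn: "\<And>x. f x \<ge> 0" "\<And>x. g x \<ge> 0"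
    and pq: "p > 1" "1/p + 1/q = 1" and ab: "a \<ge> 0" "b \<ge> 0"
    and f: "(\<integral>\<^sup>+x. ennreal (f x powr p) \<partial>M) \<le> ennreal (a powr p)"
    and g: "(\<integral>\<^sup>+x. ennreal (g x powr q) \<partial>M) \<le> ennreal (b powr q)"
  shows "(\<integral>\<^sup>+x. ennreal (f x * g x) \<partial>M) \<le> ennreal (a * b)"
proof -
  have "1/q = 1 - 1/p" "1/p < 1" "1/p > 0" using pq by auto
  then have "1/q > 0" "1/q < 1" by linarith+
  then have q: "q > 1" by (simp add: divide_less_eq_1 zero_less_divide_iff split: if_splits)
  consider "a = 0" | "b = 0" | "a > 0" "b > 0" using ab by linarith
  then show ?thesis
  proof cases
    case 1
    then have "(\<integral>\<^sup>+x. ennreal (f x powr p) \<partial>M) = 0" using f by simp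
    then have "AE x in M. ennreal (f x powr p) = 0" by (subst (asm) nn_integral_0_iff_AE) auto
    then have "AE x in M. ennreal (f x * g x) = 0" by eventually_elim (simp add: ennreal_eq_0_iff)
    then have "(\<integral>\<^sup>+x. ennreal (f x * g x) \<partial>M) = 0" by (subst nn_integral_0_iff_AE) auto
    then show ?thesis by simp
  next
    case 2
    then have "(\<integral>\<^sup>+x. ennreal (g x powr q) \<partial>M) = 0" using g by simp
    then have "AE x in M. ennreal (g x powr q) = 0" by (subst (asm) nn_integral_0_iff_AE) auto
    then have "AE x in M. ennreal (f x * g x) = 0" by eventually_elim (simp add: ennreal_eq_0_iff)
    then have "(\<integral>\<^sup>+x. ennreal (f x * g x) \<partial>M) = 0" by (subst nn_integral_0_iff_AE) auto
    then show ?thesis by simp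
  next
    case 3
    \<comment> \<open>Young's inequality is applied to f/a and g/b and multiplied by a b; these are
      the resulting coefficients of f^p and g^q. After integration they contribute a b / p and a b /
      q, which add up to a b.\<close>
    define c1 c2 where "c1 = a * b / (p * a powr p)" and "c2 = a * b / (q * b powr q)"
    have c: "c1 \<ge> 0" "c2 \<ge> 0" using 3 pq q by (auto simp: c1_def c2_def)
    have pw: "f x * g x \<le> c1 * f x powr p + c2 * g x powr q" for x
    proof -
      have "(f x / a) * (g x / b) \<le> (f x / a) powr p / p + (g x / b) powr q / q"
        using Youngs_inequality[of p q "f x / a" "g x / b"] pq q nn 3 by simp
      then have "a * b * ((f x / a) * (g x / b))
          \<le> a * b * ((f x / a) powr p / p + (g x / b) powr q / q)"
        using 3 by (intro mult_left_mono) auto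
      then show ?thesis
        using 3 nn[of x] by (simp add: c1_def c2_def powr_divide algebra_simps)
    qed
    have "(\<integral>\<^sup>+x. ennreal (f x * g x) \<partial>M)
        \<le> (\<integral>\<^sup>+x. ennreal c1 * ennreal (f x powr p) + ennreal c2 * ennreal (g x powr q) \<partial>M)"
      using pw c by (intro nn_integral_mono)
        (simp add: ennreal_mult[symmetric] ennreal_plus[symmetric] del: ennreal_plus)
    also have "\<dots> = ennreal c1 * (\<integral>\<^sup>+x. ennreal (f x powr p) \<partial>M)
        + ennreal c2 * (\<integral>\<^sup>+x. ennreal (g x powr q) \<partial>M)"
      by (simp add: nn_integral_add nn_integral_cmult)
    also have "\<dots> \<le> ennreal c1 * ennreal (a powr p) + ennreal c2 * ennreal (b powr q)"
      using f g by (intro add_mono mult_left_mono) auto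
    also have "\<dots> = ennreal (c1 * a powr p + c2 * b powr q)"
      using c by (simp add: ennreal_mult ennreal_plus)
    also have "c1 * a powr p + c2 * b powr q = a * b * (1/p + 1/q)"
      using 3 by (simp add: c1_def c2_def algebra_simps)
    finally show ?thesis using pq by simp
  qed
qed

lemma conjugate_exponent:
  fixes p :: real
  assumes "p > 1"
  shows "p / (p - 1) > 1" "1 / p + 1 / (p / (p - 1)) = 1"
  using assms by (auto simp: field_simps)

text \<open>Jensen's inequality for the measure with density \<open>g\<close>, of mass at most
  \<open>A\<close>, in a form that never divides by the mass. It is Hoelder's inequality after
  splitting g = g^{1/p} g^{1/q} and giving the first factor to \<open>f\<close>.\<close>

lemma nn_integral_Jensen:
  fixes f g :: "'a \<Rightarrow> real"
  assumes [measurable]: "f \<in> borel_measurable M" "g \<in> borel_measurable M"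
    and nn: "\<And>x. f x \<ge> 0" "\<And>x. g x \<ge> 0" and p: "p > 1" and AB: "A \<ge> 0" "B \<ge> 0"
    and g: "(\<integral>\<^sup>+x. ennreal (g x) \<partial>M) \<le> ennreal A"
    and gf: "(\<integral>\<^sup>+x. ennreal (g x * f x powr p) \<partial>M) \<le> ennreal B"
  shows "(\<integral>\<^sup>+x. ennreal (g x * f x) \<partial>M) \<le> ennreal (A powr (1 - 1/p) * B powr (1/p))"
proof -
  define q where "q = p / (p - 1)"
  have q: "q > 1" "1/p + 1/q = 1" "1/q = 1 - 1/p"
    using conjugate_exponent[OF p] by (auto simp: q_def)
  have e1: "(g x powr (1/p) * f x) powr p = g x * f x powr p" for x
    using nn[of x] p by (simp add: powr_mult powr_powr)
  have e2: "(g x powr (1/q)) powr q = g x" for x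
    using nn[of x] q(1) by (simp add: powr_powr)
  have e4: "(B powr (1/p)) powr p = B" "(A powr (1/q)) powr q = A"
    using p q(1) AB by (auto simp: powr_powr)
  have e3: "g x powr (1/p) * f x * g x powr (1/q) = g x * f x" for x
    using nn[of x] q by (cases "g x = 0") (simp_all add: powr_add[symmetric] mult.commute mult.left_commute)
  have "(\<integral>\<^sup>+x. ennreal ((g x powr (1/p) * f x) * (g x powr (1/q))) \<partial>M)
      \<le> ennreal (B powr (1/p) * A powr (1/q))"
    by (rule nn_integral_Hoelder[where p=p and q=q])
      (use nn p q(1,2) AB g gf e4 in \<open>auto simp: e1 e2\<close>)
  then show ?thesis unfolding e3 by (simp add: q(3) mult.commute)
qed

lemma nn_integral_lborel_shift:
  fixes f :: "real \<Rightarrow> ennreal"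
  assumes "f \<in> borel_measurable borel"
  shows "(\<integral>\<^sup>+t. f (t - s) \<partial>lborel) = (\<integral>\<^sup>+t. f t \<partial>lborel)"
  using nn_integral_real_affine[of f 1 "-s"] assms by simp

lemma nn_integral_lborel_reflect:
  fixes f :: "real \<Rightarrow> ennreal"
  assumes "f \<in> borel_measurable borel"
  shows "(\<integral>\<^sup>+s. f (t - s) \<partial>lborel) = (\<integral>\<^sup>+t. f t \<partial>lborel)"
  using nn_integral_real_affine[of f "-1" t] assms by simp

lemma AE_finite_of_nn_integral:
  fixes f :: "'a \<Rightarrow> ennreal"
  assumes "f \<in> borel_measurable M" "(\<integral>\<^sup>+x. f x \<partial>M) \<le> ennreal c"
  shows "AE x in M. f x < \<infinity>"
proof -
  have "(\<integral>\<^sup>+x. f x \<partial>M) \<noteq> \<infinity>" using assms(2) by (metis ennreal_neq_top infinity_ennreal_def top_unique)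
  from nn_integral_PInf_AE[OF assms(1) this] show ?thesis
    by eventually_elim (simp add: less_top)
qed

text \<open>Young's inequality for L^1 and L^r. For fixed t, Jensen with respect to the measure f(s)
  ds of mass at most \<open>F\<close> moves the power r onto the kernel at the cost of F^{r-1};
  Tonelli and translation invariance then integrate out t. The convolution may be infinite on a null
  set, where \<open>enn2real\<close> gives 0.\<close>

lemma convolution_gain:
  fixes f k :: "real \<Rightarrow> real"
  assumes [measurable]: "f \<in> borel_measurable borel" "k \<in> borel_measurable borel"
    and nn: "\<And>x. f x \<ge> 0" "\<And>x. k x \<ge> 0" and r: "r \<ge> 1" and FG: "F \<ge> 0" "G \<ge> 0"
    and f: "(\<integral>\<^sup>+t. ennreal (f t) \<partial>lborel) \<le> ennreal F"
    and k: "(\<integral>\<^sup>+t. ennreal (k t powr r) \<partial>lborel) \<le> ennreal G"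
  shows "AE t in lborel. (\<integral>\<^sup>+s. ennreal (k (t - s) * f s) \<partial>lborel) < \<infinity>"
    and "(\<integral>\<^sup>+t. ennreal (enn2real (\<integral>\<^sup>+s. ennreal (k (t - s) * f s) \<partial>lborel) powr r) \<partial>lborel)
      \<le> ennreal (F powr r * G)"
proof -
  define c where "c t = (\<integral>\<^sup>+s. ennreal (k (t - s) * f s) \<partial>lborel)" for t
  define b where "b t = (\<integral>\<^sup>+s. ennreal (f s * k (t - s) powr r) \<partial>lborel)" for t
  have [measurable]: "c \<in> borel_measurable borel" "b \<in> borel_measurable borel"
    unfolding c_def b_def by measurable
  have "(\<integral>\<^sup>+t. b t \<partial>lborel)
      = (\<integral>\<^sup>+s. (\<integral>\<^sup>+t. ennreal (f s * k (t - s) powr r) \<partial>lborel) \<partial>lborel)"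
    unfolding b_def by (subst lborel_pair.Fubini') auto
  also have "\<dots> = (\<integral>\<^sup>+s. ennreal (f s) * (\<integral>\<^sup>+t. ennreal (k t powr r) \<partial>lborel) \<partial>lborel)"
  proof (intro nn_integral_cong)
    fix s
    have "(\<integral>\<^sup>+t. ennreal (f s * k (t - s) powr r) \<partial>lborel)
        = ennreal (f s) * (\<integral>\<^sup>+t. ennreal (k (t - s) powr r) \<partial>lborel)"
      using nn by (subst nn_integral_cmult[symmetric]) (auto simp: ennreal_mult)
    then show "(\<integral>\<^sup>+t. ennreal (f s * k (t - s) powr r) \<partial>lborel)
        = ennreal (f s) * (\<integral>\<^sup>+t. ennreal (k t powr r) \<partial>lborel)"
      by (simp add: nn_integral_lborel_shift[of "\<lambda>t. ennreal (k t powr r)"])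
  qed
  also have "\<dots> = (\<integral>\<^sup>+s. ennreal (f s) \<partial>lborel) * (\<integral>\<^sup>+t. ennreal (k t powr r) \<partial>lborel)"
    by (simp add: nn_integral_multc)
  also have "\<dots> \<le> ennreal F * ennreal G"
    using f k by (intro mult_mono) auto
  finally have bi: "(\<integral>\<^sup>+t. b t \<partial>lborel) \<le> ennreal (F * G)" using FG by (simp add: ennreal_mult)
  then have bfin: "AE t in lborel. b t < \<infinity>"
    by (intro AE_finite_of_nn_integral) auto
  have main: "c t < \<infinity> \<and> ennreal (enn2real (c t) powr r) \<le> ennreal (F powr (r - 1)) * b t"
    if bt: "b t < \<infinity>" and c0: "F > 0" for t
  proof (cases "r = 1")
    case True
    have "c t = b t" unfolding c_def b_def using nn True by (simp add: mult.commute)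
    then show ?thesis using bt True FG c0 by (simp add: less_top)
  next
    case False
    then have r1: "r > 1" using r by simp
    define B where "B = enn2real (b t)"
    have B: "b t = ennreal B" "B \<ge> 0" using bt by (auto simp: B_def less_top)
    have "(\<integral>\<^sup>+s. ennreal (f s * k (t - s)) \<partial>lborel) \<le> ennreal (F powr (1 - 1/r) * B powr (1/r))"
      by (rule nn_integral_Jensen) (use nn r1 FG f B in \<open>auto simp: b_def\<close>)
    then have ct: "c t \<le> ennreal (F powr (1 - 1/r) * B powr (1/r))"
      by (simp add: c_def mult.commute)
    then have fin: "c t < \<infinity>" by (simp add: le_less_trans)
    have "enn2real (c t) \<le> F powr (1 - 1/r) * B powr (1/r)"
      using ct by (intro enn2real_leI) auto
    then have "enn2real (c t) powr r \<le> (F powr (1 - 1/r) * B powr (1/r)) powr r"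
      using r by (intro powr_mono2) auto
    also have "\<dots> = F powr (r - 1) * B"
      using r1 B by (simp add: powr_mult powr_powr algebra_simps)
    finally show ?thesis using fin B by (simp add: ennreal_mult[symmetric])
  qed
  have F0: "AE t in lborel. c t = 0" if "F = 0"
  proof -
    have "(\<integral>\<^sup>+t. ennreal (f t) \<partial>lborel) = 0" using f that by simp
    then have "AE t in lborel. ennreal (f t) = 0" by (subst (asm) nn_integral_0_iff_AE) auto
    then have "AE t in lborel. f t = 0" using nn by (auto elim!: eventually_mono simp: ennreal_eq_0_iff antisym)
    then have "c t = 0" for t unfolding c_def
      by (subst nn_integral_0_iff_AE) (auto elim!: eventually_mono)
    then show ?thesis by simp
  qed
  show "AE t in lborel. c t < \<infinity>"
    using F0 bfin main FG by (cases "F = 0") (auto elim!: eventually_mono)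
  show "(\<integral>\<^sup>+t. ennreal (enn2real (c t) powr r) \<partial>lborel) \<le> ennreal (F powr r * G)"
  proof (cases "F = 0")
    case True
    have "AE t in lborel. ennreal (enn2real (c t) powr r) = 0"
      using F0[OF True] by eventually_elim (use r in simp)
    then have "(\<integral>\<^sup>+t. ennreal (enn2real (c t) powr r) \<partial>lborel) = 0"
      by (subst nn_integral_0_iff_AE) auto
    then show ?thesis by simp
  next
    case False
    then have F: "F > 0" using FG by simp
    have "(\<integral>\<^sup>+t. ennreal (enn2real (c t) powr r) \<partial>lborel)
        \<le> (\<integral>\<^sup>+t. ennreal (F powr (r - 1)) * b t \<partial>lborel)"
      using bfin main F by (intro nn_integral_mono_AE) (auto elim!: eventually_mono)
    also have "\<dots> = ennreal (F powr (r - 1)) * (\<integral>\<^sup>+t. b t \<partial>lborel)" by (simp add: nn_integral_cmult)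
    also have "\<dots> \<le> ennreal (F powr (r - 1)) * ennreal (F * G)" using bi by (intro mult_left_mono) auto
    also have "\<dots> = ennreal (F powr r * G)"
      using F FG by (simp add: ennreal_mult[symmetric] powr_diff)
    finally show ?thesis .
  qed
qed

text \<open>Elements of the weighted spaces are Borel functions on the whole line that vanish outside of
  \<open>(0,\<infinity>)\<close>; \<open>a\<close> is an upper bound for the norm.\<close>

definition Lp_bound :: "real \<Rightarrow> real \<Rightarrow> real \<Rightarrow>
    (real \<Rightarrow> 'a::{real_normed_vector, second_countable_topology}) \<Rightarrow> bool" where
  "Lp_bound p \<sigma> a f \<longleftrightarrow> f \<in> borel_measurable borel \<and> (\<forall>t\<le>0. f t = 0) \<and> 0 \<le> a \<and>
     (\<integral>\<^sup>+t. ennreal ((exp (\<sigma> * t) * norm (f t)) powr p) \<partial>lborel) \<le> ennreal (a powr p)"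

lemma Lp_boundD:
  assumes "Lp_bound p \<sigma> a f"
  shows "f \<in> borel_measurable borel" "t \<le> 0 \<Longrightarrow> f t = 0" "0 \<le> a"
    "(\<integral>\<^sup>+t. ennreal ((exp (\<sigma> * t) * norm (f t)) powr p) \<partial>lborel) \<le> ennreal (a powr p)"
  using assms by (auto simp: Lp_bound_def)

lemma Lp_boundI:
  assumes "f \<in> borel_measurable borel" "\<And>t. t \<le> 0 \<Longrightarrow> f t = 0" "0 \<le> a"
    "(\<integral>\<^sup>+t. ennreal ((exp (\<sigma> * t) * norm (f t)) powr p) \<partial>lborel) \<le> ennreal (a powr p)"
  shows "Lp_bound p \<sigma> a f"
  using assms by (auto simp: Lp_bound_def)

lemma Lp_bound_dominated:
  assumes f: "Lp_bound p \<sigma> a f" and p: "p \<ge> 1" and c: "c \<ge> 0"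
    and g: "g \<in> borel_measurable borel" "\<And>t. t \<le> 0 \<Longrightarrow> g t = 0"
    and le: "AE t in lborel. t > 0 \<longrightarrow> exp (\<tau> * t) * norm (g t) \<le> c * (exp (\<sigma> * t) * norm (f t))"
  shows "Lp_bound p \<tau> (c * a) g"
proof (rule Lp_boundI)
  have [measurable]: "f \<in> borel_measurable borel" using Lp_boundD[OF f] by simp
  have "(\<integral>\<^sup>+t. ennreal ((exp (\<tau> * t) * norm (g t)) powr p) \<partial>lborel)
      \<le> (\<integral>\<^sup>+t. ennreal (c powr p) * ennreal ((exp (\<sigma> * t) * norm (f t)) powr p) \<partial>lborel)"
  proof (rule nn_integral_mono_AE, use le in eventually_elim)
    case (elim t)
    show ?case
    proof (cases "t > 0")
      case True
      then have "(exp (\<tau> * t) * norm (g t)) powr p \<le> (c * (exp (\<sigma> * t) * norm (f t))) powr p"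
        using elim p by (intro powr_mono2) auto
      then show ?thesis using c by (simp add: powr_mult ennreal_mult[symmetric])
    next
      case False
      then show ?thesis using g p by simp
    qed
  qed
  also have "\<dots> = ennreal (c powr p) * (\<integral>\<^sup>+t. ennreal ((exp (\<sigma> * t) * norm (f t)) powr p) \<partial>lborel)"
    by (simp add: nn_integral_cmult)
  also have "\<dots> \<le> ennreal (c powr p) * ennreal (a powr p)"
    using Lp_boundD[OF f] by (intro mult_left_mono) auto
  finally show "(\<integral>\<^sup>+t. ennreal ((exp (\<tau> * t) * norm (g t)) powr p) \<partial>lborel) \<le> ennreal ((c * a) powr p)"
    using c Lp_boundD[OF f] by (simp add: powr_mult ennreal_mult)
qed (use g c Lp_boundD[OF f] in auto)

lemma Lp_bound_cong_AE:
  assumes f: "Lp_bound p \<sigma> a f" and g: "g \<in> borel_measurable borel" "\<And>t. t \<le> 0 \<Longrightarrow> g t = 0"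
    and eq: "AE t in lborel. t > 0 \<longrightarrow> norm (g t) = norm (f t)"
  shows "Lp_bound p \<sigma> a g"
proof (rule Lp_boundI)
  have "(\<integral>\<^sup>+t. ennreal ((exp (\<sigma> * t) * norm (g t)) powr p) \<partial>lborel)
      = (\<integral>\<^sup>+t. ennreal ((exp (\<sigma> * t) * norm (f t)) powr p) \<partial>lborel)"
  proof (rule nn_integral_cong_AE, use eq in eventually_elim)
    case (elim t)
    then show ?case using g(2)[of t] Lp_boundD(2)[OF f, of t] by (cases "t > 0") auto
  qed
  then show "(\<integral>\<^sup>+t. ennreal ((exp (\<sigma> * t) * norm (g t)) powr p) \<partial>lborel) \<le> ennreal (a powr p)"
    using Lp_boundD[OF f] by simp
qed (use g Lp_boundD[OF f] in auto)

lemma Lp_bound_mono: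
  assumes "Lp_bound p \<sigma> a f" "a \<le> b" "p \<ge> 1"
  shows "Lp_bound p \<sigma> b f"
proof -
  have "ennreal (a powr p) \<le> ennreal (b powr p)"
    using assms Lp_boundD(3)[OF assms(1)] by (intro ennreal_leI powr_mono2) auto
  then show ?thesis using assms unfolding Lp_bound_def by (auto elim: order_trans)
qed

lemma Lp_bound_weight_mono:
  assumes "Lp_bound p \<sigma> a f" "\<tau> \<le> \<sigma>" "p \<ge> 1"
  shows "Lp_bound p \<tau> a f"
proof -
  have "Lp_bound p \<tau> (1 * a) f"
    using Lp_boundD[OF assms(1)] assms by (intro Lp_bound_dominated[OF assms(1,3)])
      (auto intro!: mult_right_mono)
  then show ?thesis by simp
qed

lemma Lp_bound_scaleR:
  assumes "Lp_bound p \<sigma> a f" "p \<ge> 1"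
  shows "Lp_bound p \<sigma> (\<bar>c\<bar> * a) (\<lambda>t. c *\<^sub>R f t)"
  using Lp_boundD[OF assms(1)] by (intro Lp_bound_dominated[OF assms]) auto

lemma Lp_bound_weight:
  assumes "Lp_bound p \<sigma> a f"
  shows "Lp_bound p (\<sigma> - \<tau>) a (\<lambda>t. exp (\<tau> * t) *\<^sub>R f t)"
proof -
  have e: "exp ((\<sigma> - \<tau>) * t) * norm (exp (\<tau> * t) *\<^sub>R f t) = exp (\<sigma> * t) * norm (f t)" for t
    by (simp add: mult.assoc[symmetric] exp_add[symmetric] algebra_simps)
  show ?thesis
  proof (rule Lp_boundI)
    show "(\<integral>\<^sup>+t. ennreal ((exp ((\<sigma> - \<tau>) * t) * norm (exp (\<tau> * t) *\<^sub>R f t)) powr p) \<partial>lborel)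
        \<le> ennreal (a powr p)"
      unfolding e using Lp_boundD[OF assms] by simp
  qed (use Lp_boundD[OF assms] in auto)
qed

text \<open>The factor 2 replaces Minkowski's inequality: (x + y)^p is at most 2^p max(x, y)^p, and
  a^p + b^p \<le> (a + b)^p. Where a sharp constant counts, square integrals are computed
  directly.\<close>

lemma Lp_bound_add:
  fixes f g :: "real \<Rightarrow> 'a::{real_normed_vector, second_countable_topology}"
  assumes f: "Lp_bound p \<sigma> a f" and g: "Lp_bound p \<sigma> b g" and p: "p \<ge> 1"
  shows "Lp_bound p \<sigma> (2 * (a + b)) (\<lambda>t. f t + g t)"
proof (rule Lp_boundI)
  note D = Lp_boundD[OF f] Lp_boundD[OF g]
  have [measurable]: "f \<in> borel_measurable borel" "g \<in> borel_measurable borel" using D by auto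
  have pw: "(x + y) powr p \<le> 2 powr p * (x powr p + y powr p)" if "x \<ge> 0" "y \<ge> 0" for x y :: real
  proof -
    have "(x + y) powr p \<le> (2 * max x y) powr p" using that p by (intro powr_mono2) auto
    also have "\<dots> = 2 powr p * max x y powr p" using that by (simp add: powr_mult)
    also have "\<dots> \<le> 2 powr p * (x powr p + y powr p)" by (intro mult_left_mono) (auto simp: max_def)
    finally show ?thesis .
  qed
  have "(\<integral>\<^sup>+t. ennreal ((exp (\<sigma> * t) * norm (f t + g t)) powr p) \<partial>lborel)
      \<le> (\<integral>\<^sup>+t. ennreal (2 powr p) * (ennreal ((exp (\<sigma> * t) * norm (f t)) powr p)
            + ennreal ((exp (\<sigma> * t) * norm (g t)) powr p)) \<partial>lborel)"
  proof (intro nn_integral_mono)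
    fix t
    have "(exp (\<sigma> * t) * norm (f t + g t)) powr p
        \<le> (exp (\<sigma> * t) * norm (f t) + exp (\<sigma> * t) * norm (g t)) powr p"
      using p by (intro powr_mono2)
        (auto simp: distrib_left[symmetric] intro!: mult_left_mono norm_triangle_ineq)
    also have "\<dots> \<le> 2 powr p * ((exp (\<sigma> * t) * norm (f t)) powr p + (exp (\<sigma> * t) * norm (g t)) powr p)"
      by (rule pw) auto
    finally show "ennreal ((exp (\<sigma> * t) * norm (f t + g t)) powr p)
      \<le> ennreal (2 powr p) * (ennreal ((exp (\<sigma> * t) * norm (f t)) powr p)
            + ennreal ((exp (\<sigma> * t) * norm (g t)) powr p))"
      by (simp add: ennreal_mult[symmetric] ennreal_plus[symmetric] del: ennreal_plus)
  qed
  also have "\<dots> = ennreal (2 powr p) * ((\<integral>\<^sup>+t. ennreal ((exp (\<sigma> * t) * norm (f t)) powr p) \<partial>lborel)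
      + (\<integral>\<^sup>+t. ennreal ((exp (\<sigma> * t) * norm (g t)) powr p) \<partial>lborel))"
    by (simp add: nn_integral_cmult nn_integral_add)
  also have "\<dots> \<le> ennreal (2 powr p) * (ennreal (a powr p) + ennreal (b powr p))"
    using D by (intro mult_left_mono add_mono) auto
  also have "\<dots> = ennreal (2 powr p * (a powr p + b powr p))" by (simp add: ennreal_mult)
  also have "\<dots> \<le> ennreal ((2 * (a + b)) powr p)"
  proof (intro ennreal_leI)
    have "a powr p + b powr p \<le> (a + b) powr p"
    proof (cases "a + b = 0")
      case True
      then have "a = 0" "b = 0" using D(3,7) by linarith+
      then show ?thesis using p by simp
    next
      case False
      then have s: "a + b > 0" using D by simp
      have "(x / (a + b)) powr p \<le> x / (a + b)" if "0 \<le> x" "x \<le> a + b" for x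
        using powr_mono'[of 1 p "x / (a + b)"] that s p by simp
      moreover have "a / (a + b) + b / (a + b) = 1" using s by (simp add: add_divide_distrib[symmetric])
      ultimately have "(a / (a + b)) powr p + (b / (a + b)) powr p \<le> 1"
        using D(3,7) by (smt (verit))
      then show ?thesis using s D by (simp add: powr_divide add_divide_distrib[symmetric])
    qed
    then show "2 powr p * (a powr p + b powr p) \<le> (2 * (a + b)) powr p"
      unfolding powr_mult by (intro mult_left_mono) auto
  qed
  finally show "(\<integral>\<^sup>+t. ennreal ((exp (\<sigma> * t) * norm (f t + g t)) powr p) \<partial>lborel)
      \<le> ennreal ((2 * (a + b)) powr p)" .
qed (use Lp_boundD[OF f] Lp_boundD[OF g] in auto)

lemma Lp_bound_diff:
  fixes f g :: "real \<Rightarrow> 'a::{real_normed_vector, second_countable_topology}"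
  assumes "Lp_bound p \<sigma> a f" "Lp_bound p \<sigma> b g" "p \<ge> 1"
  shows "Lp_bound p \<sigma> (2 * (a + b)) (\<lambda>t. f t - g t)"
  using Lp_bound_add[OF assms(1) Lp_bound_scaleR[OF assms(2,3), of "-1"] assms(3)] by simp

lemma Lp_bound_zero:
  assumes "p \<ge> 1"
  shows "Lp_bound p \<sigma> 0 (\<lambda>t. 0)"
  using assms by (auto simp: Lp_bound_def)

text \<open>Norms enter only through upper bounds, so vanishing almost everywhere is concluded from
  bounds for one and the same function that tend to 0.\<close>

lemma Lp_bound_tendsto_0:
  fixes f :: "real \<Rightarrow> 'a::{real_normed_vector, second_countable_topology}"
  assumes f: "\<And>n::nat. Lp_bound p \<sigma> (a n) f" and a: "a \<longlonglongrightarrow> 0" and p: "p \<ge> 1"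
  shows "AE t in lborel. f t = 0"
proof -
  have [measurable]: "f \<in> borel_measurable borel" using Lp_boundD[OF f] by auto
  let ?I = "\<integral>\<^sup>+t. ennreal ((exp (\<sigma> * t) * norm (f t)) powr p) \<partial>lborel"
  have "(\<lambda>n. a n powr p) \<longlonglongrightarrow> 0 powr p"
    using p Lp_boundD(3)[OF f] by (intro tendsto_powr2 a) auto
  then have "(\<lambda>n. ennreal (a n powr p)) \<longlonglongrightarrow> ennreal 0" by (intro tendsto_ennrealI) simp
  then have "?I \<le> ennreal 0"
    by (rule LIMSEQ_le_const) (use Lp_boundD(4)[OF f] in auto)
  then have "?I = 0" by simp
  then have "AE t in lborel. ennreal ((exp (\<sigma> * t) * norm (f t)) powr p) = 0"
    by (subst (asm) nn_integral_0_iff_AE) auto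
  then show ?thesis by eventually_elim (use p in \<open>simp add: ennreal_eq_0_iff\<close>)
qed

lemma Lp_bound_Hoelder:
  fixes f :: "real \<Rightarrow> 'a::{real_inner, second_countable_topology}"
  assumes f: "Lp_bound p \<sigma> a f" and g: "Lp_bound q (- \<sigma>) b g" and pq: "p > 1" "1/p + 1/q = 1"
  shows "integrable lborel (\<lambda>t. inner (f t) (g t))" "\<bar>\<integral>t. inner (f t) (g t) \<partial>lborel\<bar> \<le> a * b"
    "integrable lborel (\<lambda>t. norm (f t) * norm (g t))"
proof -
  note D = Lp_boundD[OF f] Lp_boundD[OF g]
  have [measurable]: "f \<in> borel_measurable borel" "g \<in> borel_measurable borel" using D by auto
  have e: "(exp (\<sigma> * t) * norm (f t)) * (exp (- \<sigma> * t) * norm (g t)) = norm (f t) * norm (g t)" for t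
    by (simp add: exp_minus field_simps)
  have *: "(\<integral>\<^sup>+t. ennreal (norm (f t) * norm (g t)) \<partial>lborel) \<le> ennreal (a * b)"
    unfolding e[symmetric] by (rule nn_integral_Hoelder[where p=p and q=q]) (use D pq in auto)
  show 1: "integrable lborel (\<lambda>t. norm (f t) * norm (g t))"
    by (rule integrableI_bounded) (use * in \<open>auto intro: le_less_trans\<close>)
  show 2: "integrable lborel (\<lambda>t. inner (f t) (g t))"
    by (rule Bochner_Integration.integrable_bound[OF 1]) (auto simp: Cauchy_Schwarz_ineq2)
  have "ennreal (norm (\<integral>t. inner (f t) (g t) \<partial>lborel)) \<le> (\<integral>\<^sup>+t. norm (inner (f t) (g t)) \<partial>lborel)"
    by (rule integral_norm_bound_ennreal[OF 2])
  also have "\<dots> \<le> (\<integral>\<^sup>+t. ennreal (norm (f t) * norm (g t)) \<partial>lborel)"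
    by (intro nn_integral_mono ennreal_leI) (simp add: Cauchy_Schwarz_ineq2)
  also note *
  finally show "\<bar>\<integral>t. inner (f t) (g t) \<partial>lborel\<bar> \<le> a * b" using D by simp
qed

lemma nn_integral_exp_neg:
  fixes c :: real
  assumes "c > 0"
  shows "(\<integral>\<^sup>+t. ennreal (indicator {0<..} t * exp (- c * t)) \<partial>lborel) = ennreal (1 / c)"
proof -
  have "((\<lambda>x. exp (- c * x)) has_integral exp (- c * 0) / c) {0..}"
    using has_integral_exp_minus_to_infinity[OF assms, of 0] .
  then have "(\<integral>\<^sup>+t. ennreal (indicator {0..} t * exp (- c * t)) \<partial>lborel) = ennreal (1 / c)"
    by (subst nn_integral_has_integral_lebesgue[where I = "1/c"]) auto
  moreover have "(\<integral>\<^sup>+t. ennreal (indicator {0<..} t * exp (- c * t)) \<partial>lborel)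
      = (\<integral>\<^sup>+t. ennreal (indicator {0..} t * exp (- c * t)) \<partial>lborel)"
    by (rule nn_integral_cong_AE, use AE_lborel_singleton[of 0] in eventually_elim)
      (auto simp: indicator_def)
  ultimately show ?thesis by simp
qed

text \<open>Hoelder's inequality with exponent 2/q splits |f|^q e^{q\<tau>t} into |f|^q
  e^{q\<sigma>t} and e^{-q(\<sigma>-\<tau>)t}. The second factor is integrable to the conjugate
  power on the half-line because \<tau> < \<sigma>: the embedding costs weight.\<close>

lemma Lp_bound_embed:
  assumes q: "1 < q" "q < 2" and \<tau>: "\<tau> < \<sigma>"
  obtains C where "C \<ge> 0"
    "\<And>a (f::real\<Rightarrow>'a::{real_normed_vector, second_countable_topology}).
        Lp_bound 2 \<sigma> a f \<Longrightarrow> Lp_bound q \<tau> (C * a) f"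
proof -
  define p where "p = 2 / q"
  define p' where "p' = p / (p - 1)"
  have p: "p > 1" "p \<noteq> 0" "p * q = 2" using q by (auto simp: p_def)
  have p': "p' > 1" "1/p + 1/p' = 1" using conjugate_exponent[OF p(1)] by (auto simp: p'_def)
  define k where "k = q * (\<sigma> - \<tau>) * p'"
  have k: "k > 0" using q \<tau> p' by (auto simp: k_def)
  define c where "c = (1 / k) powr (1 / p')"
  have c: "c \<ge> 0" "c powr p' = 1 / k" using k p' by (auto simp: c_def powr_powr)
  show ?thesis
  proof (rule that[of "c powr (1 / q)"])
    fix a and f :: "real \<Rightarrow> 'a"
    assume f: "Lp_bound 2 \<sigma> a f"
    note D = Lp_boundD[OF f]
    have [measurable]: "f \<in> borel_measurable borel" using D by auto
    let ?F = "\<lambda>t. (exp (\<sigma> * t) * norm (f t)) powr q"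
    let ?G = "\<lambda>t. indicator {0<..} t * exp (- (q * (\<sigma> - \<tau>)) * t)"
    have e: "(exp (\<tau> * t) * norm (f t)) powr q = ?F t * ?G t" for t
    proof (cases "t > 0")
      case True
      have "exp (\<tau> * t) * norm (f t) = (exp (\<sigma> * t) * norm (f t)) * exp (- (\<sigma> - \<tau>) * t)"
        by (simp add: exp_add[symmetric] algebra_simps)
      then have "(exp (\<tau> * t) * norm (f t)) powr q
          = ((exp (\<sigma> * t) * norm (f t)) * exp (- (\<sigma> - \<tau>) * t)) powr q" by (rule arg_cong)
      also have "\<dots> = ?F t * exp (- (\<sigma> - \<tau>) * t) powr q" by (intro powr_mult)
      also have "exp (- (\<sigma> - \<tau>) * t) powr q = ?G t"
        using True unfolding exp_powr_real by (simp add: algebra_simps)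
      finally show ?thesis .
    qed (use D q in auto)
    have "(\<integral>\<^sup>+t. ennreal ((exp (\<tau> * t) * norm (f t)) powr q) \<partial>lborel) \<le> ennreal (a powr q * c)"
      unfolding e
    proof (rule nn_integral_Hoelder[where p=p and q=p'])
      show "(\<integral>\<^sup>+t. ennreal (?F t powr p) \<partial>lborel) \<le> ennreal ((a powr q) powr p)"
        using D p by (simp add: powr_powr mult.commute)
      have "?G t powr p' = indicator {0<..} t * exp (- k * t)" for t
        using p' by (auto simp: indicator_def exp_powr_real k_def algebra_simps)
      then show "(\<integral>\<^sup>+t. ennreal (?G t powr p') \<partial>lborel) \<le> ennreal (c powr p')"
        using nn_integral_exp_neg[OF k] c by simp
    qed (use p p' c in auto)
    also have "a powr q * c = (c powr (1 / q) * a) powr q"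
      using D c q by (simp add: powr_mult powr_powr)
    finally show "Lp_bound q \<tau> (c powr (1 / q) * a) f"
      using D by (intro Lp_boundI) auto
  qed simp
qed

lemma suminf_ge_term:
  fixes g :: "nat \<Rightarrow> ennreal"
  shows "g j \<le> suminf g"
  using sum_le_suminf[OF summableI, of "{j}" g] by simp

text \<open>A quantitative form of completeness. The terms decay like \<mu>^{2n}; one factor \<mu>^n
  is used up by the integrable majorant \<open>S\<close>, the other remains as the rate of
  convergence. The two factors 1/(1 - \<mu>) come from the integral of \<open>S\<close> and from the
  geometric tail at a fixed time.\<close>

lemma Lp_bound_series:
  fixes d :: "nat \<Rightarrow> real \<Rightarrow> 'a::{real_normed_vector, banach, second_countable_topology}"
  assumes d: "\<And>n. Lp_bound p \<sigma> (C * (\<mu> * \<mu>) ^ n) (d n)" and p: "p \<ge> 1" and \<mu>: "0 < \<mu>" "\<mu> < 1"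
  obtains f where "\<And>n. Lp_bound p \<sigma> (C / (1 - \<mu>)\<^sup>2 * \<mu> ^ n) (\<lambda>t. f t - (\<Sum>i<n. d i t))"
proof -
  have [measurable]: "d n \<in> borel_measurable borel" for n using Lp_boundD[OF d] by auto
  have C: "C \<ge> 0" using Lp_boundD(3)[OF d, of 0] by simp
  define S where "S t = (\<Sum>j. ennreal ((exp (\<sigma> * t) * norm (d j t) / \<mu> ^ j) powr p))" for t
  have [measurable]: "S \<in> borel_measurable borel" unfolding S_def by measurable
  have trm: "(\<integral>\<^sup>+t. ennreal ((exp (\<sigma> * t) * norm (d j t) / \<mu> ^ j) powr p) \<partial>lborel)
      \<le> ennreal (C powr p * \<mu> ^ j)" for j
  proof -
    have "(\<integral>\<^sup>+t. ennreal ((exp (\<sigma> * t) * norm (d j t) / \<mu> ^ j) powr p) \<partial>lborel)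
       = (\<integral>\<^sup>+t. ennreal (1 / (\<mu> ^ j) powr p) * ennreal ((exp (\<sigma> * t) * norm (d j t)) powr p) \<partial>lborel)"
      using \<mu> by (intro nn_integral_cong) (simp add: powr_divide ennreal_mult[symmetric])
    also have "\<dots> = ennreal (1 / (\<mu> ^ j) powr p) * (\<integral>\<^sup>+t. ennreal ((exp (\<sigma> * t) * norm (d j t)) powr p) \<partial>lborel)"
      by (simp add: nn_integral_cmult)
    also have "\<dots> \<le> ennreal (1 / (\<mu> ^ j) powr p) * ennreal ((C * (\<mu> * \<mu>) ^ j) powr p)"
      using Lp_boundD(4)[OF d] by (intro mult_left_mono) auto
    also have "\<dots> = ennreal (C powr p * (\<mu> ^ j) powr p)"
      using \<mu> C by (simp add: ennreal_mult[symmetric] powr_mult power_mult_distrib)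
    also have "\<dots> \<le> ennreal (C powr p * \<mu> ^ j)"
      using \<mu> p powr_mono'[of 1 p "\<mu> ^ j"] by (intro ennreal_leI mult_left_mono) (auto simp: power_le_one)
    finally show ?thesis .
  qed
  have "(\<integral>\<^sup>+t. S t \<partial>lborel)
      = (\<Sum>j. \<integral>\<^sup>+t. ennreal ((exp (\<sigma> * t) * norm (d j t) / \<mu> ^ j) powr p) \<partial>lborel)"
    unfolding S_def by (rule nn_integral_suminf) measurable
  also have "\<dots> \<le> (\<Sum>j. ennreal (C powr p * \<mu> ^ j))" by (intro suminf_le trm) auto
  also have "\<dots> = ennreal (\<Sum>j. C powr p * \<mu> ^ j)"
    using \<mu> by (intro suminf_ennreal2) auto
  also have "(\<Sum>j. C powr p * \<mu> ^ j) = C powr p / (1 - \<mu>)"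
    using \<mu> by (simp add: suminf_mult suminf_geometric)
  finally have S: "(\<integral>\<^sup>+t. S t \<partial>lborel) \<le> ennreal (C powr p / (1 - \<mu>))" .
  have fin: "AE t in lborel. S t < \<infinity>" by (rule AE_finite_of_nn_integral[OF _ S]) measurable
  \<comment> \<open>The series is summed only where \<open>S\<close> is finite, hence where it
    converges absolutely; the value 0 on the remaining null set keeps \<open>f\<close> a pointwise
    limit of Borel functions.\<close>
  define f where "f t = (if S t < \<infinity> then \<Sum>j. d j t else 0)" for t
  have bd: "norm (d j t) \<le> exp (- \<sigma> * t) * enn2real (S t) powr (1/p) * \<mu> ^ j" if "S t < \<infinity>" for t j
  proof -
    have "ennreal ((exp (\<sigma> * t) * norm (d j t) / \<mu> ^ j) powr p) \<le> S t"
      unfolding S_def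
      using suminf_ge_term[of "\<lambda>j. ennreal ((exp (\<sigma> * t) * norm (d j t) / \<mu> ^ j) powr p)" j] .
    then have "(exp (\<sigma> * t) * norm (d j t) / \<mu> ^ j) powr p \<le> enn2real (S t)"
      using enn2real_mono[of _ "S t"] that by fastforce
    then have "((exp (\<sigma> * t) * norm (d j t) / \<mu> ^ j) powr p) powr (1/p) \<le> enn2real (S t) powr (1/p)"
      using p by (intro powr_mono2) auto
    then have "exp (\<sigma> * t) * norm (d j t) / \<mu> ^ j \<le> enn2real (S t) powr (1/p)"
      using p \<mu> by (simp add: powr_powr)
    then show ?thesis using \<mu> by (simp add: exp_minus field_simps)
  qed
  have sm: "summable (\<lambda>j. norm (d j t))" if "S t < \<infinity>" for t
  proof (rule summable_comparison_test')
    show "summable (\<lambda>j. exp (- \<sigma> * t) * enn2real (S t) powr (1/p) * \<mu> ^ j)"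
      using \<mu> by (intro summable_mult summable_geometric) auto
    show "norm (norm (d j t)) \<le> exp (- \<sigma> * t) * enn2real (S t) powr (1/p) * \<mu> ^ j" if "j \<ge> 0" for j
      using bd[OF \<open>S t < \<infinity>\<close>] by simp
  qed
  have [measurable]: "f \<in> borel_measurable borel"
  proof (rule borel_measurable_LIMSEQ_metric)
    show "(\<lambda>t. if S t < \<infinity> then \<Sum>j<n. d j t else 0) \<in> borel_measurable borel" for n by measurable
    show "(\<lambda>n. if S t < \<infinity> then \<Sum>j<n. d j t else 0) \<longlonglongrightarrow> f t" for t
      using summable_LIMSEQ[OF summable_norm_cancel[OF sm, of t]] by (auto simp: f_def)
  qed
  have f0: "f t = 0" "d j t = 0" if "t \<le> 0" for t j
    using Lp_boundD(2)[OF d that] by (auto simp: f_def)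
  show ?thesis
  proof (rule that, rule Lp_boundI)
    fix n
    show "0 \<le> C / (1 - \<mu>)\<^sup>2 * \<mu> ^ n" using C \<mu> by simp
    have tail: "norm (f t - (\<Sum>i<n. d i t)) \<le> exp (- \<sigma> * t) * enn2real (S t) powr (1/p) * (\<mu> ^ n / (1 - \<mu>))"
      if "S t < \<infinity>" for t
    proof -
      have smn: "summable (\<lambda>j. norm (d (j + n) t))"
        by (rule summable_ignore_initial_segment[OF sm[OF that]])
      have "f t - (\<Sum>i<n. d i t) = (\<Sum>j. d (j + n) t)"
        using suminf_minus_initial_segment[OF summable_norm_cancel[OF sm[OF that]], of n] that
        by (simp add: f_def)
      also have "norm \<dots> \<le> (\<Sum>j. norm (d (j + n) t))"
        by (rule summable_norm[OF smn])
      also have "\<dots> \<le> (\<Sum>j. exp (- \<sigma> * t) * enn2real (S t) powr (1/p) * \<mu> ^ n * \<mu> ^ j)"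
      proof (rule suminf_le)
        show "norm (d (j + n) t) \<le> exp (- \<sigma> * t) * enn2real (S t) powr (1/p) * \<mu> ^ n * \<mu> ^ j" for j
          using bd[OF that, of "j + n"] by (simp add: power_add mult_ac)
      qed (use smn \<mu> in \<open>auto intro!: summable_mult\<close>)
      also have "\<dots> = exp (- \<sigma> * t) * enn2real (S t) powr (1/p) * \<mu> ^ n * (\<Sum>j. \<mu> ^ j)"
        using \<mu> by (intro suminf_mult) auto
      finally show ?thesis using \<mu> by (simp add: suminf_geometric)
    qed
    have "(\<integral>\<^sup>+t. ennreal ((exp (\<sigma> * t) * norm (f t - (\<Sum>i<n. d i t))) powr p) \<partial>lborel)
        \<le> (\<integral>\<^sup>+t. ennreal ((\<mu> ^ n / (1 - \<mu>)) powr p) * S t \<partial>lborel)"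
    proof (rule nn_integral_mono_AE, use fin in eventually_elim)
      case (elim t)
      have "exp (\<sigma> * t) * norm (f t - (\<Sum>i<n. d i t)) \<le> enn2real (S t) powr (1/p) * (\<mu> ^ n / (1 - \<mu>))"
      proof -
        have e: "exp (\<sigma> * t) * (exp (- \<sigma> * t) * x * y) = x * y" for x y
          by (simp add: mult.assoc[symmetric] exp_add[symmetric])
        show ?thesis
          using mult_left_mono[OF tail[OF elim] exp_ge_zero[of "\<sigma> * t"]] by (simp only: e)
      qed
      then have "(exp (\<sigma> * t) * norm (f t - (\<Sum>i<n. d i t))) powr p
          \<le> (enn2real (S t) powr (1/p) * (\<mu> ^ n / (1 - \<mu>))) powr p"
        using p by (intro powr_mono2) auto
      also have "\<dots> = (enn2real (S t) powr (1/p)) powr p * (\<mu> ^ n / (1 - \<mu>)) powr p" by (intro powr_mult)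
      also have "\<dots> = (\<mu> ^ n / (1 - \<mu>)) powr p * enn2real (S t)"
        using p by (simp add: powr_powr)
      finally have "ennreal ((exp (\<sigma> * t) * norm (f t - (\<Sum>i<n. d i t))) powr p)
          \<le> ennreal ((\<mu> ^ n / (1 - \<mu>)) powr p * enn2real (S t))" by (rule ennreal_leI)
      also have "\<dots> = ennreal ((\<mu> ^ n / (1 - \<mu>)) powr p) * S t"
        using elim by (subst ennreal_mult) auto
      finally show ?case .
    qed
    also have "\<dots> = ennreal ((\<mu> ^ n / (1 - \<mu>)) powr p) * (\<integral>\<^sup>+t. S t \<partial>lborel)" by (simp add: nn_integral_cmult)
    also have "\<dots> \<le> ennreal ((\<mu> ^ n / (1 - \<mu>)) powr p) * ennreal (C powr p / (1 - \<mu>))"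
      using S by (intro mult_left_mono) auto
    also have "\<dots> = ennreal ((\<mu> ^ n / (1 - \<mu>)) powr p * (C powr p / (1 - \<mu>)))"
      using \<mu> by (simp add: ennreal_mult[symmetric])
    also have "\<dots> \<le> ennreal ((C / (1 - \<mu>)\<^sup>2 * \<mu> ^ n) powr p)"
    proof (rule ennreal_leI)
      have "1 / (1 - \<mu>) \<le> (1 / (1 - \<mu>)) powr p"
        using powr_mono[of 1 p "1 / (1 - \<mu>)"] \<mu> p by simp
      then have "(\<mu> ^ n / (1 - \<mu>)) powr p * C powr p * (1 / (1 - \<mu>))
          \<le> (\<mu> ^ n / (1 - \<mu>)) powr p * C powr p * (1 / (1 - \<mu>)) powr p"
        by (intro mult_left_mono) auto
      also have "\<dots> = ((\<mu> ^ n / (1 - \<mu>)) * C * (1 / (1 - \<mu>))) powr p" by (simp only: powr_mult)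
      also have "(\<mu> ^ n / (1 - \<mu>)) * C * (1 / (1 - \<mu>)) = C / (1 - \<mu>)\<^sup>2 * \<mu> ^ n"
        by (simp add: power2_eq_square)
      finally show "(\<mu> ^ n / (1 - \<mu>)) powr p * (C powr p / (1 - \<mu>)) \<le> (C / (1 - \<mu>)\<^sup>2 * \<mu> ^ n) powr p"
        by simp
    qed
    finally show "(\<integral>\<^sup>+t. ennreal ((exp (\<sigma> * t) * norm (f t - (\<Sum>i<n. d i t))) powr p) \<partial>lborel)
        \<le> ennreal ((C / (1 - \<mu>)\<^sup>2 * \<mu> ^ n) powr p)" .
  qed (use f0 in auto)
qed

section \<open>Test functions, duality and density\<close>

definition test_fun :: "(real \<Rightarrow> 'a::{real_normed_vector, second_countable_topology}) \<Rightarrow> bool" where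
  "test_fun u \<longleftrightarrow> u \<in> borel_measurable borel \<and> (\<exists>n. \<forall>t. norm (u t) \<le> n \<and> (u t \<noteq> 0 \<longrightarrow> 0 < t \<and> t \<le> n))"

lemma test_fun_truncate:
  fixes w :: "real \<Rightarrow> 'a::{real_normed_vector, second_countable_topology}"
  assumes [measurable]: "w \<in> borel_measurable borel" "A \<in> sets borel"
    and "A \<subseteq> {0<..n}" "\<And>t. t \<in> A \<Longrightarrow> norm (w t) \<le> m"
  shows "test_fun (\<lambda>t. indicator A t *\<^sub>R w t)"
  unfolding test_fun_def
proof (intro conjI exI[of _ "max \<bar>m\<bar> n"] allI impI)
  fix t
  show "norm (indicator A t *\<^sub>R w t) \<le> max \<bar>m\<bar> n"
    using assms(4)[of t] by (cases "t \<in> A") auto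
  show "0 < t" "t \<le> max \<bar>m\<bar> n" if "indicator A t *\<^sub>R w t \<noteq> 0"
    using that assms(3) by (cases "t \<in> A"; force)+
qed measurable

text \<open>Test functions lie in every weighted space at once. This makes them the common ground on
  which operators given for different exponents and weights are compared.\<close>

lemma test_fun_Lp:
  assumes "test_fun u" "p \<ge> 1"
  obtains b where "Lp_bound p \<sigma> b u"
proof -
  from assms obtain n where [measurable]: "u \<in> borel_measurable borel"
    and n: "\<And>t. norm (u t) \<le> n" "\<And>t. u t \<noteq> 0 \<Longrightarrow> 0 < t \<and> t \<le> n" by (auto simp: test_fun_def)
  have n0: "n \<ge> 0" using n(1)[of 0] norm_ge_zero[of "u 0"] by linarith
  define c where "c = exp (\<bar>\<sigma>\<bar> * n) * n"
  have pw: "(exp (\<sigma> * t) * norm (u t)) powr p \<le> c powr p * indicator {0..n} t" for t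
  proof (cases "u t = 0")
    case False
    then have "\<sigma> * t \<le> \<bar>\<sigma>\<bar> * n" using n(2)[of t] by (intro mult_mono) auto
    then have "exp (\<sigma> * t) * norm (u t) \<le> c" using n(1)[of t] n0 unfolding c_def by (intro mult_mono) auto
    then have "(exp (\<sigma> * t) * norm (u t)) powr p \<le> c powr p" using assms by (intro powr_mono2) auto
    then show ?thesis using n(2)[OF False] by simp
  qed (use assms in auto)
  have "(\<integral>\<^sup>+t. ennreal ((exp (\<sigma> * t) * norm (u t)) powr p) \<partial>lborel)
      \<le> (\<integral>\<^sup>+t. ennreal (c powr p) * indicator {0..n} t \<partial>lborel)"
  proof (intro nn_integral_mono)
    fix t
    show "ennreal ((exp (\<sigma> * t) * norm (u t)) powr p) \<le> ennreal (c powr p) * indicator {0..n} t"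
      using ennreal_leI[OF pw[of t]] by (cases "t \<in> {0..n}") auto
  qed
  also have "\<dots> = ennreal (c powr p * n)"
    using n0 by (simp add: nn_integral_cmult ennreal_mult)
  also have "c powr p * n = ((c powr p * n) powr (1/p)) powr p"
    using assms n0 by (simp add: powr_powr)
  finally have "Lp_bound p \<sigma> ((c powr p * n) powr (1/p)) u"
    using n(2) by (intro Lp_boundI) force+
  then show ?thesis by (rule that)
qed

text \<open>Converse of Hoelder's inequality, tested with the extremal function e^{p\<sigma>t}
  |w|^{p-2} w cut off to \<open>A n\<close>. Its pairing with w and the q-th power of its dual norm
  are the same number I, so I \<le> a I^{1/q} and thus I \<le> a^p; Fatou's lemma removes the
  cut-off. The cut-off also makes I finite, which the division by I^{1/q} requires.\<close>

lemma Lp_bound_of_dual: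
  fixes w :: "real \<Rightarrow> 'a::{real_inner, second_countable_topology}"
  assumes w[measurable]: "w \<in> borel_measurable borel" and w0: "\<And>t. t \<le> 0 \<Longrightarrow> w t = 0"
    and pq: "p > 1" "1/p + 1/q = 1" and a: "a \<ge> 0"
    and dual: "\<And>u b. test_fun u \<Longrightarrow> Lp_bound q (- \<sigma>) b u \<Longrightarrow> (\<integral>t. inner (w t) (u t) \<partial>lborel) \<le> a * b"
  shows "Lp_bound p \<sigma> a w"
proof (rule Lp_boundI)
  have "1/q = 1 - 1/p" "1/p < 1" "1/p > 0" using pq by auto
  then have qi: "1/q > 0" "1/q < 1" by linarith+
  then have q1: "q > 1" by (simp add: divide_less_eq_1 zero_less_divide_iff split: if_splits)
  then have q0: "q > 0" by simp
  have pq1: "(p - 1) * q = p"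
    using pq q0 by (simp add: field_simps)
  define x where "x t = (exp (\<sigma> * t) * norm (w t)) powr p" for t
  have [measurable]: "x \<in> borel_measurable borel" unfolding x_def by measurable
  have x0: "x t \<ge> 0" for t by (simp add: x_def)
  define A where "A n = {t. 0 < t \<and> t \<le> real n \<and> norm (w t) \<le> real n}" for n :: nat
  have [measurable]: "A n \<in> sets borel" for n unfolding A_def by measurable
  have main: "(\<integral>\<^sup>+t. ennreal (indicator (A n) t * x t) \<partial>lborel) \<le> ennreal (a powr p)" for n
  proof -
    define v where "v t = (exp (p * \<sigma> * t) * norm (w t) powr (p - 2)) *\<^sub>R w t" for t
    have [measurable]: "v \<in> borel_measurable borel" unfolding v_def by measurable
    have nv: "norm (v t) = exp (p * \<sigma> * t) * norm (w t) powr (p - 1)" for t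
      using pq powr_mult_base[of "norm (w t)" "p - 2"] by (simp add: v_def mult.commute)
    define m where "m = exp (p * \<bar>\<sigma>\<bar> * n) * real n powr (p - 1)"
    define u where "u t = indicator (A n) t *\<^sub>R v t" for t
    have tu: "test_fun u" unfolding u_def
    proof (rule test_fun_truncate)
      fix t assume "t \<in> A n"
      then have t: "0 < t" "t \<le> real n" "norm (w t) \<le> real n" by (auto simp: A_def)
      then have "\<sigma> * t \<le> \<bar>\<sigma>\<bar> * n" by (intro mult_mono) auto
      then have "p * \<sigma> * t \<le> p * \<bar>\<sigma>\<bar> * n" using pq by (simp add: mult.assoc)
      then show "norm (v t) \<le> m" unfolding nv m_def using t pq by (intro mult_mono powr_mono2) auto
    qed (auto simp: A_def)
    have wu: "inner (w t) (u t) = indicator (A n) t * x t" for t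
    proof -
      have "inner (w t) (v t) = exp (p * \<sigma> * t) * (norm (w t) powr (p - 2) * (norm (w t) * norm (w t)))"
        by (simp add: v_def dot_square_norm power2_eq_square)
      also have "norm (w t) powr (p - 2) * (norm (w t) * norm (w t)) = norm (w t) powr p"
      proof (cases "w t = 0")
        case False
        have "norm (w t) * norm (w t) = norm (w t) powr 2" by (simp add: power2_eq_square)
        then show ?thesis by (simp only: powr_add[symmetric]) simp
      qed (use pq in simp)
      also have "exp (p * \<sigma> * t) * norm (w t) powr p = x t"
        by (simp add: x_def powr_mult exp_powr_real mult_ac)
      finally show ?thesis by (simp add: u_def)
    qed
    \<comment> \<open>Source of the finiteness of I: the cut-off of \<open>w\<close> is itself a
      test function, and the p-th power of its weighted norm is the integrand of I.\<close>
    obtain b0 where "Lp_bound p \<sigma> b0 (\<lambda>t. indicator (A n) t *\<^sub>R w t)"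
      by (rule test_fun_Lp[where p=p, OF test_fun_truncate[of w "A n" n n]]) (use pq in \<open>auto simp: A_def\<close>)
    note b0 = Lp_boundD(4)[OF this]
    have ind: "(exp (\<sigma> * t) * norm (indicator (A n) t *\<^sub>R w t)) powr p = indicator (A n) t * x t" for t
      using pq by (simp add: x_def indicator_def)
    have int: "integrable lborel (\<lambda>t. indicator (A n) t * x t)"
      by (rule integrableI_bounded) (use b0 ind x0 in \<open>auto intro: le_less_trans\<close>)
    define I where "I = (\<integral>t. indicator (A n) t * x t \<partial>lborel)"
    have I0: "I \<ge> 0" unfolding I_def using x0 by simp
    have nI: "(\<integral>\<^sup>+t. ennreal (indicator (A n) t * x t) \<partial>lborel) = ennreal I"
      unfolding I_def using x0 by (intro nn_integral_eq_integral int) auto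
    have "Lp_bound q (- \<sigma>) (I powr (1/q)) u"
    proof (rule Lp_boundI)
      have "(exp (- \<sigma> * t) * norm (u t)) powr q = indicator (A n) t * x t" for t
      proof -
        have "(exp (- \<sigma> * t) * norm (v t)) powr q = ((exp (\<sigma> * t) * norm (w t)) powr (p - 1)) powr q"
        proof -
          have "exp (- \<sigma> * t) * norm (v t) = (exp (\<sigma> * t) * norm (w t)) powr (p - 1)"
          proof -
            have "exp (- \<sigma> * t) * exp (p * \<sigma> * t) = exp (\<sigma> * t) powr (p - 1)"
              unfolding exp_powr_real exp_add[symmetric] by (simp add: algebra_simps)
            then show ?thesis unfolding nv powr_mult by (simp add: mult.assoc[symmetric])
          qed
          then show ?thesis by simp
        qed
        also have "\<dots> = x t" by (simp add: x_def powr_powr pq1)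
        finally show ?thesis using q0 by (simp add: u_def indicator_def)
      qed
      then show "(\<integral>\<^sup>+t. ennreal ((exp (- \<sigma> * t) * norm (u t)) powr q) \<partial>lborel) \<le> ennreal ((I powr (1/q)) powr q)"
        using nI I0 q0 by (simp add: powr_powr)
    qed (use tu in \<open>auto simp: u_def A_def test_fun_def\<close>)
    from dual[OF tu this] have le: "I \<le> a * I powr (1/q)" unfolding wu I_def .
    have "I \<le> a powr p"
    proof (cases "I = 0")
      case False
      then have I: "I > 0" using I0 by simp
      have "I = I powr (1/p) * I powr (1/q)" using I pq by (simp add: powr_add[symmetric])
      with le have "I powr (1/p) * I powr (1/q) \<le> a * I powr (1/q)" by simp
      then have "I powr (1/p) \<le> a" using I by simp
      then have "(I powr (1/p)) powr p \<le> a powr p" using pq by (intro powr_mono2) auto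
      then show ?thesis using I pq by (simp add: powr_powr)
    qed simp
    then show ?thesis using nI by (simp add: ennreal_leI)
  qed
  have lim: "(\<lambda>n. ennreal (indicator (A n) t * x t)) \<longlonglongrightarrow> ennreal (x t)" for t
  proof (cases "t > 0")
    case True
    obtain N :: nat where N: "max t (norm (w t)) \<le> N" using real_arch_simple by blast
    have "eventually (\<lambda>n. ennreal (indicator (A n) t * x t) = ennreal (x t)) sequentially"
      using eventually_ge_at_top[of N] by eventually_elim (use N True in \<open>auto simp: A_def indicator_def\<close>)
    then show ?thesis by (rule tendsto_eventually)
  qed (use w0 pq in \<open>simp add: x_def\<close>)
  have "(\<integral>\<^sup>+t. ennreal (x t) \<partial>lborel)
      = (\<integral>\<^sup>+t. liminf (\<lambda>n. ennreal (indicator (A n) t * x t)) \<partial>lborel)"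
    by (intro nn_integral_cong) (metis lim lim_imp_Liminf trivial_limit_sequentially)
  also have "\<dots> \<le> liminf (\<lambda>n. \<integral>\<^sup>+t. ennreal (indicator (A n) t * x t) \<partial>lborel)"
    by (intro nn_integral_liminf) measurable
  also have "\<dots> \<le> liminf (\<lambda>n::nat. ennreal (a powr p))"
    by (intro Liminf_mono always_eventually allI main)
  finally show "(\<integral>\<^sup>+t. ennreal ((exp (\<sigma> * t) * norm (w t)) powr p) \<partial>lborel) \<le> ennreal (a powr p)"
    by (simp add: x_def Liminf_const)
qed (use w w0 a in auto)

lemma Lp_bound_dominated_convergence:
  fixes g :: "nat \<Rightarrow> real \<Rightarrow> 'a::{real_normed_vector, second_countable_topology}"
  assumes f: "Lp_bound p \<sigma> a f" and p: "p \<ge> 1" and c: "c \<ge> 0" and e: "e > 0"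
    and [measurable]: "\<And>n. g n \<in> borel_measurable borel" and g0: "\<And>n t. t \<le> 0 \<Longrightarrow> g n t = 0"
    and dom: "\<And>n t. norm (g n t) \<le> c * norm (f t)" and lim: "\<And>t. (\<lambda>n. g n t) \<longlonglongrightarrow> 0"
  obtains n where "Lp_bound p \<sigma> e (g n)"
proof -
  note D = Lp_boundD[OF f]
  have [measurable]: "f \<in> borel_measurable borel" using D by simp
  have "(\<lambda>n. \<integral>\<^sup>+t. ennreal ((exp (\<sigma> * t) * norm (g n t)) powr p) \<partial>lborel)
      \<longlonglongrightarrow> (\<integral>\<^sup>+t. ennreal 0 \<partial>(lborel::real measure))"
  proof (rule nn_integral_dominated_convergence)
    show "(\<integral>\<^sup>+t. ennreal (c powr p) * ennreal ((exp (\<sigma> * t) * norm (f t)) powr p) \<partial>lborel) < \<infinity>"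
      using D(4) by (subst nn_integral_cmult) (auto intro: le_less_trans simp: ennreal_mult_less_top)
    show "AE t in lborel. ennreal ((exp (\<sigma> * t) * norm (g n t)) powr p)
        \<le> ennreal (c powr p) * ennreal ((exp (\<sigma> * t) * norm (f t)) powr p)" for n
    proof (intro AE_I2)
      fix t
      have "exp (\<sigma> * t) * norm (g n t) \<le> c * (exp (\<sigma> * t) * norm (f t))"
        using mult_left_mono[OF dom[of n t] exp_ge_zero[of "\<sigma> * t"]] by (simp add: mult_ac)
      then have "(exp (\<sigma> * t) * norm (g n t)) powr p \<le> (c * (exp (\<sigma> * t) * norm (f t))) powr p"
        using p by (intro powr_mono2) auto
      also have "\<dots> = c powr p * (exp (\<sigma> * t) * norm (f t)) powr p" by (intro powr_mult)
      finally show "ennreal ((exp (\<sigma> * t) * norm (g n t)) powr p)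
        \<le> ennreal (c powr p) * ennreal ((exp (\<sigma> * t) * norm (f t)) powr p)"
        unfolding ennreal_mult[symmetric, OF powr_ge_zero powr_ge_zero] by (rule ennreal_leI)
    qed
    show "AE t in lborel. (\<lambda>n. ennreal ((exp (\<sigma> * t) * norm (g n t)) powr p)) \<longlonglongrightarrow> ennreal 0"
    proof (intro AE_I2 tendsto_ennrealI)
      fix t
      have "(\<lambda>n. (exp (\<sigma> * t) * norm (g n t)) powr p) \<longlonglongrightarrow> (exp (\<sigma> * t) * norm (0::'a)) powr p"
        using p by (intro tendsto_intros tendsto_powr2 lim) auto
      then show "(\<lambda>n. (exp (\<sigma> * t) * norm (g n t)) powr p) \<longlonglongrightarrow> 0" by simp
    qed
  qed measurable
  then have "eventually (\<lambda>n. (\<integral>\<^sup>+t. ennreal ((exp (\<sigma> * t) * norm (g n t)) powr p) \<partial>lborel) < ennreal (e powr p)) sequentially"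
    using e by (intro order_tendstoD(2)[where a = "ennreal (e powr p)"]) (auto simp: zero_less_iff_neq_zero)
  then obtain n where "(\<integral>\<^sup>+t. ennreal ((exp (\<sigma> * t) * norm (g n t)) powr p) \<partial>lborel) < ennreal (e powr p)"
    by (auto simp: eventually_sequentially)
  then show ?thesis using e g0 by (intro that[of n] Lp_boundI) auto
qed

lemma test_fun_dense:
  fixes f :: "real \<Rightarrow> 'a::{real_normed_vector, second_countable_topology}"
  assumes f: "Lp_bound p \<sigma> a f" and p: "p \<ge> 1" and e: "e > 0"
  obtains u where "test_fun u" "Lp_bound p \<sigma> e (\<lambda>t. f t - u t)"
proof -
  note D = Lp_boundD[OF f]
  have [measurable]: "f \<in> borel_measurable borel" using D by simp
  define A where "A n = {t. 0 < t \<and> t \<le> real n \<and> norm (f t) \<le> real n}" for n :: nat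
  have [measurable]: "A n \<in> sets borel" for n unfolding A_def by measurable
  obtain n where "Lp_bound p \<sigma> e (\<lambda>t. f t - indicator (A n) t *\<^sub>R f t)"
  proof (rule Lp_bound_dominated_convergence[OF f p zero_le_one e])
    show "(\<lambda>n. f t - indicator (A n) t *\<^sub>R f t) \<longlonglongrightarrow> 0" for t
    proof (cases "t > 0")
      case True
      obtain N :: nat where N: "max t (norm (f t)) \<le> N" using real_arch_simple by blast
      have "eventually (\<lambda>n. f t - indicator (A n) t *\<^sub>R f t = 0) sequentially"
        using eventually_ge_at_top[of N] by eventually_elim (use N True in \<open>auto simp: A_def indicator_def\<close>)
      then show ?thesis by (rule tendsto_eventually)
    qed (use D in simp)
    show "norm (f t - indicator (A n) t *\<^sub>R f t) \<le> 1 * norm (f t)" for n t by (simp add: indicator_def)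
  qed (use D in auto)
  moreover have "test_fun (\<lambda>t. indicator (A n) t *\<^sub>R f t)"
    by (rule test_fun_truncate[where n=n and m=n]) (auto simp: A_def)
  ultimately show ?thesis by (rule that[rotated])
qed

text \<open>\<open>v\<close> is replaced by a simple function, and its finitely many values by
  nearby points of the range of \<open>J\<close>. Finiteness bounds the chosen preimages by a
  multiple of the values; measuring the error relative to the value makes it integrable and sends 0
  to 0.\<close>

lemma Lp_bound_dense_range:
  fixes v :: "real \<Rightarrow> 'a::{real_normed_vector, second_countable_topology}"
    and J :: "'b::{real_normed_vector, second_countable_topology} \<Rightarrow> 'a"
  assumes v: "Lp_bound p \<sigma> a v" and p: "p \<ge> 1" and e: "e > 0"
    and J: "bounded_linear J" and dense: "closure (range J) = UNIV"
  obtains y b where "Lp_bound p \<sigma> b y" "Lp_bound p \<sigma> e (\<lambda>t. v t - J (y t))"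
proof -
  note D = Lp_boundD[OF v]
  have [measurable]: "v \<in> borel_measurable borel" using D by simp
  have J0: "J 0 = 0" using J by (intro linear_0 bounded_linear.linear)
  have [measurable]: "J \<in> borel_measurable borel"
    using J by (intro borel_measurable_continuous_onI linear_continuous_on)
  obtain F where F: "\<And>i. simple_function borel (F i)" "\<And>x. (\<lambda>i. F i x) \<longlonglongrightarrow> v x"
    and F2: "\<And>i x. norm (F i x) \<le> 2 * norm (v x)"
    using borel_measurable_implies_sequence_metric[of v borel 0] by (auto simp: dist_norm)
  have [measurable]: "F i \<in> borel_measurable borel" for i using F(1) by (rule borel_measurable_simple_function)
  have F0: "F i t = 0" if "t \<le> 0" for i t using F2[of i t] D(2)[OF that] by simp
  obtain i where i: "Lp_bound p \<sigma> (e/4) (\<lambda>t. v t - F i t)"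
  proof (rule Lp_bound_dominated_convergence[OF v p, of 3 "e/4"])
    show "norm (v t - F i t) \<le> 3 * norm (v t)" for i t
      using norm_triangle_ineq4[of "v t" "F i t"] F2[of i t] by simp
    show "(\<lambda>n. v t - F n t) \<longlonglongrightarrow> 0" for t using tendsto_diff[OF tendsto_const F(2)[of t], of "v t"] by simp
  qed (use e F0 D in auto)
  \<comment> \<open>The relative error gets a factor 2 because the simple functions are bounded by
    twice the norm of \<open>v\<close>. With this value 2 (e/4 + 2 h a) \<le> e, where the outer 2
    is the factor of \<open>Lp_bound_add\<close>.\<close>
  define h where "h = e / (8 * (a + 1))"
  have h: "h > 0" using e D by (simp add: h_def)
  have "\<exists>y. norm (x - J y) \<le> h * norm x \<and> (x = 0 \<longrightarrow> y = 0)" for x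
  proof (cases "x = 0")
    case False
    have "x \<in> closure (range J)" using dense by simp
    then obtain z where "z \<in> range J" "dist z x < h * norm x"
      using h False unfolding closure_approachable by (metis mult_pos_pos zero_less_norm_iff)
    then show ?thesis using False by (auto simp: dist_norm norm_minus_commute intro: less_imp_le)
  qed (use J0 in auto)
  then obtain j where j: "\<And>x. norm (x - J (j x)) \<le> h * norm x" "j 0 = 0" by metis
  have sf: "simple_function borel (\<lambda>t. j (F i t))" by (rule simple_function_compose1[OF F(1)])
  have [measurable]: "(\<lambda>t. j (F i t)) \<in> borel_measurable borel" using sf by (rule borel_measurable_simple_function)
  have fin: "finite (range (F i))" using simple_functionD(1)[OF F(1)[of i]] by simp
  define b where "b = (\<Sum>x\<in>range (F i). norm (j x) / norm x)"
  have b: "norm (j (F i t)) \<le> b * norm (F i t)" for t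
  proof (cases "F i t = 0")
    case False
    have "norm (j (F i t)) / norm (F i t) \<le> b"
      unfolding b_def by (rule member_le_sum[of "F i t"]) (use fin in auto)
    then show ?thesis using False by (simp add: divide_le_eq)
  qed (use j in simp)
  have b0: "b \<ge> 0" unfolding b_def by (intro sum_nonneg) auto
  have y: "Lp_bound p \<sigma> ((b * 2) * a) (\<lambda>t. j (F i t))"
  proof (rule Lp_bound_dominated[OF v p])
    show "AE t in lborel. t > 0 \<longrightarrow> exp (\<sigma> * t) * norm (j (F i t)) \<le> b * 2 * (exp (\<sigma> * t) * norm (v t))"
    proof (intro AE_I2 impI)
      fix t
      have "norm (j (F i t)) \<le> b * (2 * norm (v t))"
        using b[of t] mult_left_mono[OF F2[of i t] b0] by linarith
      then show "exp (\<sigma> * t) * norm (j (F i t)) \<le> b * 2 * (exp (\<sigma> * t) * norm (v t))"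
        using mult_left_mono[of _ _ "exp (\<sigma> * t)"] by (fastforce simp: mult_ac)
    qed
  qed (use b0 F0 j in auto)
  have d: "Lp_bound p \<sigma> ((h * 2) * a) (\<lambda>t. F i t - J (j (F i t)))"
  proof (rule Lp_bound_dominated[OF v p])
    show "AE t in lborel. t > 0 \<longrightarrow> exp (\<sigma> * t) * norm (F i t - J (j (F i t))) \<le> h * 2 * (exp (\<sigma> * t) * norm (v t))"
    proof (intro AE_I2 impI)
      fix t
      have "norm (F i t - J (j (F i t))) \<le> h * (2 * norm (v t))"
        using j(1)[of "F i t"] mult_left_mono[OF F2[of i t] less_imp_le[OF h]] by linarith
      then show "exp (\<sigma> * t) * norm (F i t - J (j (F i t))) \<le> h * 2 * (exp (\<sigma> * t) * norm (v t))"
        using mult_left_mono[of _ _ "exp (\<sigma> * t)"] by (fastforce simp: mult_ac)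
    qed
  qed (use h F0 j J0 in auto)
  have "Lp_bound p \<sigma> (2 * (e/4 + h * 2 * a)) (\<lambda>t. (v t - F i t) + (F i t - J (j (F i t))))"
    by (rule Lp_bound_add[OF i d p])
  moreover have "2 * (e/4 + h * 2 * a) \<le> e"
    using e D(3) by (simp add: h_def field_simps)
  ultimately have "Lp_bound p \<sigma> e (\<lambda>t. v t - J (j (F i t)))"
    using Lp_bound_mono p by fastforce
  with y show ?thesis by (rule that)
qed

lemma Lp_bound_2_iff:
  fixes f :: "real \<Rightarrow> 'a::{real_normed_vector, second_countable_topology}"
  assumes "f \<in> borel_measurable borel" "\<And>t. t \<le> 0 \<Longrightarrow> f t = 0" "a \<ge> 0"
  shows "Lp_bound 2 \<sigma> a f \<longleftrightarrow> integrable lborel (\<lambda>t. (exp (\<sigma> * t) * norm (f t))\<^sup>2) \<and>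
    (\<integral>t. (exp (\<sigma> * t) * norm (f t))\<^sup>2 \<partial>lborel) \<le> a\<^sup>2"
proof -
  have [measurable]: "f \<in> borel_measurable borel" by fact
  have e: "(exp (\<sigma> * t) * norm (f t)) powr 2 = (exp (\<sigma> * t) * norm (f t))\<^sup>2" for t by simp
  have ea: "a powr 2 = a\<^sup>2" using assms(3) by simp
  show ?thesis
  proof
    assume L: "Lp_bound 2 \<sigma> a f"
    have b: "(\<integral>\<^sup>+t. ennreal ((exp (\<sigma> * t) * norm (f t))\<^sup>2) \<partial>lborel) \<le> ennreal (a\<^sup>2)"
      using Lp_boundD(4)[OF L] unfolding e ea .
    have i: "integrable lborel (\<lambda>t. (exp (\<sigma> * t) * norm (f t))\<^sup>2)"
      by (rule integrableI_bounded) (use b in \<open>auto intro: le_less_trans\<close>)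
    have "ennreal (\<integral>t. (exp (\<sigma> * t) * norm (f t))\<^sup>2 \<partial>lborel) \<le> ennreal (a\<^sup>2)"
      using b nn_integral_eq_integral[OF i] by simp
    with i show "integrable lborel (\<lambda>t. (exp (\<sigma> * t) * norm (f t))\<^sup>2) \<and>
      (\<integral>t. (exp (\<sigma> * t) * norm (f t))\<^sup>2 \<partial>lborel) \<le> a\<^sup>2" by simp
  next
    assume i: "integrable lborel (\<lambda>t. (exp (\<sigma> * t) * norm (f t))\<^sup>2) \<and>
      (\<integral>t. (exp (\<sigma> * t) * norm (f t))\<^sup>2 \<partial>lborel) \<le> a\<^sup>2"
    then have "(\<integral>\<^sup>+t. ennreal ((exp (\<sigma> * t) * norm (f t))\<^sup>2) \<partial>lborel) \<le> ennreal (a\<^sup>2)"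
      by (subst nn_integral_eq_integral) (auto intro: ennreal_leI)
    then show "Lp_bound 2 \<sigma> a f" using assms by (intro Lp_boundI) (simp_all only: e ea)
  qed
qed

text \<open>In L^2 the square root of the integral is itself an admissible bound; arguments that
  need the exact norm replace a given bound by it.\<close>

lemma Lp_bound_2D:
  fixes f :: "real \<Rightarrow> 'a::{real_normed_vector, second_countable_topology}"
  assumes "Lp_bound 2 \<sigma> a f"
  shows "integrable lborel (\<lambda>t. (exp (\<sigma> * t) * norm (f t))\<^sup>2)"
    "(\<integral>t. (exp (\<sigma> * t) * norm (f t))\<^sup>2 \<partial>lborel) \<le> a\<^sup>2"
    "Lp_bound 2 \<sigma> (sqrt (\<integral>t. (exp (\<sigma> * t) * norm (f t))\<^sup>2 \<partial>lborel)) f"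
proof -
  note D = Lp_boundD[OF assms]
  show 1: "integrable lborel (\<lambda>t. (exp (\<sigma> * t) * norm (f t))\<^sup>2)"
    "(\<integral>t. (exp (\<sigma> * t) * norm (f t))\<^sup>2 \<partial>lborel) \<le> a\<^sup>2"
    using Lp_bound_2_iff[OF D(1-3), of \<sigma>] assms by auto
  show "Lp_bound 2 \<sigma> (sqrt (\<integral>t. (exp (\<sigma> * t) * norm (f t))\<^sup>2 \<partial>lborel)) f"
    using 1 D by (subst Lp_bound_2_iff) (auto intro!: Bochner_Integration.integral_nonneg)
qed

section \<open>Two facts on Hilbert spaces\<close>

text \<open>The representing vector is the limit of a minimising sequence of \<open>(norm (J y))\<^sup>2 / 2 - f y\<close>; hence
  neither \<open>J\<close> needs to be injective nor its range closed.\<close>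

lemma Riesz_representation:
  fixes J :: "'v::real_vector \<Rightarrow> 'h::{real_inner, banach}" and f :: "'v \<Rightarrow> real"
  assumes J: "linear J" and f: "linear f" and le: "\<And>y. \<bar>f y\<bar> \<le> C * norm (J y)" and C: "C \<ge> 0"
  obtains l where "norm l \<le> C" "\<And>y. inner l (J y) = f y" "l \<in> closure (range J)"
proof -
  note lin = linear_add[OF J] linear_add[OF f] linear_scale[OF J] linear_scale[OF f]
  define \<phi> where "\<phi> y = (norm (J y))\<^sup>2 / 2 - f y" for y
  have lb: "\<phi> y \<ge> - C\<^sup>2 / 2" for y
  proof -
    have "0 \<le> (norm (J y) - C)\<^sup>2" by simp
    then show ?thesis using le[of y] by (simp add: \<phi>_def power2_eq_square algebra_simps abs_le_iff)
  qed
  define d where "d = Inf (range \<phi>)"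
  have bb: "bdd_below (range \<phi>)" using lb by (intro bdd_belowI[of _ "- C\<^sup>2 / 2"]) auto
  have d: "d \<le> \<phi> y" for y unfolding d_def by (intro cInf_lower bb) auto
  have "\<exists>y. \<phi> y < d + 1 / Suc n" for n
  proof -
    have "\<exists>x\<in>range \<phi>. x < d + 1 / Suc n"
      using bb by (subst cInf_less_iff[symmetric]) (auto simp: d_def)
    then show ?thesis by auto
  qed
  then obtain y where y: "\<And>n. \<phi> (y n) < d + 1 / Suc n" by metis
  \<comment> \<open>Parallelogram identity for the minimised functional: since the midpoint has
    value at least \<open>d\<close>, two near-minimisers have nearby images under
    \<open>J\<close>.\<close>
  have par: "(norm (J a - J b))\<^sup>2 = 4 * (\<phi> a + \<phi> b) - 8 * \<phi> ((1/2) *\<^sub>R (a + b))" for a b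
    by (simp add: \<phi>_def lin power_divide power2_norm_eq_inner inner_add_left inner_add_right
        inner_diff_left inner_diff_right inner_commute field_simps)
  have cau: "(norm (J (y m) - J (y n)))\<^sup>2 \<le> 4 * (1 / Suc m + 1 / Suc n)" for m n
    using d[of "(1/2) *\<^sub>R (y m + y n)"] y[of m] y[of n] unfolding par by simp
  have "Cauchy (\<lambda>n. J (y n))"
  proof (rule metric_CauchyI)
    fix e :: real assume e: "e > 0"
    obtain N :: nat where N: "8 / e\<^sup>2 < N" using reals_Archimedean2 by blast
    show "\<exists>M. \<forall>m\<ge>M. \<forall>n\<ge>M. dist (J (y m)) (J (y n)) < e"
    proof (intro exI allI impI)
      fix m n assume mn: "m \<ge> N" "n \<ge> N"
      have "N > 0" using N e by (metis gr0I less_le_not_le of_nat_0 zero_le_divide_iff zero_le_numeral zero_le_power2)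
      then have "1 / Suc m < 1 / N" "1 / Suc n < 1 / N" using mn by (auto simp: field_simps)
      then have "(norm (J (y m) - J (y n)))\<^sup>2 < 8 / N" using cau[of m n] by simp
      also have "8 / N < e\<^sup>2" using N e \<open>N > 0\<close> by (simp add: field_simps)
      finally show "dist (J (y m)) (J (y n)) < e"
        using e by (simp add: dist_norm power2_less_imp_less)
    qed
  qed
  then obtain l where l: "(\<lambda>n. J (y n)) \<longlonglongrightarrow> l" using Cauchy_convergent convergent_def by blast
  have eq: "inner l (J x) = f x" for x
  proof (rule ccontr)
    assume ne: "inner l (J x) \<noteq> f x"
    \<comment> \<open>First variation in the direction \<open>x\<close>. It is carried out along the
      minimising sequence because the limit \<open>l\<close> need not lie in the range of
      \<open>J\<close>.\<close>
    have ineq: "0 \<le> s * (inner l (J x) - f x) + s\<^sup>2 * (norm (J x))\<^sup>2 / 2" for s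
    proof -
      have *: "- (1 / Suc n) \<le> s * (inner (J (y n)) (J x) - f x) + s\<^sup>2 * (norm (J x))\<^sup>2 / 2" for n
      proof -
        have "\<phi> (y n + s *\<^sub>R x) - \<phi> (y n)
            = s * (inner (J (y n)) (J x) - f x) + s\<^sup>2 * (norm (J x))\<^sup>2 / 2"
        proof -
          have "(norm (u + s *\<^sub>R v))\<^sup>2 = (norm u)\<^sup>2 + 2 * s * inner u v + s\<^sup>2 * (norm v)\<^sup>2" for u v :: 'h
            unfolding power2_norm_eq_inner
            by (simp add: inner_add_left inner_add_right inner_commute power2_eq_square algebra_simps)
          then show ?thesis by (simp add: \<phi>_def lin algebra_simps)
        qed
        then show ?thesis using d[of "y n + s *\<^sub>R x"] y[of n] by simp
      qed
      have "(\<lambda>n. - (1 / real (Suc n))) \<longlonglongrightarrow> - 0"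
        using LIMSEQ_inverse_real_of_nat by (intro tendsto_minus) (simp add: inverse_eq_divide)
      moreover have "(\<lambda>n. s * (inner (J (y n)) (J x) - f x) + s\<^sup>2 * (norm (J x))\<^sup>2 / 2)
          \<longlonglongrightarrow> s * (inner l (J x) - f x) + s\<^sup>2 * (norm (J x))\<^sup>2 / 2"
        by (intro tendsto_intros l)
      ultimately show ?thesis using * by (intro LIMSEQ_le[of "\<lambda>n. - (1 / real (Suc n))" "0"]) auto
    qed
    \<comment> \<open>The step -\<Delta>/K minimises the quadratic in s once its leading coefficient
      is enlarged to K/2; the summand 1 in K keeps it positive when \<open>J x\<close>
      vanishes.\<close>
    define \<Delta> where "\<Delta> = inner l (J x) - f x"
    define K where "K = (norm (J x))\<^sup>2 + 1"
    have K: "K > 0" unfolding K_def by (rule add_nonneg_pos) auto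
    have "0 \<le> (- \<Delta> / K) * \<Delta> + (- \<Delta> / K)\<^sup>2 * (norm (J x))\<^sup>2 / 2" using ineq unfolding \<Delta>_def .
    also have "\<dots> \<le> (- \<Delta> / K) * \<Delta> + (- \<Delta> / K)\<^sup>2 * K / 2"
      by (intro add_left_mono divide_right_mono mult_left_mono) (auto simp: K_def)
    also have "\<dots> = - \<Delta>\<^sup>2 / (2 * K)" using K by (simp add: power2_eq_square field_simps)
    also have "\<dots> < 0" using K ne by (simp add: \<Delta>_def)
    finally show False by simp
  qed
  have "norm l \<le> C"
  proof (cases "l = 0")
    case False
    have "(\<lambda>n. inner l (J (y n))) \<longlonglongrightarrow> inner l l" by (intro tendsto_intros l)
    moreover have "(\<lambda>n. C * norm (J (y n))) \<longlonglongrightarrow> C * norm l" by (intro tendsto_intros l)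
    moreover have "inner l (J (y n)) \<le> C * norm (J (y n))" for n using le[of "y n"] by (simp add: eq abs_le_iff)
    ultimately have "inner l l \<le> C * norm l" by (intro LIMSEQ_le) auto
    then show ?thesis using False by (simp add: dot_square_norm power2_eq_square)
  qed (use C in simp)
  moreover have "l \<in> closure (range J)" using l unfolding closure_sequential
    by (intro exI[of _ "\<lambda>n. J (y n)"]) auto
  ultimately show ?thesis using eq by (intro that)
qed

text \<open>Pettis' theorem in a separable Hilbert space. A closed ball is the intersection of
  countably many half-spaces whose normals run through a countable dense set, and an open set is a
  countable union of closed balls with centres in that set.\<close>

lemma measurable_of_weak:
  fixes f :: "'a \<Rightarrow> 'b::{real_inner, second_countable_topology}"
  assumes X: "closure X = UNIV" and w: "\<And>x. x \<in> X \<Longrightarrow> (\<lambda>t. inner (f t) x) \<in> borel_measurable M"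
  shows "f \<in> borel_measurable M"
proof -
  have all[measurable]: "(\<lambda>t. inner (f t) x) \<in> borel_measurable M" for x
  proof -
    have "x \<in> closure X" using X by simp
    then obtain y where y: "\<And>n. y n \<in> X" "y \<longlonglongrightarrow> x" unfolding closure_sequential by blast
    show ?thesis
      by (rule borel_measurable_LIMSEQ_metric[of "\<lambda>n t. inner (f t) (y n)"])
        (auto intro!: w y tendsto_intros)
  qed
  obtain D :: "'b set" where D: "countable D" "\<And>Z. open Z \<Longrightarrow> Z \<noteq> {} \<Longrightarrow> \<exists>d\<in>D. d \<in> Z"
    using countable_dense_exists by blast
  have cl: "closure D = UNIV"
  proof (rule ccontr)
    assume "closure D \<noteq> UNIV"
    then show False using D(2)[of "- closure D"] closure_subset[of D] by auto
  qed
  have ball: "f -` cball z c \<inter> space M \<in> sets M" for z and c :: real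
  proof -
    have "norm (v - z) \<le> c \<longleftrightarrow> (\<forall>d\<in>D. inner (v - z) d \<le> c * norm d) \<and> 0 \<le> c" (is "_ \<longleftrightarrow> ?r") for v
    proof
      assume "norm (v - z) \<le> c"
      then show ?r using norm_cauchy_schwarz[of "v - z"] norm_ge_zero[of "v - z"]
        by (meson mult_right_mono norm_ge_zero order_trans)
    next
      assume r: ?r
      have "v - z \<in> closure D" using cl by simp
      then obtain y where y: "\<And>n. y n \<in> D" "y \<longlonglongrightarrow> v - z" unfolding closure_sequential by blast
      have "inner (v - z) (v - z) \<le> c * norm (v - z)"
      proof (rule LIMSEQ_le)
        show "(\<lambda>n. inner (v - z) (y n)) \<longlonglongrightarrow> inner (v - z) (v - z)" by (intro tendsto_intros y)
        show "(\<lambda>n. c * norm (y n)) \<longlonglongrightarrow> c * norm (v - z)" by (intro tendsto_intros y)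
      qed (use r y in auto)
      then show "norm (v - z) \<le> c"
        using r by (cases "v = z") (simp_all add: dot_square_norm power2_eq_square)
    qed
    then have "f -` cball z c \<inter> space M
        = (if 0 \<le> c then {t\<in>space M. \<forall>d\<in>D. inner (f t) d - inner z d \<le> c * norm d} else {})"
    proof -
      assume *: "\<And>v. norm (v - z) \<le> c \<longleftrightarrow> (\<forall>d\<in>D. inner (v - z) d \<le> c * norm d) \<and> 0 \<le> c"
      have "v \<in> cball z c \<longleftrightarrow> (\<forall>d\<in>D. inner v d - inner z d \<le> c * norm d) \<and> 0 \<le> c" for v
        using *[of v] by (simp add: dist_norm norm_minus_commute inner_diff_left)
      then show ?thesis by (auto simp del: mem_cball)
    qed
    moreover have "{t\<in>space M. \<forall>d\<in>D. inner (f t) d - inner z d \<le> c * norm d} \<in> sets M"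
      using D(1) by measurable
    ultimately show ?thesis by simp
  qed
  show ?thesis
  proof (rule borel_measurableI)
    fix S :: "'b set" assume S: "open S"
    define P where "P = {(z, n :: nat). z \<in> D \<and> cball z (1 / Suc n) \<subseteq> S}"
    have "countable P"
      by (rule countable_subset[of _ "D \<times> UNIV"]) (use D(1) in \<open>auto simp: P_def\<close>)
    have "S = (\<Union>(z, n)\<in>P. cball z (1 / Suc n))"
    proof (intro equalityI subsetI)
      fix x assume "x \<in> S"
      then obtain e where e: "e > 0" "ball x e \<subseteq> S" using S open_contains_ball by blast
      obtain n :: nat where n: "1 / Suc n < e / 2" using nat_approx_posE[of "e / 2"] e by auto
      obtain z where z: "z \<in> D" "z \<in> ball x (1 / Suc n)"
        using D(2)[of "ball x (1 / Suc n)"] by auto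
      have "cball z (1 / Suc n) \<subseteq> ball x e"
      proof
        fix u assume "u \<in> cball z (1 / Suc n)"
        then have "dist x u < 1 / Suc n + 1 / Suc n"
          using z dist_triangle_lt[of x z u] dist_triangle[of x u z] by auto
        then show "u \<in> ball x e" using n by simp
      qed
      then have "(z, n) \<in> P" using z e by (auto simp: P_def)
      moreover have "x \<in> cball z (1 / Suc n)" using z by (simp add: dist_commute)
      ultimately show "x \<in> (\<Union>(z, n)\<in>P. cball z (1 / Suc n))" by blast
    qed (auto simp: P_def)
    then have "f -` S \<inter> space M = (\<Union>(z, n)\<in>P. f -` cball z (1 / Suc n) \<inter> space M)" by auto
    also have "\<dots> \<in> sets M" using ball \<open>countable P\<close> by (auto intro!: sets.countable_UN'')
    finally show "f -` S \<inter> space M \<in> sets M" .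
  qed
qed

section \<open>Integral kernels with a power singularity\<close>

text \<open>Scalar majorant for the convolutions: the power carries the singularity of
  \<open>F\<close>, and the summand 1 supplies the plain L^p norm against which \<open>G\<close> is
  estimated by Hoelder's inequality.\<close>

definition kernel_weight :: "real \<Rightarrow> real \<Rightarrow> real \<Rightarrow> real" where
  "kernel_weight \<gamma> \<kappa> a = indicator {0<..} a * (a powr (- \<gamma>) + 1) * exp (- \<kappa> * a)"

lemma kernel_weight_measurable [measurable]: "kernel_weight \<gamma> \<kappa> \<in> borel_measurable borel"
  unfolding kernel_weight_def by measurable

lemma kernel_weight_nonneg: "kernel_weight \<gamma> \<kappa> a \<ge> 0"
  by (simp add: kernel_weight_def)

lemma kernel_weight_exp: "exp (\<mu> * a) * kernel_weight \<gamma> \<kappa> a = kernel_weight \<gamma> (\<kappa> - \<mu>) a"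
proof -
  have "exp (\<mu> * a) * exp (- \<kappa> * a) = exp (- (\<kappa> - \<mu>) * a)"
    unfolding exp_add[symmetric] by (simp add: algebra_simps)
  then show ?thesis by (simp add: kernel_weight_def)
qed

lemma nn_integral_powr_interval:
  assumes "0 < T" "\<gamma> < 1"
  shows "(\<integral>\<^sup>+a. ennreal (indicator {0<..<T} a * a powr (- \<gamma>)) \<partial>lborel) = ennreal (T powr (1 - \<gamma>) / (1 - \<gamma>))"
proof -
  have "((\<lambda>a. a powr (- \<gamma>)) has_integral (T powr (- \<gamma> + 1) / (- \<gamma> + 1))) {0..T}"
    using has_integral_powr_from_0[of "- \<gamma>" T] assms by simp
  then have "(\<integral>\<^sup>+t. ennreal (indicator {0..T} t * t powr (- \<gamma>)) \<partial>lborel) = ennreal (T powr (1 - \<gamma>) / (1 - \<gamma>))"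
    by (subst nn_integral_has_integral_lebesgue[where I = "T powr (1 - \<gamma>) / (1 - \<gamma>)"]) auto
  moreover have "(\<integral>\<^sup>+a. ennreal (indicator {0<..<T} a * a powr (- \<gamma>)) \<partial>lborel)
      = (\<integral>\<^sup>+t. ennreal (indicator {0..T} t * t powr (- \<gamma>)) \<partial>lborel)"
    by (rule nn_integral_cong_AE, use AE_lborel_singleton[of 0] AE_lborel_singleton[of T] in eventually_elim)
      (auto simp: indicator_def)
  ultimately show ?thesis by simp
qed

text \<open>The condition \<gamma> r < 1 makes the singularity integrable near 0; for a \<ge> 1 the
  power is at most 1 and the exponential takes over.\<close>

lemma kernel_weight_integral:
  assumes \<gamma>: "\<gamma> \<ge> 0" and \<kappa>: "\<kappa> > 0" and r: "r \<ge> 1" "\<gamma> * r < 1"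
  obtains G where "G \<ge> 0" "(\<integral>\<^sup>+a. ennreal (kernel_weight \<gamma> \<kappa> a powr r) \<partial>lborel) \<le> ennreal G"
proof -
  have pw: "kernel_weight \<gamma> \<kappa> a powr r
      \<le> 2 powr r * (indicator {0<..<1} a * a powr (- (\<gamma> * r))) + 2 powr r * (indicator {0<..} a * exp (- (r * \<kappa>) * a))" for a
  proof (cases "a > 0")
    case True
    have e: "exp (- \<kappa> * a) powr r = exp (- (r * \<kappa>) * a)" unfolding exp_powr_real by (simp add: mult_ac)
    have k: "kernel_weight \<gamma> \<kappa> a powr r = (a powr (- \<gamma>) + 1) powr r * exp (- (r * \<kappa>) * a)"
      using True e by (simp add: kernel_weight_def powr_mult)
    have e1: "exp (- (r * \<kappa>) * a) \<le> 1" using True \<kappa> r by simp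
    show ?thesis
    proof (cases "a < 1")
      case a1: True
      have "1 \<le> a powr (- \<gamma>)" using True a1 \<gamma> by (simp add: powr_minus powr_le1 one_le_inverse)
      then have "(a powr (- \<gamma>) + 1) powr r \<le> (2 * a powr (- \<gamma>)) powr r" using r by (intro powr_mono2) auto
      also have "\<dots> = 2 powr r * a powr (- (\<gamma> * r))" by (simp add: powr_mult powr_powr)
      finally have "kernel_weight \<gamma> \<kappa> a powr r \<le> 2 powr r * a powr (- (\<gamma> * r)) * 1"
        unfolding k using e1 by (intro mult_mono) auto
      also have "\<dots> \<le> 2 powr r * (indicator {0<..<1} a * a powr (- (\<gamma> * r))) + 2 powr r * (indicator {0<..} a * exp (- (r * \<kappa>) * a))"
        using True a1 by simp
      finally show ?thesis .
    next
      case False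
      then have "a powr (- \<gamma>) \<le> 1" using \<gamma> by (simp add: powr_minus inverse_le_1_iff ge_one_powr_ge_zero)
      then have "(a powr (- \<gamma>) + 1) powr r \<le> 2 powr r" using r by (intro powr_mono2) auto
      then show ?thesis unfolding k using True False by (simp add: mult_right_mono)
    qed
  qed (use r in \<open>simp add: kernel_weight_def\<close>)
  have rl: "r * \<kappa> > 0" using r \<kappa> by simp
  have g1: "1 / (1 - \<gamma> * r) \<ge> 0" using r by simp
  have "(\<integral>\<^sup>+a. ennreal (kernel_weight \<gamma> \<kappa> a powr r) \<partial>lborel)
      \<le> (\<integral>\<^sup>+a. ennreal (2 powr r) * ennreal (indicator {0<..<1} a * a powr (- (\<gamma> * r)))
          + ennreal (2 powr r) * ennreal (indicator {0<..} a * exp (- (r * \<kappa>) * a)) \<partial>lborel)"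
    using pw by (intro nn_integral_mono)
      (simp add: ennreal_mult[symmetric] ennreal_plus[symmetric] del: ennreal_plus)
  also have "\<dots> = ennreal (2 powr r) * ennreal (1 / (1 - \<gamma> * r)) + ennreal (2 powr r) * ennreal (1 / (r * \<kappa>))"
    using nn_integral_powr_interval[OF zero_less_one r(2)] nn_integral_exp_neg[OF rl]
    by (simp add: nn_integral_add nn_integral_cmult)
  also have "\<dots> = ennreal (2 powr r * (1 / (1 - \<gamma> * r)) + 2 powr r * (1 / (r * \<kappa>)))"
  proof -
    have "ennreal x * ennreal y + ennreal x * ennreal z = ennreal (x * y + x * z)"
      if "x \<ge> 0" "y \<ge> 0" "z \<ge> 0" for x y z
      using that by (simp add: ennreal_mult)
    then show ?thesis using g1 rl by simp
  qed
  finally show ?thesis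
    using g1 rl by (intro that[of "2 powr r * (1 / (1 - \<gamma> * r)) + 2 powr r * (1 / (r * \<kappa>))"]) auto
qed

section \<open>The input map in terms of its kernel\<close>

text \<open>\<open>J y\<close> runs through a dense subspace on which the kernel of the input map is defined, and \<open>kk a y\<close>
  is the value of the kernel at time \<open>a\<close> on \<open>J y\<close>. In the application \<open>J\<close> is the inverse of the
  adjoint generator.\<close>

locale control_kernel =
  fixes J :: "'y::{real_inner, banach, second_countable_topology} \<Rightarrow> 'y"
    and kk :: "real \<Rightarrow> 'y \<Rightarrow> 'u::{real_inner, banach, second_countable_topology}"
    and Q :: "'y \<Rightarrow> 'y"
    and \<gamma> \<omega> :: real
  assumes J: "bounded_linear J" and J_dense: "closure (range J) = UNIV"
    and kk_linear: "\<And>a. linear (kk a)"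
    and kk_pair: "(\<lambda>(a, y). kk a y) \<in> borel_measurable (borel \<Otimes>\<^sub>M borel)"
    and kk_neg: "\<And>a y. a < 0 \<Longrightarrow> kk a y = 0"
    and kk_bound: "\<exists>C. \<forall>a y. norm (kk a y) \<le> C * exp (- \<omega> * a) * norm y"
    and \<gamma>: "0 < \<gamma>" "\<gamma> < 1" and \<omega>: "0 < \<omega>"
    and kernel: "\<And>p \<beta>. p > 1 \<Longrightarrow> 0 \<le> \<beta> \<Longrightarrow> \<beta> < \<omega> \<Longrightarrow> \<exists>C\<ge>0. \<forall>w y W. w \<in> borel_measurable borel \<longrightarrow>
        (\<forall>a. 0 \<le> w a) \<longrightarrow> 0 \<le> W \<longrightarrow>
        (\<integral>\<^sup>+a. ennreal (kernel_weight \<gamma> (p * \<beta>) a * w a powr p) \<partial>lborel) \<le> ennreal (W powr p) \<longrightarrow>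
        (\<integral>\<^sup>+a. ennreal (w a * norm (kk a y)) \<partial>lborel) \<le> ennreal (C * W * norm (J y))"
    and Q: "bounded_linear Q" and Q_sym: "\<And>x y. inner (Q x) y = inner x (Q y)"
    and Q_pos: "\<And>x. 0 \<le> inner (Q x) x"
begin

lemma kk_measurable [measurable (raw)]:
  assumes "f \<in> borel_measurable M" "g \<in> borel_measurable M"
  shows "(\<lambda>x. kk (f x) (g x)) \<in> borel_measurable M"
proof -
  have "(\<lambda>x. (f x, g x)) \<in> measurable M (borel \<Otimes>\<^sub>M borel)" using assms by simp
  from measurable_compose[OF this kk_pair] show ?thesis by simp
qed

lemma J_measurable [measurable]: "J \<in> borel_measurable borel"
  using J by (intro borel_measurable_continuous_onI linear_continuous_on)

lemma Q_measurable [measurable]: "Q \<in> borel_measurable borel"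
  using Q by (intro borel_measurable_continuous_onI linear_continuous_on)

lemma J_lim:
  obtains y where "(\<lambda>n. J (y n)) \<longlonglongrightarrow> x"
proof -
  have "x \<in> closure (range J)" using J_dense by simp
  then obtain z where z: "\<And>n. z n \<in> range J" "z \<longlonglongrightarrow> x" unfolding closure_sequential by blast
  have "\<forall>n. \<exists>y. z n = J y" using z(1) by blast
  then obtain y where "\<forall>n. z n = J (y n)" by metis
  then have "z = (\<lambda>n. J (y n))" by auto
  then show ?thesis using z(2) by (intro that[of y]) simp
qed

lemma norm_le_dense:
  assumes "\<And>y. inner l (J y) \<le> C * norm (J y)" "C \<ge> 0"
  shows "norm l \<le> C"
proof (cases "l = 0")
  case False
  obtain y where y: "(\<lambda>n. J (y n)) \<longlonglongrightarrow> l" by (rule J_lim)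
  have "inner l l \<le> C * norm l"
  proof (rule LIMSEQ_le)
    show "(\<lambda>n. inner l (J (y n))) \<longlonglongrightarrow> inner l l" by (intro tendsto_intros y)
    show "(\<lambda>n. C * norm (J (y n))) \<longlonglongrightarrow> C * norm l" by (intro tendsto_intros y)
  qed (use assms in auto)
  then show ?thesis using False by (simp add: dot_square_norm power2_eq_square)
qed (use assms in simp)

lemma eq_dense:
  assumes "\<And>y. inner l (J y) = inner l' (J y)"
  shows "l = l'"
proof -
  have "norm (l - l') \<le> 0" by (rule norm_le_dense) (auto simp: inner_diff_left assms)
  then show ?thesis by simp
qed

text \<open>\<open>l\<close> represents (Lu)(t), tested only against the dense range of
  \<open>J\<close>, where the kernel takes values in the control space. Integrability is part of the
  definition because a divergent integral would be read as 0.\<close>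

definition is_input :: "(real \<Rightarrow> 'u) \<Rightarrow> real \<Rightarrow> 'y \<Rightarrow> bool" where
  "is_input u t l \<longleftrightarrow> (\<forall>y. integrable lborel (\<lambda>s. inner (u s) (kk (t - s) y)) \<and>
     inner l (J y) = (\<integral>s. inner (u s) (kk (t - s) y) \<partial>lborel))"

lemma is_input_unique: "is_input u t l \<Longrightarrow> is_input u t l' \<Longrightarrow> l = l'"
  by (rule eq_dense) (simp add: is_input_def)

lemma is_input_lincomb:
  assumes "is_input u t l" "is_input v t m"
  shows "is_input (\<lambda>s. c *\<^sub>R u s + v s) t (c *\<^sub>R l + m)"
  using assms by (auto simp: is_input_def inner_add_left)

lemma kernel_convolution:
  assumes "p > 1" "0 \<le> \<beta>" "\<beta> < \<omega>"
  shows "\<exists>C\<ge>0. \<forall>w t y W. w \<in> borel_measurable borel \<longrightarrow> (\<forall>a. 0 \<le> w a) \<longrightarrow> 0 \<le> W \<longrightarrow>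
       (\<integral>\<^sup>+s. ennreal (kernel_weight \<gamma> (p * \<beta>) (t - s) * w s powr p) \<partial>lborel) \<le> ennreal (W powr p) \<longrightarrow>
       (\<integral>\<^sup>+s. ennreal (w s * norm (kk (t - s) y)) \<partial>lborel) \<le> ennreal (C * W * norm (J y))"
proof -
  obtain C where C: "C \<ge> 0" and *: "\<And>w y W. w \<in> borel_measurable borel \<Longrightarrow> (\<forall>a. 0 \<le> w a) \<Longrightarrow> 0 \<le> W \<Longrightarrow>
       (\<integral>\<^sup>+a. ennreal (kernel_weight \<gamma> (p * \<beta>) a * w a powr p) \<partial>lborel) \<le> ennreal (W powr p) \<Longrightarrow>
       (\<integral>\<^sup>+a. ennreal (w a * norm (kk a y)) \<partial>lborel) \<le> ennreal (C * W * norm (J y))"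
    using kernel[OF assms] by blast
  show ?thesis
  proof (intro exI[of _ C] conjI C allI impI)
    fix w :: "real \<Rightarrow> real" and t W y
    assume [measurable]: "w \<in> borel_measurable borel" and w: "\<forall>a. 0 \<le> w a" and W: "0 \<le> W"
      and le: "(\<integral>\<^sup>+s. ennreal (kernel_weight \<gamma> (p * \<beta>) (t - s) * w s powr p) \<partial>lborel) \<le> ennreal (W powr p)"
    have "(\<integral>\<^sup>+s. ennreal (w s * norm (kk (t - s) y)) \<partial>lborel)
        = (\<integral>\<^sup>+a. ennreal (w (t - a) * norm (kk a y)) \<partial>lborel)"
      using nn_integral_lborel_reflect[of "\<lambda>a. ennreal (w (t - a) * norm (kk a y))" t] by simp
    moreover have "(\<integral>\<^sup>+s. ennreal (kernel_weight \<gamma> (p * \<beta>) (t - s) * w s powr p) \<partial>lborel)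
        = (\<integral>\<^sup>+a. ennreal (kernel_weight \<gamma> (p * \<beta>) a * w (t - a) powr p) \<partial>lborel)"
      using nn_integral_lborel_reflect[of "\<lambda>a. ennreal (kernel_weight \<gamma> (p * \<beta>) a * w (t - a) powr p)" t] by simp
    ultimately show "(\<integral>\<^sup>+s. ennreal (w s * norm (kk (t - s) y)) \<partial>lborel) \<le> ennreal (C * W * norm (J y))"
      using *[of "\<lambda>a. w (t - a)" W y] le w W by simp
  qed
qed

text \<open>The kernel bound is linear in the norm of \<open>J y\<close>, not merely of
  \<open>y\<close>. The pairing is therefore a bounded functional on the range of \<open>J\<close>
  with the norm of the whole space, and its Riesz vector is the wanted value.\<close>

lemma is_input_exists:
  assumes "p > 1" "0 \<le> \<beta>" "\<beta> < \<omega>"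
  shows "\<exists>C\<ge>0. \<forall>u t W. u \<in> borel_measurable borel \<longrightarrow> 0 \<le> W \<longrightarrow>
       (\<integral>\<^sup>+s. ennreal (kernel_weight \<gamma> (p * \<beta>) (t - s) * norm (u s) powr p) \<partial>lborel) \<le> ennreal (W powr p) \<longrightarrow>
       (\<exists>l. is_input u t l \<and> norm l \<le> C * W)"
proof -
  obtain C where C: "C \<ge> 0" and *: "\<And>w t y W. w \<in> borel_measurable borel \<Longrightarrow> (\<And>a. 0 \<le> w a) \<Longrightarrow> 0 \<le> W \<Longrightarrow>
       (\<integral>\<^sup>+s. ennreal (kernel_weight \<gamma> (p * \<beta>) (t - s) * w s powr p) \<partial>lborel) \<le> ennreal (W powr p) \<Longrightarrow>
       (\<integral>\<^sup>+s. ennreal (w s * norm (kk (t - s) y)) \<partial>lborel) \<le> ennreal (C * W * norm (J y))"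
    using kernel_convolution[OF assms] by blast
  show ?thesis
  proof (intro exI[of _ C] conjI C allI impI)
    fix u :: "real \<Rightarrow> 'u" and t W
    assume [measurable]: "u \<in> borel_measurable borel" and W: "0 \<le> W"
      and le: "(\<integral>\<^sup>+s. ennreal (kernel_weight \<gamma> (p * \<beta>) (t - s) * norm (u s) powr p) \<partial>lborel) \<le> ennreal (W powr p)"
    define f where "f y = (\<integral>s. inner (u s) (kk (t - s) y) \<partial>lborel)" for y
    have b: "(\<integral>\<^sup>+s. ennreal (norm (u s) * norm (kk (t - s) y)) \<partial>lborel) \<le> ennreal (C * W * norm (J y))" for y
      using *[of "\<lambda>s. norm (u s)" W t y] le W by simp
    have int: "integrable lborel (\<lambda>s. inner (u s) (kk (t - s) y))" for y
    proof (rule Bochner_Integration.integrable_bound)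
      show "integrable lborel (\<lambda>s. norm (u s) * norm (kk (t - s) y))"
        by (rule integrableI_bounded) (use b[of y] in \<open>auto intro: le_less_trans\<close>)
    qed (auto simp: Cauchy_Schwarz_ineq2)
    have fb: "\<bar>f y\<bar> \<le> (C * W) * norm (J y)" for y
    proof -
      have "ennreal (norm (f y)) \<le> (\<integral>\<^sup>+s. norm (inner (u s) (kk (t - s) y)) \<partial>lborel)"
        unfolding f_def by (rule integral_norm_bound_ennreal[OF int])
      also have "\<dots> \<le> (\<integral>\<^sup>+s. ennreal (norm (u s) * norm (kk (t - s) y)) \<partial>lborel)"
        by (intro nn_integral_mono ennreal_leI) (simp add: Cauchy_Schwarz_ineq2)
      also note b
      finally show ?thesis using C W by simp
    qed
    have "linear f"
      unfolding f_def using int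
      by (intro linearI) (auto simp: linear_add[OF kk_linear] linear_scale[OF kk_linear] inner_add_right)
    then obtain l where "norm l \<le> C * W" "\<And>y. inner l (J y) = f y"
      using Riesz_representation[OF bounded_linear.linear[OF J] _ fb] C W by auto
    then show "\<exists>l. is_input u t l \<and> norm l \<le> C * W"
      using int by (auto simp: is_input_def f_def)
  qed
qed

text \<open>A Borel representative that vanishes for t \<le> 0 is selected, so that the result can
  again be an argument of \<open>Lp_bound\<close>. The selection says nothing when no such function
  exists, whence the companion predicate \<open>input_defined\<close>.\<close>

definition input :: "(real \<Rightarrow> 'u) \<Rightarrow> real \<Rightarrow> 'y" where
  "input u = (SOME l. l \<in> borel_measurable borel \<and> (\<forall>t\<le>0. l t = 0) \<and> (AE t in lborel. is_input u t (l t)))"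

definition input_defined :: "(real \<Rightarrow> 'u) \<Rightarrow> bool" where
  "input_defined u \<longleftrightarrow> input u \<in> borel_measurable borel \<and> (\<forall>t\<le>0. input u t = 0) \<and>
     (AE t in lborel. is_input u t (input u t))"

lemma is_input_0: "t \<le> 0 \<Longrightarrow> (\<And>s. s \<le> 0 \<Longrightarrow> u s = 0) \<Longrightarrow> is_input u t 0"
proof -
  assume t: "t \<le> 0" and u: "\<And>s. s \<le> 0 \<Longrightarrow> u s = 0"
  have "inner (u s) (kk (t - s) y) = 0" for s y
    using u[of s] kk_neg[of "t - s" y] t by (cases "s \<le> 0") auto
  then show ?thesis by (simp add: is_input_def)
qed

lemma input_bound:
  assumes p: "p > 1" and \<sigma>: "\<sigma> < \<omega>" and r: "r \<ge> 1" "\<gamma> * r < 1"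
  shows "\<exists>C\<ge>0. \<forall>u a. Lp_bound p \<sigma> a u \<longrightarrow> input_defined u \<and> Lp_bound (p * r) \<sigma> (C * a) (input u)"
proof -
  \<comment> \<open>\<beta> < \<omega> keeps the kernel estimate available, and \<beta> > \<sigma>
    leaves the positive decay rate p (\<beta> - \<sigma>) for the scalar kernel. The maximum with 0
    is there because \<sigma> may be negative, as it is for dual weights.\<close>
  define \<beta> where "\<beta> = (max 0 \<sigma> + \<omega>) / 2"
  have \<beta>: "0 \<le> \<beta>" "\<beta> < \<omega>" "\<sigma> < \<beta>" using \<omega> \<sigma> by (auto simp: \<beta>_def)
  obtain C0 where C0: "C0 \<ge> 0" and ex: "\<And>u t W. u \<in> borel_measurable borel \<Longrightarrow> 0 \<le> W \<Longrightarrow>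
       (\<integral>\<^sup>+s. ennreal (kernel_weight \<gamma> (p * \<beta>) (t - s) * norm (u s) powr p) \<partial>lborel) \<le> ennreal (W powr p) \<Longrightarrow>
       \<exists>l. is_input u t l \<and> norm l \<le> C0 * W"
    using is_input_exists[OF p \<beta>(1,2)] by blast
  define \<kappa> where "\<kappa> = p * (\<beta> - \<sigma>)"
  have "\<kappa> > 0" using p \<beta> by (simp add: \<kappa>_def)
  then obtain G where G: "G \<ge> 0" "(\<integral>\<^sup>+a. ennreal (kernel_weight \<gamma> \<kappa> a powr r) \<partial>lborel) \<le> ennreal G"
    using kernel_weight_integral[of \<gamma> \<kappa> r] \<gamma> r by auto
  define C where "C = C0 * G powr (1 / (p * r))"
  have main: "input_defined u \<and> Lp_bound (p * r) \<sigma> (C * a) (input u)" if u: "Lp_bound p \<sigma> a u" for u a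
  proof -
    note D = Lp_boundD[OF u]
    have [measurable]: "u \<in> borel_measurable borel" using D by simp
    define f where "f s = (exp (\<sigma> * s) * norm (u s)) powr p" for s
    have [measurable]: "f \<in> borel_measurable borel" unfolding f_def by measurable
    have f0: "f s \<ge> 0" for s by (simp add: f_def)
    define c where "c t = (\<integral>\<^sup>+s. ennreal (kernel_weight \<gamma> \<kappa> (t - s) * f s) \<partial>lborel)" for t
    have [measurable]: "c \<in> borel_measurable borel" unfolding c_def by measurable
    have cfin: "AE t in lborel. c t < \<infinity>"
      and cint: "(\<integral>\<^sup>+t. ennreal (enn2real (c t) powr r) \<partial>lborel) \<le> ennreal ((a powr p) powr r * G)"
      unfolding c_def by (rule convolution_gain;
          use f0 kernel_weight_nonneg r D G in \<open>auto simp: f_def\<close>)+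
    \<comment> \<open>Since e^{-p\<sigma>s} = e^{-p\<sigma>t} e^{p\<sigma>(t-s)}, the weight of
      \<open>u\<close> leaves the convolution as a factor in t and changes the decay rate of the
      kernel from p \<beta> to \<open>\<kappa>\<close>; the p-th root of the result is
      \<open>W\<close>.\<close>
    define W where "W t = exp (- \<sigma> * t) * enn2real (c t) powr (1/p)" for t
    have W0: "W t \<ge> 0" for t by (simp add: W_def)
    have good: "\<exists>l. is_input u t l \<and> norm l \<le> C0 * W t" if "c t < \<infinity>" for t
    proof (rule ex[OF _ W0])
      have "kernel_weight \<gamma> (p * \<beta>) (t - s) * norm (u s) powr p
          = exp (- (p * \<sigma>) * t) * (kernel_weight \<gamma> \<kappa> (t - s) * f s)" for s
      proof -
        have "kernel_weight \<gamma> (p * \<beta>) (t - s) = exp (- (p * \<sigma>) * (t - s)) * kernel_weight \<gamma> \<kappa> (t - s)"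
          unfolding kernel_weight_exp by (simp add: \<kappa>_def algebra_simps)
        moreover have "norm (u s) powr p = exp (- (p * \<sigma>) * s) * f s"
        proof -
          have "exp (\<sigma> * s) powr p = exp (p * \<sigma> * s)" unfolding exp_powr_real by (simp add: mult_ac)
          then have "f s = exp (p * \<sigma> * s) * norm (u s) powr p" by (simp add: f_def powr_mult)
          then show ?thesis by (simp add: mult.assoc[symmetric] exp_add[symmetric])
        qed
        moreover have "exp (- (p * \<sigma>) * (t - s)) * exp (- (p * \<sigma>) * s) = exp (- (p * \<sigma>) * t)"
          unfolding exp_add[symmetric] by (simp add: algebra_simps)
        moreover have "a * b = z * (k * g)" if "a = x * k" "b = y * g" "x * y = z" for a b x k y g z :: real
          unfolding that(1,2) that(3)[symmetric] by (simp add: mult_ac)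
        ultimately show ?thesis by blast
      qed
      then have "(\<integral>\<^sup>+s. ennreal (kernel_weight \<gamma> (p * \<beta>) (t - s) * norm (u s) powr p) \<partial>lborel)
          = (\<integral>\<^sup>+s. ennreal (exp (- (p * \<sigma>) * t)) * ennreal (kernel_weight \<gamma> \<kappa> (t - s) * f s) \<partial>lborel)"
        using kernel_weight_nonneg f0 by (simp add: ennreal_mult)
      also have "\<dots> = ennreal (exp (- (p * \<sigma>) * t)) * c t" unfolding c_def by (rule nn_integral_cmult) measurable
      also have "\<dots> = ennreal (exp (- (p * \<sigma>) * t) * enn2real (c t))"
        using that by (subst ennreal_mult) auto
      also have "exp (- (p * \<sigma>) * t) * enn2real (c t) = W t powr p"
      proof -
        have "exp (- \<sigma> * t) powr p = exp (- (p * \<sigma>) * t)" unfolding exp_powr_real by (simp add: mult_ac)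
        then show ?thesis using p by (simp add: W_def powr_mult powr_powr)
      qed
      finally show "(\<integral>\<^sup>+s. ennreal (kernel_weight \<gamma> (p * \<beta>) (t - s) * norm (u s) powr p) \<partial>lborel)
          \<le> ennreal (W t powr p)" by simp
    qed measurable
    define l where "l t = (if c t < \<infinity> then THE l. is_input u t l else 0)" for t
    have l: "is_input u t (l t)" "norm (l t) \<le> C0 * W t" if ct: "c t < \<infinity>" for t
    proof -
      obtain l' where l': "is_input u t l'" "norm l' \<le> C0 * W t" using good[OF ct] by blast
      then have "(THE l. is_input u t l) = l'" using is_input_unique by (intro the_equality) auto
      then show "is_input u t (l t)" "norm (l t) \<le> C0 * W t" using l' ct by (auto simp: l_def)
    qed
    \<comment> \<open>Weak measurability suffices: against \<open>J y\<close> the function is a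
      parameter integral with a jointly measurable integrand.\<close>
    have lm: "l \<in> borel_measurable borel"
    proof (rule measurable_of_weak[OF J_dense])
      fix x assume "x \<in> range J"
      then obtain y where y: "x = J y" by auto
      have "inner (l t) x = (if c t < \<infinity> then \<integral>s. inner (u s) (kk (t - s) y) \<partial>lborel else 0)" for t
        using l(1)[of t] by (simp add: y is_input_def l_def)
      then show "(\<lambda>t. inner (l t) x) \<in> borel_measurable borel" by simp
    qed
    have l0: "l t = 0" if "t \<le> 0" for t
      using l(1)[of t] is_input_unique[OF is_input_0[OF that] ] D(2) by (cases "c t < \<infinity>") (auto simp: l_def)
    have lAE: "AE t in lborel. is_input u t (l t)" using cfin by eventually_elim (rule l)
    have "input u \<in> borel_measurable borel \<and> (\<forall>t\<le>0. input u t = 0) \<and> (AE t in lborel. is_input u t (input u t))"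
      unfolding input_def by (rule someI[of _ l]) (use lm l0 lAE in auto)
    then have id: "input_defined u" by (simp add: input_defined_def)
    have eq: "AE t in lborel. input u t = l t"
      using lAE id[unfolded input_defined_def, THEN conjunct2, THEN conjunct2]
      by eventually_elim (rule is_input_unique)
    have C: "C \<ge> 0" using C0 by (simp add: C_def)
    have "Lp_bound (p * r) \<sigma> (C * a) l"
    proof (rule Lp_boundI)
      have "(\<integral>\<^sup>+t. ennreal ((exp (\<sigma> * t) * norm (l t)) powr (p * r)) \<partial>lborel)
          \<le> (\<integral>\<^sup>+t. ennreal (C0 powr (p * r)) * ennreal (enn2real (c t) powr r) \<partial>lborel)"
      proof (rule nn_integral_mono_AE, use cfin in eventually_elim)
        case (elim t)
        have "exp (\<sigma> * t) * norm (l t) \<le> exp (\<sigma> * t) * (C0 * W t)" using l(2)[OF elim] by simp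
        also have "\<dots> = C0 * enn2real (c t) powr (1/p)"
        proof -
          have "exp (\<sigma> * t) * exp (- \<sigma> * t) = 1" unfolding exp_add[symmetric] by simp
          moreover have "exp (\<sigma> * t) * (C0 * (y * x)) = (exp (\<sigma> * t) * y) * (C0 * x)" for x y
            by (simp add: mult_ac)
          ultimately show ?thesis unfolding W_def by simp
        qed
        finally have "(exp (\<sigma> * t) * norm (l t)) powr (p * r) \<le> (C0 * enn2real (c t) powr (1/p)) powr (p * r)"
          using p r by (intro powr_mono2) auto
        also have "\<dots> = C0 powr (p * r) * enn2real (c t) powr r"
          using p by (simp add: powr_mult powr_powr)
        finally show ?case by (simp add: ennreal_mult[symmetric])
      qed
      also have "\<dots> = ennreal (C0 powr (p * r)) * (\<integral>\<^sup>+t. ennreal (enn2real (c t) powr r) \<partial>lborel)"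
        by (rule nn_integral_cmult) measurable
      also have "\<dots> \<le> ennreal (C0 powr (p * r)) * ennreal ((a powr p) powr r * G)"
        using cint by (intro mult_left_mono) auto
      also have "\<dots> = ennreal ((C * a) powr (p * r))"
        using p r G D by (simp add: C_def ennreal_mult[symmetric] powr_mult powr_powr mult_ac)
      finally show "(\<integral>\<^sup>+t. ennreal ((exp (\<sigma> * t) * norm (l t)) powr (p * r)) \<partial>lborel) \<le> ennreal ((C * a) powr (p * r))" .
    qed (use lm l0 C D in auto)
    then have "Lp_bound (p * r) \<sigma> (C * a) (input u)"
      using id eq by (elim Lp_bound_cong_AE) (auto simp: input_defined_def)
    with id show ?thesis by simp
  qed
  have "C \<ge> 0" using C0 by (simp add: C_def)
  then show ?thesis using main by blast
qed

lemma input_lincomb: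
  assumes "input_defined u" "input_defined v" "input_defined (\<lambda>s. c *\<^sub>R u s + v s)"
  shows "AE t in lborel. input (\<lambda>s. c *\<^sub>R u s + v s) t = c *\<^sub>R input u t + input v t"
proof -
  have "AE t in lborel. is_input u t (input u t)" "AE t in lborel. is_input v t (input v t)"
    "AE t in lborel. is_input (\<lambda>s. c *\<^sub>R u s + v s) t (input (\<lambda>s. c *\<^sub>R u s + v s) t)"
    using assms by (auto simp: input_defined_def)
  then show ?thesis
    by eventually_elim (rule is_input_unique[OF _ is_input_lincomb])
qed

section \<open>The adjoint of the input map, first on functions with values in the range of
  \<open>J\<close>\<close>

lemma kk_bound':
  obtains C where "C \<ge> 0" "\<And>a y. norm (kk a y) \<le> C * exp (- \<omega> * a) * norm y"
proof -
  obtain C where C: "\<And>a y. norm (kk a y) \<le> C * exp (- \<omega> * a) * norm y" using kk_bound by blast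
  have "norm (kk a y) \<le> \<bar>C\<bar> * exp (- \<omega> * a) * norm y" for a y
    by (rule order_trans[OF C]) (intro mult_right_mono; simp)
  then show ?thesis by (intro that[of "\<bar>C\<bar>"]) auto
qed

text \<open>Only a finite bound, uniform in \<open>s\<close>, is wanted, for integrability and for
  Fubini's theorem. Estimating the norm of y by 1 plus its p-th power separates the two factors and
  treats p = 1 in the same way.\<close>

lemma kk_nn_bound:
  assumes p: "p \<ge> 1"
  obtains C where "C \<ge> 0"
    "\<And>y a s. Lp_bound p 0 a y \<Longrightarrow> (\<integral>\<^sup>+t. ennreal (norm (kk (t - s) (y t))) \<partial>lborel) \<le> ennreal (C * (1 / \<omega> + a powr p))"
proof -
  obtain C where C: "C \<ge> 0" "\<And>a y. norm (kk a y) \<le> C * exp (- \<omega> * a) * norm y" using kk_bound' by blast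
  show ?thesis
  proof (rule that[OF C(1)])
    fix y :: "real \<Rightarrow> 'y" and a s
    assume y: "Lp_bound p 0 a y"
    note D = Lp_boundD[OF y]
    have [measurable]: "y \<in> borel_measurable borel" using D by simp
    have pw: "norm (kk (t - s) (y t)) \<le> C * (indicator {0<..} (t - s) * exp (- \<omega> * (t - s)) + norm (y t) powr p)"
      if "t \<noteq> s" for t
    proof (cases "t > s")
      case True
      have e: "0 \<le> exp (- \<omega> * (t - s))" "exp (- \<omega> * (t - s)) \<le> 1" using True \<omega> by auto
      have y1: "norm (y t) \<le> 1 + norm (y t) powr p"
      proof (cases "norm (y t) \<le> 1")
        case False
        then show ?thesis using powr_mono[of 1 p "norm (y t)"] p by simp
      qed (simp add: add_increasing2)
      have "norm (kk (t - s) (y t)) \<le> C * (exp (- \<omega> * (t - s)) * norm (y t))" using C(2)[of "t - s" "y t"] by (simp add: mult_ac)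
      also have "exp (- \<omega> * (t - s)) * norm (y t) \<le> exp (- \<omega> * (t - s)) * (1 + norm (y t) powr p)"
        using y1 e by (intro mult_left_mono)
      also have "\<dots> \<le> exp (- \<omega> * (t - s)) + norm (y t) powr p"
        using mult_right_mono[OF e(2), of "norm (y t) powr p"] by (simp add: algebra_simps)
      finally show ?thesis using True C(1) by (simp add: mult_left_mono)
    next
      case False
      then have "kk (t - s) (y t) = 0" using that kk_neg by simp
      then show ?thesis using C(1) by simp
    qed
    have "(\<integral>\<^sup>+t. ennreal (norm (kk (t - s) (y t))) \<partial>lborel)
        \<le> (\<integral>\<^sup>+t. ennreal C * (ennreal (indicator {0<..} (t - s) * exp (- \<omega> * (t - s))) + ennreal (norm (y t) powr p)) \<partial>lborel)"
    proof (rule nn_integral_mono_AE, use AE_lborel_singleton[of s] in eventually_elim)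
      case (elim t)
      show ?case using ennreal_leI[OF pw[OF elim]] C(1) by (simp add: ennreal_mult)
    qed
    also have "\<dots> = ennreal C * ((\<integral>\<^sup>+t. ennreal (indicator {0<..} (t - s) * exp (- \<omega> * (t - s))) \<partial>lborel)
        + (\<integral>\<^sup>+t. ennreal (norm (y t) powr p) \<partial>lborel))"
      by (simp add: nn_integral_cmult nn_integral_add)
    also have "(\<integral>\<^sup>+t. ennreal (indicator {0<..} (t - s) * exp (- \<omega> * (t - s))) \<partial>lborel) = ennreal (1 / \<omega>)"
      using nn_integral_lborel_shift[of "\<lambda>t. ennreal (indicator {0<..} t * exp (- \<omega> * t))" s] nn_integral_exp_neg[OF \<omega>] by simp
    also have "ennreal C * (ennreal (1 / \<omega>) + (\<integral>\<^sup>+t. ennreal (norm (y t) powr p) \<partial>lborel))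
        \<le> ennreal C * (ennreal (1 / \<omega>) + ennreal (a powr p))"
      using D(4) by (intro mult_left_mono add_left_mono) auto
    also have "\<dots> = ennreal (C * (1 / \<omega> + a powr p))" using C \<omega> by (simp add: ennreal_mult)
    finally show "(\<integral>\<^sup>+t. ennreal (norm (kk (t - s) (y t))) \<partial>lborel) \<le> ennreal (C * (1 / \<omega> + a powr p))" .
  qed
qed

lemma kk_integrable:
  assumes "p \<ge> 1" "Lp_bound p 0 a y"
  shows "integrable lborel (\<lambda>t. kk (t - s) (y t))"
proof -
  obtain C where C: "(\<integral>\<^sup>+t. ennreal (norm (kk (t - s) (y t))) \<partial>lborel) \<le> ennreal (C * (1 / \<omega> + a powr p))"
    using kk_nn_bound[OF assms(1)] assms(2) by metis
  have [measurable]: "y \<in> borel_measurable borel" using Lp_boundD[OF assms(2)] by simp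
  show ?thesis by (rule integrableI_bounded) (use C in \<open>auto intro: le_less_trans\<close>)
qed

text \<open>The integral formula for the adjoint, applied to \<open>J \<circ> y\<close>. For s \<le>
  0 the integral need not vanish; the value 0 is prescribed there to stay within the functions on
  the half-line.\<close>

definition adj_input :: "(real \<Rightarrow> 'y) \<Rightarrow> real \<Rightarrow> 'u" where
  "adj_input y s = (if s \<le> 0 then 0 else \<integral>t. kk (t - s) (y t) \<partial>lborel)"

lemma adj_input_measurable [measurable]:
  assumes [measurable]: "y \<in> borel_measurable borel"
  shows "adj_input y \<in> borel_measurable borel"
  unfolding adj_input_def by measurable

lemma adj_input_diff:
  assumes "p \<ge> 1" "Lp_bound p 0 a y" "Lp_bound p 0 b z"
  shows "adj_input (\<lambda>t. y t - z t) s = adj_input y s - adj_input z s"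
  using kk_integrable[OF assms(1,2)] kk_integrable[OF assms(1,3)]
  by (simp add: adj_input_def linear_diff[OF kk_linear])

text \<open>Fubini's theorem. Pairing with a bounded function of bounded support reduces absolute
  integrability to the uniform bound of \<open>kk_nn_bound\<close>.\<close>

lemma adj_input_duality:
  assumes u: "test_fun u" and ud: "input_defined u" and p: "p \<ge> 1" and y: "Lp_bound p 0 a y"
  shows "(\<integral>s. inner (adj_input y s) (u s) \<partial>lborel) = (\<integral>t. inner (J (y t)) (input u t) \<partial>lborel)"
proof -
  from u obtain n where [measurable]: "u \<in> borel_measurable borel"
    and n: "\<And>t. norm (u t) \<le> n" "\<And>t. u t \<noteq> 0 \<Longrightarrow> 0 < t \<and> t \<le> n" by (auto simp: test_fun_def)
  have n0: "n \<ge> 0" using n(1)[of 0] norm_ge_zero[of "u 0"] by linarith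
  have [measurable]: "y \<in> borel_measurable borel" using Lp_boundD[OF y] by simp
  obtain C where C: "C \<ge> 0" and Cb: "\<And>s. (\<integral>\<^sup>+t. ennreal (norm (kk (t - s) (y t))) \<partial>lborel) \<le> ennreal (C * (1 / \<omega> + a powr p))"
    using kk_nn_bound[OF p] y by metis
  define M where "M = C * (1 / \<omega> + a powr p)"
  have M: "M \<ge> 0" using C \<omega> by (simp add: M_def)
  define H where "H = (\<lambda>(s, t). inner (kk (t - s) (y t)) (u s))"
  have [measurable]: "H \<in> borel_measurable (lborel \<Otimes>\<^sub>M lborel)" unfolding H_def by measurable
  have "integrable (lborel \<Otimes>\<^sub>M lborel) H"
  proof (rule integrableI_bounded)
    have "(\<integral>\<^sup>+z. ennreal (norm (H z)) \<partial>(lborel \<Otimes>\<^sub>M lborel)) = (\<integral>\<^sup>+s. \<integral>\<^sup>+t. ennreal (norm (H (s, t))) \<partial>lborel \<partial>lborel)"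
      by (rule lborel.nn_integral_fst[symmetric]) measurable
    also have "\<dots> \<le> (\<integral>\<^sup>+s. ennreal (n * M) * indicator {0..n} s \<partial>lborel)"
    proof (rule nn_integral_mono)
      fix s
      show "(\<integral>\<^sup>+t. ennreal (norm (H (s, t))) \<partial>lborel) \<le> ennreal (n * M) * indicator {0..n} s"
      proof (cases "u s = 0")
        case False
        have "(\<integral>\<^sup>+t. ennreal (norm (H (s, t))) \<partial>lborel) \<le> (\<integral>\<^sup>+t. ennreal n * ennreal (norm (kk (t - s) (y t))) \<partial>lborel)"
        proof (rule nn_integral_mono)
          fix t
          have "norm (H (s, t)) \<le> norm (kk (t - s) (y t)) * norm (u s)"
            unfolding H_def by (simp add: Cauchy_Schwarz_ineq2)
          also have "\<dots> \<le> norm (kk (t - s) (y t)) * n" using n(1)[of s] by (intro mult_left_mono) auto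
          finally show "ennreal (norm (H (s, t))) \<le> ennreal n * ennreal (norm (kk (t - s) (y t)))"
            using n0 by (simp add: ennreal_mult[symmetric] mult.commute)
        qed
        also have "\<dots> = ennreal n * (\<integral>\<^sup>+t. ennreal (norm (kk (t - s) (y t))) \<partial>lborel)" by (rule nn_integral_cmult) measurable
        also have "\<dots> \<le> ennreal n * ennreal M" using Cb[of s] by (intro mult_left_mono) (auto simp: M_def)
        also have "\<dots> = ennreal (n * M) * indicator {0..n} s" using n(2)[OF False] n0 M by (simp add: ennreal_mult)
        finally show ?thesis .
      qed (simp add: H_def)
    qed
    also have "\<dots> = ennreal (n * M) * ennreal n" using n0 by (simp add: nn_integral_cmult)
    also have "\<dots> < \<infinity>" by (simp add: ennreal_mult_less_top)
    finally show "(\<integral>\<^sup>+z. ennreal (norm (H z)) \<partial>(lborel \<Otimes>\<^sub>M lborel)) < \<infinity>" .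
  qed measurable
  then have F: "(\<integral>t. (\<integral>s. H (s, t) \<partial>lborel) \<partial>lborel) = (\<integral>s. (\<integral>t. H (s, t) \<partial>lborel) \<partial>lborel)"
    using lborel_pair.Fubini_integral[of "\<lambda>s t. H (s, t)"] by simp
  have l: "(\<integral>t. H (s, t) \<partial>lborel) = inner (adj_input y s) (u s)" for s
  proof (cases "s \<le> 0")
    case True
    then have "u s = 0" using n(2)[of s] by force
    then show ?thesis by (simp add: H_def)
  next
    case False
    then show ?thesis using kk_integrable[OF p y, of s] by (simp add: H_def adj_input_def)
  qed
  have r: "AE t in lborel. (\<integral>s. H (s, t) \<partial>lborel) = inner (J (y t)) (input u t)"
    using ud[unfolded input_defined_def, THEN conjunct2, THEN conjunct2]
  proof eventually_elim
    case (elim t)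
    then show ?case by (simp add: is_input_def H_def inner_commute)
  qed
  have [measurable]: "input u \<in> borel_measurable borel" using ud by (simp add: input_defined_def)
  have [measurable]: "(\<lambda>t. (\<integral>s. H (s, t) \<partial>lborel)) \<in> borel_measurable borel" by measurable
  have "(\<integral>t. (\<integral>s. H (s, t) \<partial>lborel) \<partial>lborel) = (\<integral>t. inner (J (y t)) (input u t) \<partial>lborel)"
    by (rule integral_cong_AE) (use r in measurable)
  then show ?thesis using F l by simp
qed

lemma input_bound1:
  assumes "p > 1" "\<sigma> < \<omega>"
  shows "\<exists>C\<ge>0. \<forall>u a. Lp_bound p \<sigma> a u \<longrightarrow> input_defined u \<and> Lp_bound p \<sigma> (C * a) (input u)"
  using input_bound[OF assms, of 1] \<gamma> by simp

text \<open>By duality with the bounded input map. The constant multiplies the norm of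
  \<open>J y\<close> alone, and the bound on \<open>y\<close> serves only to make the integral
  formula meaningful; this is what permits extension by density.\<close>

lemma adj_input_bound:
  assumes q: "q > 1"
  shows "\<exists>C\<ge>0. \<forall>y a b. Lp_bound q 0 b y \<longrightarrow> Lp_bound q 0 a (\<lambda>t. J (y t)) \<longrightarrow> Lp_bound q 0 (C * a) (adj_input y)"
proof -
  define p where "p = q / (q - 1)"
  have p: "p > 1" "1 / q + 1 / p = 1" using conjugate_exponent[OF q] by (auto simp: p_def)
  obtain C where C: "C \<ge> 0" "\<And>u a. Lp_bound p 0 a u \<Longrightarrow> input_defined u"
    "\<And>u a. Lp_bound p 0 a u \<Longrightarrow> Lp_bound p 0 (C * a) (input u)"
    using input_bound1[OF p(1) \<omega>] by blast
  have "Lp_bound q 0 (C * a) (adj_input y)" if y: "Lp_bound q 0 b y" "Lp_bound q 0 a (\<lambda>t. J (y t))" for y a b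
  proof (rule Lp_bound_of_dual[OF _ _ q p(2)])
    have [measurable]: "y \<in> borel_measurable borel" using Lp_boundD[OF y(1)] by simp
    show "adj_input y \<in> borel_measurable borel" by measurable
    show "0 \<le> C * a" using C(1) Lp_boundD(3)[OF y(2)] by simp
    fix u :: "real \<Rightarrow> 'u" and b assume u: "test_fun u" "Lp_bound p (- 0) b u"
    have "(\<integral>t. inner (adj_input y t) (u t) \<partial>lborel) = (\<integral>t. inner (J (y t)) (input u t) \<partial>lborel)"
      by (rule adj_input_duality[OF u(1) C(2) _ y(1)]) (use u q in auto)
    also have "\<dots> \<le> a * (C * b)"
      using Lp_bound_Hoelder(2)[OF y(2) _ q p(2), of "C * b" "input u"] C(3)[of b u] u by simp
    finally show "(\<integral>t. inner (adj_input y t) (u t) \<partial>lborel) \<le> C * a * b" by (simp add: mult_ac)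
  qed (simp add: adj_input_def)
  then show ?thesis using C(1) by blast
qed

text \<open>Continuous extension from the dense set of functions \<open>J \<circ> y\<close>, carried
  out along one sequence. Errors 4^{-n} make consecutive images differ by a multiple of 4^{-n},
  which \<open>Lp_bound_series\<close> with \<mu> = 1/2 sums with rate 2^{-n}.\<close>

lemma adj_input_approximation:
  assumes q: "q > 1" and v: "Lp_bound q 0 a v"
  shows "\<exists>y b w c c'. (\<forall>n. Lp_bound q 0 (b n) (y n)) \<and>
    (\<forall>n. Lp_bound q 0 ((1/4) ^ n) (\<lambda>t. v t - J (y n t))) \<and>
    (\<forall>n. Lp_bound q 0 (c * (1/2) ^ n) (\<lambda>t. w t - adj_input (y n) t)) \<and> Lp_bound q 0 c' w"
proof -
  have q1: "q \<ge> 1" using q by simp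
  have "\<exists>y b. Lp_bound q 0 b y \<and> Lp_bound q 0 ((1/4) ^ n) (\<lambda>t. v t - J (y t))" for n :: nat
  proof -
    have "(1/4::real) ^ n > 0" by simp
    from Lp_bound_dense_range[OF v q1 this J J_dense] show ?thesis by metis
  qed
  then obtain y b where y: "\<And>n. Lp_bound q 0 (b n) (y n)" and Jy: "\<And>n. Lp_bound q 0 ((1/4) ^ n) (\<lambda>t. v t - J (y n t))"
    by metis
  obtain C where C: "C \<ge> 0"
    "\<And>y a b. Lp_bound q 0 b y \<Longrightarrow> Lp_bound q 0 a (\<lambda>t. J (y t)) \<Longrightarrow> Lp_bound q 0 (C * a) (adj_input y)"
    using adj_input_bound[OF q] by blast
  define d where "d n t = adj_input (y (Suc n)) t - adj_input (y n) t" for n t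
  have d: "Lp_bound q 0 ((4 * C) * (1/2 * (1/2)) ^ n) (d n)" for n
  proof -
    have "Lp_bound q 0 (2 * ((1/4) ^ n + (1/4) ^ Suc n)) (\<lambda>t. (v t - J (y n t)) - (v t - J (y (Suc n) t)))"
      by (rule Lp_bound_diff[OF Jy Jy q1])
    also have "(\<lambda>t. (v t - J (y n t)) - (v t - J (y (Suc n) t))) = (\<lambda>t. J (y (Suc n) t - y n t))"
      using J by (simp add: bounded_linear.linear linear_diff)
    finally have "Lp_bound q 0 (2 * ((1/4) ^ n + (1/4) ^ Suc n)) (\<lambda>t. J (y (Suc n) t - y n t))" .
    then have "Lp_bound q 0 (4 * (1/4) ^ n) (\<lambda>t. J (y (Suc n) t - y n t))"
      by (rule Lp_bound_mono) (use q1 in simp_all)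
    with Lp_bound_diff[OF y y q1] have "Lp_bound q 0 (C * (4 * (1/4) ^ n)) (adj_input (\<lambda>t. y (Suc n) t - y n t))"
      by (rule C(2))
    then show ?thesis unfolding d_def adj_input_diff[OF q1 y y] by (simp add: mult_ac)
  qed
  obtain f where f: "\<And>n. Lp_bound q 0 ((4 * C) / (1 - 1/2)\<^sup>2 * (1/2) ^ n) (\<lambda>t. f t - (\<Sum>i<n. d i t))"
    by (rule Lp_bound_series[OF d q1]) auto
  define w where "w t = f t + adj_input (y 0) t" for t
  have sum: "(\<Sum>i<n. d i t) = adj_input (y n) t - adj_input (y 0) t" for n t
    unfolding d_def by (rule sum_lessThan_telescope)
  have w: "Lp_bound q 0 ((16 * C) * (1/2) ^ n) (\<lambda>t. w t - adj_input (y n) t)" for n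
    using f[of n] unfolding sum w_def by (simp add: algebra_simps power2_eq_square)
  have "Lp_bound q 0 (2 * (a + (1/4) ^ 0)) (\<lambda>t. v t - (v t - J (y 0 t)))"
    by (rule Lp_bound_diff[OF v Jy q1])
  then have "Lp_bound q 0 (C * (2 * (a + 1))) (adj_input (y 0))" using C(2)[OF y[of 0]] by simp
  from Lp_bound_add[OF w[of 0] this q1] obtain c' where "Lp_bound q 0 c' w" by auto
  with y Jy w show ?thesis by blast
qed

text \<open>\<open>weak_adj v w\<close> expresses \<open>w = L\<^sup>* v\<close>, and \<open>feedback q\<close> is \<open>L\<^sup>* Q L\<close> on \<open>L\<^sup>q\<close> for \<open>Q = R\<^sup>* R\<close>.\<close>

definition weak_adj :: "(real \<Rightarrow> 'y) \<Rightarrow> (real \<Rightarrow> 'u) \<Rightarrow> bool" where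
  "weak_adj v w \<longleftrightarrow>
     (\<forall>u. test_fun u \<longrightarrow> (\<integral>t. inner (w t) (u t) \<partial>lborel) = (\<integral>t. inner (v t) (input u t) \<partial>lborel))"

text \<open>Both sides of the duality identity are continuous, so it passes to the limit. The
  approximating sequence is arbitrary: the lemma applies to the one constructed above as well as to
  whichever one is selected inside \<open>adj_input_map\<close>.\<close>

lemma weak_adj_limit:
  assumes q: "q > 1" and v: "Lp_bound q 0 a v" and w: "Lp_bound q 0 c w"
    and y: "\<And>n. Lp_bound q 0 (b n) (y n)"
    and e: "\<And>n. Lp_bound q 0 (e n) (\<lambda>t. v t - J (y n t))" "e \<longlonglongrightarrow> 0"
    and f: "\<And>n. Lp_bound q 0 (f n) (\<lambda>t. w t - adj_input (y n) t)" "f \<longlonglongrightarrow> 0"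
  shows "weak_adj v w"
  unfolding weak_adj_def
proof (intro allI impI)
  fix u :: "real \<Rightarrow> 'u" assume u: "test_fun u"
  have q1: "q \<ge> 1" using q by simp
  define p where "p = q / (q - 1)"
  have p: "p > 1" "1 / q + 1 / p = 1" using conjugate_exponent[OF q] by (auto simp: p_def)
  obtain C where C: "C \<ge> 0" "\<And>u a. Lp_bound p 0 a u \<Longrightarrow> input_defined u"
    "\<And>u a. Lp_bound p 0 a u \<Longrightarrow> Lp_bound p 0 (C * a) (input u)"
    using input_bound1[OF p(1) \<omega>] by blast
  have p1: "p \<ge> 1" using p by simp
  obtain m where "Lp_bound p 0 m u" by (rule test_fun_Lp[OF u p1])
  then have m: "Lp_bound p (- 0) m u" "input_defined u" "Lp_bound p (- 0) (C * m) (input u)" using C by auto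
  let ?d = "\<bar>(\<integral>t. inner (w t) (u t) \<partial>lborel) - (\<integral>t. inner (v t) (input u t) \<partial>lborel)\<bar>"
  have "?d \<le> f n * m + e n * (C * m)" for n
  proof -
    obtain c1 where c1: "Lp_bound q 0 c1 (\<lambda>t. w t - (w t - adj_input (y n) t))"
      using Lp_bound_diff[OF w f(1) q1] by blast
    obtain c2 where c2: "Lp_bound q 0 c2 (\<lambda>t. v t - (v t - J (y n t)))"
      using Lp_bound_diff[OF v e(1) q1] by blast
    have c: "Lp_bound q 0 c1 (adj_input (y n))" "Lp_bound q 0 c2 (\<lambda>t. J (y n t))" using c1 c2 by auto
    have "(\<integral>t. inner (w t - adj_input (y n) t) (u t) \<partial>lborel)
        = (\<integral>t. inner (w t) (u t) \<partial>lborel) - (\<integral>t. inner (adj_input (y n) t) (u t) \<partial>lborel)"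
      using Lp_bound_Hoelder(1)[OF w m(1) q p(2)] Lp_bound_Hoelder(1)[OF c(1) m(1) q p(2)]
      by (simp add: inner_diff_left)
    moreover have "(\<integral>t. inner (v t - J (y n t)) (input u t) \<partial>lborel)
        = (\<integral>t. inner (v t) (input u t) \<partial>lborel) - (\<integral>t. inner (J (y n t)) (input u t) \<partial>lborel)"
      using Lp_bound_Hoelder(1)[OF v m(3) q p(2)] Lp_bound_Hoelder(1)[OF c(2) m(3) q p(2)]
      by (simp add: inner_diff_left)
    moreover have "(\<integral>t. inner (adj_input (y n) t) (u t) \<partial>lborel) = (\<integral>t. inner (J (y n t)) (input u t) \<partial>lborel)"
      by (rule adj_input_duality[OF u m(2) q1 y])
    ultimately show ?thesis
      using Lp_bound_Hoelder(2)[OF f(1)[of n] m(1) q p(2)] Lp_bound_Hoelder(2)[OF e(1)[of n] m(3) q p(2)]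
      by linarith
  qed
  moreover have "(\<lambda>n. f n * m + e n * (C * m)) \<longlonglongrightarrow> 0 * m + 0 * (C * m)"
    by (intro tendsto_intros e f)
  ultimately have "?d \<le> 0" by (intro LIMSEQ_le_const) auto
  then show "(\<integral>t. inner (w t) (u t) \<partial>lborel) = (\<integral>t. inner (v t) (input u t) \<partial>lborel)" by simp
qed

text \<open>Test functions are norming, so two weak adjoints of the same function differ by a
  function with norm bound 0.\<close>

lemma weak_adj_unique:
  assumes q: "q > 1" and w: "Lp_bound q 0 a w" "weak_adj v w" and z: "Lp_bound q 0 b z" "weak_adj v z"
  shows "AE t in lborel. w t = z t"
proof -
  have q1: "q \<ge> 1" using q by simp
  define p where "p = q / (q - 1)"
  have p: "p > 1" "p \<ge> 1" "1 / q + 1 / p = 1" using conjugate_exponent[OF q] by (auto simp: p_def)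
  note D = Lp_boundD[OF w(1)] Lp_boundD[OF z(1)]
  have "Lp_bound q 0 0 (\<lambda>t. w t - z t)"
  proof (rule Lp_bound_of_dual[OF _ _ q p(3)])
    fix u :: "real \<Rightarrow> 'u" and m assume u: "test_fun u" "Lp_bound p (- 0) m u"
    have "(\<integral>t. inner (w t - z t) (u t) \<partial>lborel) = (\<integral>t. inner (w t) (u t) \<partial>lborel) - (\<integral>t. inner (z t) (u t) \<partial>lborel)"
      using Lp_bound_Hoelder(1)[OF w(1) u(2) q p(3)] Lp_bound_Hoelder(1)[OF z(1) u(2) q p(3)]
      by (simp add: inner_diff_left)
    then show "(\<integral>t. inner (w t - z t) (u t) \<partial>lborel) \<le> 0 * m"
      using w(2) z(2) u(1) by (simp add: weak_adj_def)
  qed (use D in auto)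
  from Lp_bound_tendsto_0[OF this tendsto_const q1] show ?thesis by simp
qed

section \<open>The operator \<open>L\<^sup>* Q L\<close>\<close>

definition feedback :: "real \<Rightarrow> (real \<Rightarrow> 'u) \<Rightarrow> real \<Rightarrow> 'u" where
  "feedback q g = (SOME w. (\<exists>b. Lp_bound q 0 b w) \<and> weak_adj (\<lambda>t. Q (input g t)) w)"

lemma Q_bound:
  obtains C where "C \<ge> 0" "\<And>x. norm (Q x) \<le> C * norm x"
  using bounded_linear.nonneg_bounded[OF Q] by (metis mult.commute)

lemma Lp_bound_Q:
  assumes C: "C \<ge> 0" "\<And>x. norm (Q x) \<le> C * norm x" and v: "Lp_bound p \<sigma> a v" and p: "p \<ge> 1"
  shows "Lp_bound p \<sigma> (C * a) (\<lambda>t. Q (v t))"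
proof (rule Lp_bound_dominated[OF v p C(1)])
  note D = Lp_boundD[OF v]
  have [measurable]: "v \<in> borel_measurable borel" using D by simp
  show "(\<lambda>t. Q (v t)) \<in> borel_measurable borel" by measurable
  show "Q (v t) = 0" if "t \<le> 0" for t using D(2)[OF that] Q by (simp add: linear_0 bounded_linear.linear)
  show "AE t in lborel. 0 < t \<longrightarrow> exp (\<sigma> * t) * norm (Q (v t)) \<le> C * (exp (\<sigma> * t) * norm (v t))"
  proof (intro AE_I2 impI)
    fix t
    show "exp (\<sigma> * t) * norm (Q (v t)) \<le> C * (exp (\<sigma> * t) * norm (v t))"
      using mult_left_mono[OF C(2)[of "v t"] exp_ge_zero[of "\<sigma> * t"]] by (simp add: mult_ac)
  qed
qed

lemma feedback_weak:
  assumes q: "q > 1" and g: "Lp_bound q 0 a g"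
  shows "\<exists>b. Lp_bound q 0 b (feedback q g)" "weak_adj (\<lambda>t. Q (input g t)) (feedback q g)"
    "\<exists>b. Lp_bound q 0 b (\<lambda>t. Q (input g t))" "input_defined g"
proof -
  obtain C where C: "C \<ge> 0" "\<And>u a. Lp_bound q 0 a u \<Longrightarrow> input_defined u"
    "\<And>u a. Lp_bound q 0 a u \<Longrightarrow> Lp_bound q 0 (C * a) (input u)"
    using input_bound1[OF q \<omega>] by blast
  have q1: "q \<ge> 1" using q by simp
  obtain c where "c \<ge> 0" "\<And>x. norm (Q x) \<le> c * norm x" by (rule Q_bound) blast
  from Lp_bound_Q[OF this C(3)[OF g] q1] have v: "Lp_bound q 0 (c * (C * a)) (\<lambda>t. Q (input g t))" .
  obtain y b w d d' where *: "\<And>n. Lp_bound q 0 (b n) (y n)"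
    "\<And>n. Lp_bound q 0 ((1/4) ^ n) (\<lambda>t. Q (input g t) - J (y n t))"
    "\<And>n. Lp_bound q 0 (d * (1/2) ^ n) (\<lambda>t. w t - adj_input (y n) t)" "Lp_bound q 0 d' w"
    using adj_input_approximation[OF q v] by blast
  have "weak_adj (\<lambda>t. Q (input g t)) w"
  proof (rule weak_adj_limit[OF q v *(4) *(1) *(2) _ *(3)])
    show "(\<lambda>n. (1/4::real) ^ n) \<longlonglongrightarrow> 0" by (rule LIMSEQ_realpow_zero) auto
    have "(\<lambda>n. d * (1/2) ^ n) \<longlonglongrightarrow> d * 0" by (intro tendsto_mult tendsto_const LIMSEQ_realpow_zero) auto
    then show "(\<lambda>n. d * (1/2) ^ n) \<longlonglongrightarrow> 0" by simp
  qed
  with *(4) have "\<exists>w. (\<exists>b. Lp_bound q 0 b w) \<and> weak_adj (\<lambda>t. Q (input g t)) w" by blast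
  from someI_ex[OF this] show "\<exists>b. Lp_bound q 0 b (feedback q g)" "weak_adj (\<lambda>t. Q (input g t)) (feedback q g)"
    unfolding feedback_def by auto
  show "\<exists>b. Lp_bound q 0 b (\<lambda>t. Q (input g t))" "input_defined g" using v C(2)[OF g] by auto
qed

text \<open>\<open>feedback\<close> is picked from a class of functions equal almost everywhere, so
  linearity is not built in; it follows from uniqueness of the weak adjoint.\<close>

lemma feedback_lincomb:
  assumes q: "q > 1" and g: "Lp_bound q 0 a g" and h: "Lp_bound q 0 b h"
  shows "AE t in lborel. feedback q (\<lambda>t. c *\<^sub>R g t + h t) t = c *\<^sub>R feedback q g t + feedback q h t"
proof -
  have q1: "q \<ge> 1" using q by simp
  define p where "p = q / (q - 1)"
  have p: "p > 1" "p \<ge> 1" "1 / q + 1 / p = 1" using conjugate_exponent[OF q] by (auto simp: p_def)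
  obtain C where C: "C \<ge> 0" "\<And>u a. Lp_bound p 0 a u \<Longrightarrow> input_defined u"
    "\<And>u a. Lp_bound p 0 a u \<Longrightarrow> Lp_bound p 0 (C * a) (input u)"
    using input_bound1[OF p(1) \<omega>] by blast
  define k where "k t = c *\<^sub>R g t + h t" for t
  have keq: "k = (\<lambda>t. c *\<^sub>R g t + h t)" by (simp add: fun_eq_iff k_def)
  obtain d where k: "Lp_bound q 0 d k"
    unfolding keq using Lp_bound_add[OF Lp_bound_scaleR[OF g q1] h q1] by blast
  note fg = feedback_weak[OF q g] and fh = feedback_weak[OF q h] and fk = feedback_weak[OF q k]
  obtain ag ah ak vg vh vk where bd: "Lp_bound q 0 ag (feedback q g)" "Lp_bound q 0 ah (feedback q h)"
    "Lp_bound q 0 ak (feedback q k)" "Lp_bound q 0 vg (\<lambda>t. Q (input g t))"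
    "Lp_bound q 0 vh (\<lambda>t. Q (input h t))" "Lp_bound q 0 vk (\<lambda>t. Q (input k t))"
    using fg fh fk by blast
  define w where "w t = c *\<^sub>R feedback q g t + feedback q h t" for t
  obtain aw where w: "Lp_bound q 0 aw w"
    unfolding w_def using Lp_bound_add[OF Lp_bound_scaleR[OF bd(1) q1] bd(2) q1] by blast
  have kin: "AE t in lborel. Q (input k t) = c *\<^sub>R Q (input g t) + Q (input h t)"
    using input_lincomb[OF fg(4) fh(4) fk(4)[unfolded keq]]
    unfolding keq[symmetric]
    by eventually_elim (use Q in \<open>simp add: bounded_linear.linear linear_add linear_scale\<close>)
  have "weak_adj (\<lambda>t. Q (input k t)) w"
    unfolding weak_adj_def
  proof (intro allI impI)
    fix u :: "real \<Rightarrow> 'u" assume u: "test_fun u"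
    obtain m where "Lp_bound p 0 m u" by (rule test_fun_Lp[OF u p(2)])
    then have m: "Lp_bound p (- 0) m u" "Lp_bound p (- 0) (C * m) (input u)" using C by auto
    note I = Lp_bound_Hoelder(1)[OF _ m(1) q p(3)] and I' = Lp_bound_Hoelder(1)[OF _ m(2) q p(3)]
    have [measurable]: "input u \<in> borel_measurable borel" "(\<lambda>t. Q (input g t)) \<in> borel_measurable borel"
      "(\<lambda>t. Q (input h t)) \<in> borel_measurable borel" "(\<lambda>t. Q (input k t)) \<in> borel_measurable borel"
      using Lp_boundD(1)[OF m(2)] Lp_boundD(1)[OF bd(4)] Lp_boundD(1)[OF bd(5)] Lp_boundD(1)[OF bd(6)] by auto
    have "(\<integral>t. inner (w t) (u t) \<partial>lborel)
        = c * (\<integral>t. inner (feedback q g t) (u t) \<partial>lborel) + (\<integral>t. inner (feedback q h t) (u t) \<partial>lborel)"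
      unfolding w_def using I[OF bd(1)] I[OF bd(2)] by (simp add: inner_add_left)
    also have "\<dots> = c * (\<integral>t. inner (Q (input g t)) (input u t) \<partial>lborel) + (\<integral>t. inner (Q (input h t)) (input u t) \<partial>lborel)"
      using fg(2) fh(2) u by (simp add: weak_adj_def)
    also have "\<dots> = (\<integral>t. inner (c *\<^sub>R Q (input g t) + Q (input h t)) (input u t) \<partial>lborel)"
      using I'[OF bd(4)] I'[OF bd(5)] by (simp add: inner_add_left)
    also have "\<dots> = (\<integral>t. inner (Q (input k t)) (input u t) \<partial>lborel)"
      by (rule integral_cong_AE) (use kin in \<open>auto elim: eventually_mono\<close>)
    finally show "(\<integral>t. inner (w t) (u t) \<partial>lborel) = (\<integral>t. inner (Q (input k t)) (input u t) \<partial>lborel)" .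
  qed
  from weak_adj_unique[OF q bd(3) fk(2) w this] show ?thesis by (simp add: keq w_def)
qed

text \<open>The index \<open>q\<close> only fixes which operator is meant; the estimate is in an
  unrelated exponent \<open>p\<close>. The whole gain is made by \<open>L\<close>, from p to s = p r
  at weight \<sigma>. The adjoint is handled by duality, through the boundedness of \<open>L\<close>
  in the exponent conjugate to s with weight -\<sigma>.\<close>

lemma feedback_gain:
  assumes q: "q > 1" and p: "p > 1" and r: "r \<ge> 1" "\<gamma> * r < 1" and \<sigma>: "0 \<le> \<sigma>" "\<sigma> < \<omega>"
  shows "\<exists>C\<ge>0. \<forall>g a b. Lp_bound q 0 b g \<longrightarrow> Lp_bound p \<sigma> a g \<longrightarrow> Lp_bound (p * r) \<sigma> (C * a) (feedback q g)"
proof -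
  define s where "s = p * r"
  have "p * 1 \<le> p * r" using p r by (intro mult_left_mono) auto
  then have s: "s > 1" using p unfolding s_def by linarith
  define s' where "s' = s / (s - 1)"
  have s': "s' > 1" "1 / s + 1 / s' = 1" using conjugate_exponent[OF s] by (auto simp: s'_def)
  obtain C1 where C1: "C1 \<ge> 0" "\<And>u a. Lp_bound p \<sigma> a u \<Longrightarrow> Lp_bound s \<sigma> (C1 * a) (input u)"
    using input_bound[OF p \<sigma>(2) r] unfolding s_def by blast
  obtain C2 where C2: "C2 \<ge> 0" "\<And>u a. Lp_bound s' (- \<sigma>) a u \<Longrightarrow> Lp_bound s' (- \<sigma>) (C2 * a) (input u)"
    using input_bound1[OF s'(1), of "- \<sigma>"] \<sigma> \<omega> by auto
  obtain c where c: "c \<ge> 0" "\<And>x. norm (Q x) \<le> c * norm x" by (rule Q_bound) blast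
  have "Lp_bound s \<sigma> (C2 * c * C1 * a) (feedback q g)" if g: "Lp_bound q 0 b g" "Lp_bound p \<sigma> a g" for g a b
  proof -
    note f = feedback_weak[OF q g(1)]
    obtain d where d: "Lp_bound q 0 d (feedback q g)" using f by blast
    have Qi: "Lp_bound s \<sigma> (c * (C1 * a)) (\<lambda>t. Q (input g t))"
      using Lp_bound_Q[OF c C1(2)[OF g(2)]] s by simp
    show ?thesis
    proof (rule Lp_bound_of_dual[OF _ _ s s'(2)])
      fix u :: "real \<Rightarrow> 'u" and m assume u: "test_fun u" "Lp_bound s' (- \<sigma>) m u"
      have "(\<integral>t. inner (feedback q g t) (u t) \<partial>lborel) = (\<integral>t. inner (Q (input g t)) (input u t) \<partial>lborel)"
        using f(2) u(1) by (simp add: weak_adj_def)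
      also have "\<dots> \<le> (c * (C1 * a)) * (C2 * m)"
        using Lp_bound_Hoelder(2)[OF Qi C2(2)[OF u(2)] s s'(2)] by simp
      finally show "(\<integral>t. inner (feedback q g t) (u t) \<partial>lborel) \<le> C2 * c * C1 * a * m" by (simp add: mult_ac)
    qed (use Lp_boundD[OF d] C1 C2 c Lp_boundD(3)[OF g(2)] in auto)
  qed
  moreover have "C2 * c * C1 \<ge> 0" using C1 C2 c by simp
  ultimately show ?thesis unfolding s_def by blast
qed

text \<open>The weak adjoint is defined by test functions, but coercivity tests with e^{2\<sigma>t}
  d, which is merely in L^2 with weight -\<sigma>. Both sides are continuous there, so density of
  the test functions suffices.\<close>

lemma feedback_pairing:
  assumes q: "q > 1" and \<sigma>: "0 \<le> \<sigma>" "\<sigma> < \<omega>" and d: "Lp_bound q 0 b d" "Lp_bound 2 \<sigma> a d"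
    and u: "Lp_bound 2 (- \<sigma>) m u"
  shows "(\<integral>t. inner (feedback q d t) (u t) \<partial>lborel) = (\<integral>t. inner (Q (input d t)) (input u t) \<partial>lborel)"
proof -
  obtain Ck where Ck: "Lp_bound 2 \<sigma> (Ck * a) (feedback q d)" "Ck \<ge> 0"
    using feedback_gain[OF q, of 2 1 \<sigma>] \<sigma> d \<gamma> by auto
  obtain C1 where C1: "C1 \<ge> 0" "Lp_bound 2 \<sigma> (C1 * a) (input d)" using input_bound1[of 2 \<sigma>] \<sigma> d by auto
  obtain C2 where C2: "C2 \<ge> 0" "\<And>u a. Lp_bound 2 (- \<sigma>) a u \<Longrightarrow> input_defined u"
    "\<And>u a. Lp_bound 2 (- \<sigma>) a u \<Longrightarrow> Lp_bound 2 (- \<sigma>) (C2 * a) (input u)"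
    using input_bound1[of 2 "- \<sigma>"] \<sigma> \<omega> by auto
  obtain c where c: "c \<ge> 0" "\<And>x. norm (Q x) \<le> c * norm x" by (rule Q_bound) blast
  define A where "A = c * (C1 * a)"
  have Qi: "Lp_bound 2 \<sigma> A (\<lambda>t. Q (input d t))" unfolding A_def by (rule Lp_bound_Q[OF c C1(2)]) simp
  have h: "(1::real) < 2" "1 / 2 + 1 / 2 = (1::real)" "(1::real) \<le> 2" by auto
  note I = Lp_bound_Hoelder[OF Ck(1) _ h(1,2)] and I' = Lp_bound_Hoelder[OF Qi _ h(1,2)]
  let ?d = "\<bar>(\<integral>t. inner (feedback q d t) (u t) \<partial>lborel) - (\<integral>t. inner (Q (input d t)) (input u t) \<partial>lborel)\<bar>"
  have le: "?d \<le> (Ck * a + A * C2) * e" if e: "e > 0" for e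
  proof -
    obtain v where v: "test_fun v" "Lp_bound 2 (- \<sigma>) e (\<lambda>t. u t - v t)" by (rule test_fun_dense[OF u h(3) e])
    obtain m' where v': "Lp_bound 2 (- \<sigma>) m' v" by (rule test_fun_Lp[OF v(1) h(3)])
    have sub: "(\<lambda>t. u t - v t) = (\<lambda>t. (-1) *\<^sub>R v t + u t)" by auto
    have "AE t in lborel. input (\<lambda>t. u t - v t) t = (-1) *\<^sub>R input v t + input u t"
      unfolding sub by (rule input_lincomb[OF C2(2)[OF v'] C2(2)[OF u] C2(2)[OF v(2)[unfolded sub]]])
    then have ae: "AE t in lborel. inner (Q (input d t)) (input (\<lambda>t. u t - v t) t)
        = inner (Q (input d t)) (input u t) - inner (Q (input d t)) (input v t)"
      by eventually_elim (simp add: inner_diff_right)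
    note iu = C2(3)[OF u] and iv = C2(3)[OF v'] and iw = C2(3)[OF v(2)]
    have [measurable]: "(\<lambda>t. Q (input d t)) \<in> borel_measurable borel" "input u \<in> borel_measurable borel"
      "input v \<in> borel_measurable borel" "input (\<lambda>t. u t - v t) \<in> borel_measurable borel"
      using Lp_boundD(1)[OF Qi] Lp_boundD(1)[OF iu] Lp_boundD(1)[OF iv] Lp_boundD(1)[OF iw] by auto
    have "(\<integral>t. inner (Q (input d t)) (input (\<lambda>t. u t - v t) t) \<partial>lborel)
        = (\<integral>t. inner (Q (input d t)) (input u t) - inner (Q (input d t)) (input v t) \<partial>lborel)"
      by (rule integral_cong_AE) (use ae in measurable)
    also have "\<dots> = (\<integral>t. inner (Q (input d t)) (input u t) \<partial>lborel) - (\<integral>t. inner (Q (input d t)) (input v t) \<partial>lborel)"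
      using I'(1)[OF iu] I'(1)[OF iv] by simp
    finally have e1: "\<bar>(\<integral>t. inner (Q (input d t)) (input u t) \<partial>lborel) - (\<integral>t. inner (Q (input d t)) (input v t) \<partial>lborel)\<bar>
        \<le> A * (C2 * e)" using I'(2)[OF iw] by simp
    have "(\<integral>t. inner (feedback q d t) (u t - v t) \<partial>lborel)
        = (\<integral>t. inner (feedback q d t) (u t) \<partial>lborel) - (\<integral>t. inner (feedback q d t) (v t) \<partial>lborel)"
      using I(1)[OF u] I(1)[OF v'] by (simp add: inner_diff_right)
    then have "\<bar>(\<integral>t. inner (feedback q d t) (u t) \<partial>lborel) - (\<integral>t. inner (feedback q d t) (v t) \<partial>lborel)\<bar>
        \<le> (Ck * a) * e" using I(2)[OF v(2)] by simp
    moreover have "(\<integral>t. inner (feedback q d t) (v t) \<partial>lborel) = (\<integral>t. inner (Q (input d t)) (input v t) \<partial>lborel)"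
      using feedback_weak(2)[OF q d(1)] v(1) by (simp add: weak_adj_def)
    ultimately show ?thesis using e1 by (simp add: algebra_simps)
  qed
  have "(\<lambda>n. (Ck * a + A * C2) * (1 / real (Suc n))) \<longlonglongrightarrow> (Ck * a + A * C2) * 0"
    using LIMSEQ_inverse_real_of_nat by (intro tendsto_mult tendsto_const) (simp add: inverse_eq_divide)
  then have "?d \<le> (Ck * a + A * C2) * 0"
    by (rule LIMSEQ_le_const) (intro exI[of _ 0] allI impI le, simp)
  then show ?thesis by simp
qed

section \<open>Coercivity in \<open>L\<^sup>2\<close> with a small weight\<close>

lemma exp_diff_bound:
  fixes a :: real
  assumes "0 \<le> \<sigma>" "\<sigma> \<le> \<omega> / 8" "0 \<le> a"
  shows "\<bar>exp (\<sigma> * a) - exp (- \<sigma> * a)\<bar> \<le> (16 * \<sigma> / \<omega>) * exp (\<omega> / 4 * a)"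
proof -
  have x: "0 \<le> \<sigma> * a" using assms by simp
  have "1 + (- 2 * (\<sigma> * a)) \<le> exp (- 2 * (\<sigma> * a))" by (rule exp_ge_add_one_self)
  then have "exp (\<sigma> * a) * (1 - exp (- 2 * (\<sigma> * a))) \<le> exp (\<sigma> * a) * (2 * (\<sigma> * a))"
    by (intro mult_left_mono) auto
  moreover have "exp (\<sigma> * a) * exp (- 2 * (\<sigma> * a)) = exp (- \<sigma> * a)" unfolding exp_add[symmetric] by simp
  ultimately have 1: "exp (\<sigma> * a) - exp (- \<sigma> * a) \<le> 2 * \<sigma> * a * exp (\<sigma> * a)" by (simp add: algebra_simps)
  \<comment> \<open>The factor \<open>a\<close> is traded for an exponential: the difference becomes
    O(\<sigma>) at the price of the growth e^{\<omega>a/4}, which the decay of the kernel can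
    absorb.\<close>
  have "\<omega> / 8 * a \<le> exp (\<omega> / 8 * a)" using exp_ge_add_one_self[of "\<omega> / 8 * a"] by linarith
  then have a: "a \<le> 8 / \<omega> * exp (\<omega> / 8 * a)" using \<omega> by (simp add: field_simps)
  have "\<sigma> * a \<le> \<omega> / 8 * a" using assms by (intro mult_right_mono)
  then have "exp (\<sigma> * a) \<le> exp (\<omega> / 8 * a)" by simp
  then have "2 * \<sigma> * a * exp (\<sigma> * a) \<le> 2 * \<sigma> * (8 / \<omega> * exp (\<omega> / 8 * a)) * exp (\<omega> / 8 * a)"
    using a assms \<omega> by (intro mult_mono) auto
  also have "\<dots> = (16 * \<sigma> / \<omega>) * (exp (\<omega> / 8 * a) * exp (\<omega> / 8 * a))" by simp
  also have "exp (\<omega> / 8 * a) * exp (\<omega> / 8 * a) = exp (\<omega> / 4 * a)" unfolding exp_add[symmetric] by simp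
  finally show ?thesis using 1 x by (simp add: abs_if)
qed

text \<open>Conjugating \<open>L\<close> with e^{\<sigma>t} multiplies its kernel by
  e^{\<sigma>(t-s)}, so the difference of the two conjugates carries the factor 2
  sinh(\<sigma>(t-s)), which is O(\<sigma>) up to a slow exponential growth.\<close>

lemma input_weight_difference:
  "\<exists>C\<ge>0. \<forall>\<sigma> u a. 0 \<le> \<sigma> \<longrightarrow> \<sigma> \<le> \<omega> / 8 \<longrightarrow> Lp_bound 2 0 a u \<longrightarrow> Lp_bound 2 0 (C * \<sigma> * a)
    (\<lambda>t. exp (\<sigma> * t) *\<^sub>R input (\<lambda>s. exp (- \<sigma> * s) *\<^sub>R u s) t - exp (- \<sigma> * t) *\<^sub>R input (\<lambda>s. exp (\<sigma> * s) *\<^sub>R u s) t)"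
proof -
  \<comment> \<open>With \<beta> = \<omega>/2 the kernel weight decays at the rate 2 \<beta> =
    \<omega>; the square of the growth factor e^{\<omega>a/4} consumes \<omega>/2 of it and leaves
    \<omega>/2.\<close>
  have b: "(1::real) < 2" "0 \<le> \<omega> / 2" "\<omega> / 2 < \<omega>" using \<omega> by auto
  obtain C0 where C0: "C0 \<ge> 0" and ker: "\<And>w t y W. w \<in> borel_measurable borel \<Longrightarrow> (\<And>a. 0 \<le> w a) \<Longrightarrow> 0 \<le> W \<Longrightarrow>
       (\<integral>\<^sup>+s. ennreal (kernel_weight \<gamma> (2 * (\<omega> / 2)) (t - s) * w s powr 2) \<partial>lborel) \<le> ennreal (W powr 2) \<Longrightarrow>
       (\<integral>\<^sup>+s. ennreal (w s * norm (kk (t - s) y)) \<partial>lborel) \<le> ennreal (C0 * W * norm (J y))"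
    using kernel_convolution[OF b] by blast
  obtain G where G: "G \<ge> 0" "(\<integral>\<^sup>+a. ennreal (kernel_weight \<gamma> (\<omega> / 2) a powr 1) \<partial>lborel) \<le> ennreal G"
    by (rule kernel_weight_integral[of \<gamma> "\<omega> / 2" 1]) (use \<gamma> \<omega> in auto)
  define C where "C = C0 * (16 / \<omega>) * sqrt G"
  have C: "C \<ge> 0" using C0 G \<omega> by (simp add: C_def)
  have "Lp_bound 2 0 (C * \<sigma> * a)
      (\<lambda>t. exp (\<sigma> * t) *\<^sub>R input (\<lambda>s. exp (- \<sigma> * s) *\<^sub>R u s) t - exp (- \<sigma> * t) *\<^sub>R input (\<lambda>s. exp (\<sigma> * s) *\<^sub>R u s) t)"
    if \<sigma>: "0 \<le> \<sigma>" "\<sigma> \<le> \<omega> / 8" and u: "Lp_bound 2 0 a u" for \<sigma> a u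
  proof -
    note D = Lp_boundD[OF u]
    have [measurable]: "u \<in> borel_measurable borel" using D by simp
    define um where "um s = exp (- \<sigma> * s) *\<^sub>R u s" for s
    define up where "up s = exp (\<sigma> * s) *\<^sub>R u s" for s
    have "Lp_bound 2 \<sigma> a um" "Lp_bound 2 (- \<sigma>) a up"
      using Lp_bound_weight[OF u, of "- \<sigma>"] Lp_bound_weight[OF u, of \<sigma>] by (simp_all add: um_def[abs_def] up_def[abs_def])
    moreover have "\<sigma> < \<omega>" "- \<sigma> < \<omega>" using \<sigma> \<omega> by auto
    ultimately have id: "input_defined um" "input_defined up"
      using input_bound1[OF b(1), of \<sigma>] input_bound1[OF b(1), of "- \<sigma>"] by blast+
    then have [measurable]: "input um \<in> borel_measurable borel" "input up \<in> borel_measurable borel"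
      and z: "\<And>t. t \<le> 0 \<Longrightarrow> input um t = 0" "\<And>t. t \<le> 0 \<Longrightarrow> input up t = 0"
      and ae: "AE t in lborel. is_input um t (input um t)" "AE t in lborel. is_input up t (input up t)"
      by (auto simp: input_defined_def)
    define dd where "dd t = exp (\<sigma> * t) *\<^sub>R input um t - exp (- \<sigma> * t) *\<^sub>R input up t" for t
    have [measurable]: "dd \<in> borel_measurable borel" unfolding dd_def by measurable
    define c where "c t = (\<integral>\<^sup>+s. ennreal (kernel_weight \<gamma> (\<omega> / 2) (t - s) * norm (u s) powr 2) \<partial>lborel)" for t
    have [measurable]: "c \<in> borel_measurable borel" unfolding c_def by measurable
    have cfin: "AE t in lborel. c t < \<infinity>"
      and cint: "(\<integral>\<^sup>+t. ennreal (enn2real (c t) powr 1) \<partial>lborel) \<le> ennreal ((a powr 2) powr 1 * G)"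
      unfolding c_def using D(4) G
      by (intro convolution_gain[where r = 1 and F = "a powr 2" and G = G]; simp add: kernel_weight_nonneg)+
    define k where "k = 16 * \<sigma> / \<omega>"
    have k: "k \<ge> 0" using \<sigma> \<omega> by (simp add: k_def)
    have bd: "AE t in lborel. norm (dd t) \<le> C0 * k * enn2real (c t) powr (1/2)"
      using ae cfin
    proof eventually_elim
      case (elim t)
      define W where "W = k * enn2real (c t) powr (1/2)"
      have W: "W \<ge> 0" using k by (simp add: W_def)
      \<comment> \<open>The indicator confines the estimate to s \<le> t, where
        \<open>exp_diff_bound\<close> applies; for s > t the kernel is 0.\<close>
      define w where "w s = indicator {..t} s * (k * exp (\<omega> / 4 * (t - s)) * norm (u s))" for s
      have [measurable]: "w \<in> borel_measurable borel" unfolding w_def by measurable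
      have w0: "0 \<le> w s" for s using k by (simp add: w_def)
      have pw: "kernel_weight \<gamma> (2 * (\<omega> / 2)) (t - s) * w s powr 2
          \<le> k\<^sup>2 * (kernel_weight \<gamma> (\<omega> / 2) (t - s) * norm (u s) powr 2)" for s
      proof (cases "s \<le> t")
        case True
        have "exp (\<omega> / 4 * (t - s)) powr 2 = exp (\<omega> / 2 * (t - s))" unfolding exp_powr_real by simp
        then have "w s powr 2 = k\<^sup>2 * exp (\<omega> / 2 * (t - s)) * norm (u s) powr 2"
          using True k by (simp add: w_def powr_mult)
        moreover have "exp (\<omega> / 2 * (t - s)) * kernel_weight \<gamma> (2 * (\<omega> / 2)) (t - s) = kernel_weight \<gamma> (\<omega> / 2) (t - s)"
          unfolding kernel_weight_exp by (simp add: field_simps)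
        moreover have "x * v \<le> l * (z * y)" if "v = l * e * y" "e * x = z" for x v l e y z :: real
          unfolding that(1) that(2)[symmetric] by (simp add: mult_ac)
        ultimately show ?thesis by blast
      qed (use kernel_weight_nonneg in \<open>simp add: w_def\<close>)
      have "(\<integral>\<^sup>+s. ennreal (kernel_weight \<gamma> (2 * (\<omega> / 2)) (t - s) * w s powr 2) \<partial>lborel)
          \<le> (\<integral>\<^sup>+s. ennreal (k\<^sup>2) * ennreal (kernel_weight \<gamma> (\<omega> / 2) (t - s) * norm (u s) powr 2) \<partial>lborel)"
      proof (rule nn_integral_mono)
        fix s
        show "ennreal (kernel_weight \<gamma> (2 * (\<omega> / 2)) (t - s) * w s powr 2)
            \<le> ennreal (k\<^sup>2) * ennreal (kernel_weight \<gamma> (\<omega> / 2) (t - s) * norm (u s) powr 2)"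
          unfolding ennreal_mult'[OF zero_le_power2, symmetric] by (rule ennreal_leI[OF pw])
      qed
      also have "\<dots> = ennreal (k\<^sup>2) * c t" unfolding c_def by (rule nn_integral_cmult) measurable
      also have "\<dots> = ennreal (k\<^sup>2 * enn2real (c t))" using elim(3) by (subst ennreal_mult) auto
      also have "k\<^sup>2 * enn2real (c t) = W powr 2" using k by (simp add: W_def powr_mult powr_powr)
      finally have le: "(\<integral>\<^sup>+s. ennreal (kernel_weight \<gamma> (2 * (\<omega> / 2)) (t - s) * w s powr 2) \<partial>lborel) \<le> ennreal (W powr 2)" .
      have kw: "(\<integral>\<^sup>+s. ennreal (w s * norm (kk (t - s) y)) \<partial>lborel) \<le> ennreal (C0 * W * norm (J y))" for y
        by (rule ker[OF _ w0 W le]) measurable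
      have "norm (dd t) \<le> C0 * W"
      proof (rule norm_le_dense)
        fix y
        let ?f = "\<lambda>s. inner (um s) (kk (t - s) y)" and ?g = "\<lambda>s. inner (up s) (kk (t - s) y)"
        have int: "integrable lborel ?f" "integrable lborel ?g"
          and val: "inner (input um t) (J y) = (\<integral>s. ?f s \<partial>lborel)" "inner (input up t) (J y) = (\<integral>s. ?g s \<partial>lborel)"
          using elim(1,2) by (auto simp: is_input_def)
        have int': "integrable lborel (\<lambda>s. exp (\<sigma> * t) * ?f s - exp (- \<sigma> * t) * ?g s)" using int by simp
        have "inner (dd t) (J y) = (\<integral>s. exp (\<sigma> * t) * ?f s - exp (- \<sigma> * t) * ?g s \<partial>lborel)"
          using int by (simp add: dd_def inner_diff_left val)
        moreover have "norm (\<integral>s. exp (\<sigma> * t) * ?f s - exp (- \<sigma> * t) * ?g s \<partial>lborel) \<le> C0 * W * norm (J y)"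
        proof -
          have "ennreal (norm (\<integral>s. exp (\<sigma> * t) * ?f s - exp (- \<sigma> * t) * ?g s \<partial>lborel))
              \<le> (\<integral>\<^sup>+s. norm (exp (\<sigma> * t) * ?f s - exp (- \<sigma> * t) * ?g s) \<partial>lborel)"
            by (rule integral_norm_bound_ennreal[OF int'])
          also have "\<dots> \<le> (\<integral>\<^sup>+s. ennreal (w s * norm (kk (t - s) y)) \<partial>lborel)"
          proof (intro nn_integral_mono ennreal_leI)
            fix s
            show "norm (exp (\<sigma> * t) * ?f s - exp (- \<sigma> * t) * ?g s) \<le> w s * norm (kk (t - s) y)"
            proof (cases "s \<le> t")
              case True
              have "exp (\<sigma> * t) * ?f s - exp (- \<sigma> * t) * ?g s
                  = (exp (\<sigma> * (t - s)) - exp (- \<sigma> * (t - s))) * inner (u s) (kk (t - s) y)"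
              proof -
                have "exp (\<sigma> * t) * exp (- \<sigma> * s) = exp (\<sigma> * (t - s))" "exp (- \<sigma> * t) * exp (\<sigma> * s) = exp (- \<sigma> * (t - s))"
                  unfolding exp_add[symmetric] by (simp_all add: algebra_simps)
                then show ?thesis by (simp add: um_def up_def mult.assoc[symmetric] left_diff_distrib)
              qed
              then have "norm (exp (\<sigma> * t) * ?f s - exp (- \<sigma> * t) * ?g s)
                  = \<bar>exp (\<sigma> * (t - s)) - exp (- \<sigma> * (t - s))\<bar> * \<bar>inner (u s) (kk (t - s) y)\<bar>" by (simp add: abs_mult)
              also have "\<dots> \<le> (k * exp (\<omega> / 4 * (t - s))) * (norm (u s) * norm (kk (t - s) y))"
                using True \<sigma> k unfolding k_def
                by (intro mult_mono exp_diff_bound Cauchy_Schwarz_ineq2) auto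
              finally show ?thesis using True by (simp add: w_def mult_ac)
            next
              case False
              then show ?thesis using kk_neg[of "t - s" y] by simp
            qed
          qed
          also note kw
          finally show ?thesis using C0 W by simp
        qed
        ultimately show "inner (dd t) (J y) \<le> C0 * W * norm (J y)" by simp
      qed (use C0 W in simp)
      then show ?case by (simp add: W_def mult.assoc)
    qed
    have "Lp_bound 2 0 (C * \<sigma> * a) dd"
    proof (rule Lp_boundI)
      have "(\<integral>\<^sup>+t. ennreal ((exp (0 * t) * norm (dd t)) powr 2) \<partial>lborel)
          \<le> (\<integral>\<^sup>+t. ennreal ((C0 * k)\<^sup>2) * ennreal (enn2real (c t) powr 1) \<partial>lborel)"
      proof (rule nn_integral_mono_AE, use bd in eventually_elim)
        case (elim t)
        have "norm (dd t) powr 2 \<le> (C0 * k * enn2real (c t) powr (1/2)) powr 2"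
          using elim by (intro powr_mono2) auto
        also have "\<dots> = (C0 * k)\<^sup>2 * enn2real (c t)" using C0 k by (simp add: powr_mult powr_powr power_mult_distrib)
        finally show ?case by (simp add: ennreal_mult[symmetric])
      qed
      also have "\<dots> = ennreal ((C0 * k)\<^sup>2) * (\<integral>\<^sup>+t. ennreal (enn2real (c t) powr 1) \<partial>lborel)"
        by (rule nn_integral_cmult) measurable
      also have "\<dots> \<le> ennreal ((C0 * k)\<^sup>2) * ennreal ((a powr 2) powr 1 * G)"
        using cint by (intro mult_left_mono) auto
      also have "\<dots> = ennreal ((C * \<sigma> * a) powr 2)"
        using C0 k G D(3) \<sigma> \<omega> by (simp add: C_def k_def ennreal_mult[symmetric] power_mult_distrib power_divide mult_ac)
      finally show "(\<integral>\<^sup>+t. ennreal ((exp (0 * t) * norm (dd t)) powr 2) \<partial>lborel) \<le> ennreal ((C * \<sigma> * a) powr 2)" .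
    qed (use z C \<sigma> D(3) in \<open>auto simp: dd_def\<close>)
    then show ?thesis by (simp add: dd_def[abs_def] um_def[abs_def] up_def[abs_def])
  qed
  then show ?thesis using C by blast
qed

text \<open>Polarisation: 4 <Qx, y> is the difference of the quadratic forms at x + y and x - y. The
  first is nonnegative, the second at most c |x - y|^2.\<close>

lemma Q_lower:
  assumes c: "\<And>x. norm (Q x) \<le> c * norm x"
  shows "- (c / 4) * (norm (x - y))\<^sup>2 \<le> inner (Q x) y"
proof -
  note lin = linear_add[OF bounded_linear.linear[OF Q]] linear_diff[OF bounded_linear.linear[OF Q]]
  have "inner (Q y) x = inner (Q x) y" by (metis Q_sym inner_commute)
  then have "4 * inner (Q x) y = inner (Q (x + y)) (x + y) - inner (Q (x - y)) (x - y)"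
    by (simp add: lin inner_add_left inner_add_right inner_diff_left inner_diff_right)
  moreover have "inner (Q (x - y)) (x - y) \<le> c * (norm (x - y))\<^sup>2"
  proof -
    have "inner (Q (x - y)) (x - y) \<le> norm (Q (x - y)) * norm (x - y)" by (rule norm_cauchy_schwarz)
    also have "\<dots> \<le> (c * norm (x - y)) * norm (x - y)" by (intro mult_right_mono c) auto
    finally show ?thesis by (simp add: power2_eq_square mult.assoc)
  qed
  ultimately show ?thesis using Q_pos[of "x + y"] by simp
qed

text \<open>The pairing is the inner product of L^2 with weight \<sigma>, so the bound says that I +
  K stays coercive with constant 1/2. Integrability is recorded because a divergent integral, read
  as 0, would satisfy the inequality trivially.\<close>

definition coercive_at :: "real \<Rightarrow> real \<Rightarrow> bool" where
  "coercive_at q \<sigma> \<longleftrightarrow> (\<forall>d a b. Lp_bound q 0 b d \<longrightarrow> Lp_bound 2 \<sigma> a d \<longrightarrow>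
    integrable lborel (\<lambda>t. inner (feedback q d t) (exp (2 * \<sigma> * t) *\<^sub>R d t)) \<and>
    - (1/2) * (\<integral>t. (exp (\<sigma> * t) * norm (d t))\<^sup>2 \<partial>lborel)
      \<le> (\<integral>t. inner (feedback q d t) (exp (2 * \<sigma> * t) *\<^sub>R d t) \<partial>lborel))"

text \<open>With \<open>x = e\<^sup>\<sigma>\<^sup>t (L d)(t)\<close> and \<open>y = e\<^sup>-\<^sup>\<sigma>\<^sup>t (L e\<^sup>2\<^sup>\<sigma>\<^sup>\<cdot> d)(t)\<close> the weighted pairing is the integral of
  \<open>inner (Q x) y\<close>, which is at least a negative multiple of \<open>(norm (x - y))\<^sup>2\<close>, and \<open>x - y\<close> is \<open>O(\<sigma>)\<close>.\<close>

lemma feedback_coercive: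
  assumes q: "q > 1"
  shows "\<exists>\<sigma>\<^sub>1>0. \<sigma>\<^sub>1 < \<omega> \<and> (\<forall>\<sigma>. 0 \<le> \<sigma> \<longrightarrow> \<sigma> \<le> \<sigma>\<^sub>1 \<longrightarrow> coercive_at q \<sigma>)"
proof -
  obtain C where C: "C \<ge> 0" and diff: "\<And>\<sigma> u a. 0 \<le> \<sigma> \<Longrightarrow> \<sigma> \<le> \<omega> / 8 \<Longrightarrow> Lp_bound 2 0 a u \<Longrightarrow> Lp_bound 2 0 (C * \<sigma> * a)
    (\<lambda>t. exp (\<sigma> * t) *\<^sub>R input (\<lambda>s. exp (- \<sigma> * s) *\<^sub>R u s) t - exp (- \<sigma> * t) *\<^sub>R input (\<lambda>s. exp (\<sigma> * s) *\<^sub>R u s) t)"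
    using input_weight_difference by blast
  obtain c where c: "c \<ge> 0" "\<And>x. norm (Q x) \<le> c * norm x" by (rule Q_bound) blast
  \<comment> \<open>The bound \<omega>/8 is the range of \<open>exp_diff_bound\<close>. The other
    two give c C^2 \<sigma>^2 \<le> 1, so that (c/4) (C \<sigma> a)^2 is at most a quarter of the
    squared norm; the summand 1 excludes division by 0.\<close>
  define \<sigma>\<^sub>1 where "\<sigma>\<^sub>1 = min (\<omega> / 8) (min 1 (1 / (c * C\<^sup>2 + 1)))"
  have cC: "c * C\<^sup>2 \<ge> 0" using c by simp
  have \<sigma>1: "\<sigma>\<^sub>1 > 0" "\<sigma>\<^sub>1 < \<omega>" using \<omega> cC by (auto simp: \<sigma>\<^sub>1_def add_nonneg_pos min_less_iff_disj)
  have "integrable lborel (\<lambda>t. inner (feedback q d t) (exp (2 * \<sigma> * t) *\<^sub>R d t)) \<and>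
      - (1/2) * (\<integral>t. (exp (\<sigma> * t) * norm (d t))\<^sup>2 \<partial>lborel)
      \<le> (\<integral>t. inner (feedback q d t) (exp (2 * \<sigma> * t) *\<^sub>R d t) \<partial>lborel)"
    if \<sigma>: "0 \<le> \<sigma>" "\<sigma> \<le> \<sigma>\<^sub>1" and d: "Lp_bound q 0 b d" "Lp_bound 2 \<sigma> a0 d" for \<sigma> d a0 b
  proof -
    define I where "I = (\<integral>t. (exp (\<sigma> * t) * norm (d t))\<^sup>2 \<partial>lborel)"
    \<comment> \<open>The given bound \<open>a0\<close> may exceed the norm. The inequality compares
      with \<open>I\<close> itself, so the exact norm serves as bound from here on.\<close>
    define a where "a = sqrt I"
    have I0: "I \<ge> 0" unfolding I_def by simp
    then have a: "a \<ge> 0" "a\<^sup>2 = I" by (auto simp: a_def)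
    have d2: "Lp_bound 2 \<sigma> a d" using Lp_bound_2D(3)[OF d(2)] unfolding a_def I_def .
    have s8: "\<sigma> \<le> \<omega> / 8" "\<sigma> \<le> 1" "\<sigma> \<le> 1 / (c * C\<^sup>2 + 1)" using \<sigma> by (auto simp: \<sigma>\<^sub>1_def)
    have sw: "\<sigma> < \<omega>" "- \<sigma> < \<omega>" using \<sigma> \<sigma>1 \<omega> by auto
    define u where "u t = exp (2 * \<sigma> * t) *\<^sub>R d t" for t
    have u: "Lp_bound 2 (- \<sigma>) a u"
      using Lp_bound_weight[OF d2, of "2 * \<sigma>"] by (simp add: u_def[abs_def])
    have h: "(1::real) < 2" "1 / 2 + 1 / 2 = (1::real)" "(1::real) \<le> 2" by auto
    obtain Ck where Ck: "Lp_bound 2 \<sigma> (Ck * a) (feedback q d)"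
      using feedback_gain[OF q h(1), of 1 \<sigma>] \<sigma>(1) sw d(1) d2 \<gamma> by auto
    have int: "integrable lborel (\<lambda>t. inner (feedback q d t) (u t))" by (rule Lp_bound_Hoelder(1)[OF Ck u h(1,2)])
    obtain C1 where C1: "Lp_bound 2 \<sigma> (C1 * a) (input d)" using input_bound1[OF h(1) sw(1)] d2 by blast
    obtain C2 where C2: "Lp_bound 2 (- \<sigma>) (C2 * a) (input u)" using input_bound1[OF h(1) sw(2)] u by blast
    have Qi: "Lp_bound 2 \<sigma> (c * (C1 * a)) (\<lambda>t. Q (input d t))" by (rule Lp_bound_Q[OF c C1 h(3)])
    have int2: "integrable lborel (\<lambda>t. inner (Q (input d t)) (input u t))" by (rule Lp_bound_Hoelder(1)[OF Qi C2 h(1,2)])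
    define D where "D t = exp (\<sigma> * t) *\<^sub>R input d t - exp (- \<sigma> * t) *\<^sub>R input u t" for t
    have D: "Lp_bound 2 0 (C * \<sigma> * a) D"
    proof -
      have "Lp_bound 2 (\<sigma> - \<sigma>) a (\<lambda>t. exp (\<sigma> * t) *\<^sub>R d t)" by (rule Lp_bound_weight[OF d2])
      then have "Lp_bound 2 0 a (\<lambda>t. exp (\<sigma> * t) *\<^sub>R d t)" by simp
      from diff[OF \<sigma>(1) s8(1) this]
      have "Lp_bound 2 0 (C * \<sigma> * a) (\<lambda>t. exp (\<sigma> * t) *\<^sub>R input (\<lambda>s. exp (- \<sigma> * s) *\<^sub>R exp (\<sigma> * s) *\<^sub>R d s) t
          - exp (- \<sigma> * t) *\<^sub>R input (\<lambda>s. exp (\<sigma> * s) *\<^sub>R exp (\<sigma> * s) *\<^sub>R d s) t)" .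
      moreover have "(\<lambda>s. exp (- \<sigma> * s) *\<^sub>R exp (\<sigma> * s) *\<^sub>R d s) = d"
        by (simp add: exp_add[symmetric])
      moreover have "(\<lambda>s. exp (\<sigma> * s) *\<^sub>R exp (\<sigma> * s) *\<^sub>R d s) = u"
        by (simp add: u_def[abs_def] exp_add[symmetric] algebra_simps)
      ultimately show ?thesis by (simp add: D_def[abs_def])
    qed
    have D2: "integrable lborel (\<lambda>t. (norm (D t))\<^sup>2)" "(\<integral>t. (norm (D t))\<^sup>2 \<partial>lborel) \<le> (C * \<sigma> * a)\<^sup>2"
      using Lp_bound_2D(1,2)[OF D] by simp_all
    have "- (1/2) * I \<le> - (c / 4) * (C * \<sigma> * a)\<^sup>2"
    proof -
      have "(c * C\<^sup>2 + 1) * \<sigma> \<le> 1" using s8(3) cC by (simp add: field_simps)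
      then have "c * C\<^sup>2 * \<sigma> \<le> 1" using \<sigma> by (simp add: algebra_simps)
      then have "(c * C\<^sup>2 * \<sigma>) * \<sigma> \<le> 1 * 1" using s8 \<sigma> cC by (intro mult_mono) auto
      then have "(c * C\<^sup>2 * \<sigma> * \<sigma>) * I \<le> 1 * I" using I0 by (intro mult_right_mono) auto
      then show ?thesis using I0 by (simp add: power_mult_distrib a(2) power2_eq_square[of \<sigma>] mult_ac)
    qed
    also have "\<dots> \<le> - (c / 4) * (\<integral>t. (norm (D t))\<^sup>2 \<partial>lborel)"
      using mult_left_mono[OF D2(2), of "c / 4"] c by simp
    also have "\<dots> = (\<integral>t. - (c / 4) * (norm (D t))\<^sup>2 \<partial>lborel)" by simp
    also have "\<dots> \<le> (\<integral>t. inner (Q (input d t)) (input u t) \<partial>lborel)"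
    proof (rule integral_mono)
      fix t
      have "- (c / 4) * (norm (D t))\<^sup>2 \<le> inner (Q (exp (\<sigma> * t) *\<^sub>R input d t)) (exp (- \<sigma> * t) *\<^sub>R input u t)"
        unfolding D_def by (rule Q_lower[OF c(2)])
      also have "\<dots> = inner (Q (input d t)) (input u t)"
        using Q by (simp add: bounded_linear.linear linear_scale mult.assoc[symmetric] exp_add[symmetric])
      finally show "- (c / 4) * (norm (D t))\<^sup>2 \<le> inner (Q (input d t)) (input u t)" .
    qed (use D2 int2 in auto)
    also have "\<dots> = (\<integral>t. inner (feedback q d t) (u t) \<partial>lborel)"
      by (rule feedback_pairing[OF q \<sigma>(1) sw(1) d(1) d2 u, symmetric])
    finally show ?thesis using int unfolding u_def I_def by simp
  qed
  then have "coercive_at q \<sigma>" if "0 \<le> \<sigma>" "\<sigma> \<le> \<sigma>\<^sub>1" for \<sigma>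
    unfolding coercive_at_def using that by blast
  then show ?thesis using \<sigma>1 by blast
qed

text \<open>One step of the damped iteration that subtracts \<rho> times d + K d from d. By
  coercivity it multiplies the squared norm by at most (1-\<rho>)^2 + \<rho>(1-\<rho>) + \<rho>^2
  C^2 = 1 - \<rho> + \<rho>^2 C^2, which is below 1 for small \<rho> however large the norm of K
  is.\<close>

lemma feedback_contraction:
  assumes q: "q > 1" and \<sigma>: "0 \<le> \<sigma>" "\<sigma> < \<omega>"
    and co: "coercive_at q \<sigma>"
  shows "\<exists>\<rho> \<mu>. 0 < \<rho> \<and> 0 < \<mu> \<and> \<mu> < 1 \<and> (\<forall>d a b. Lp_bound q 0 b d \<longrightarrow> Lp_bound 2 \<sigma> a d \<longrightarrow>
    Lp_bound 2 \<sigma> (\<mu> * \<mu> * a) (\<lambda>t. (1 - \<rho>) *\<^sub>R d t - \<rho> *\<^sub>R feedback q d t))"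
proof -
  obtain C where C: "C \<ge> 0" "\<And>g a b. Lp_bound q 0 b g \<Longrightarrow> Lp_bound 2 \<sigma> a g \<Longrightarrow> Lp_bound 2 \<sigma> (C * a) (feedback q g)"
    using feedback_gain[OF q, of 2 1 \<sigma>] \<sigma> \<gamma> by auto
  \<comment> \<open>This value gives \<rho> C^2 \<le> 1/2, hence a factor at most 1 - \<rho>/2 for
    the squared norm; the summand 2 keeps \<rho> at most 1/2 even for C = 0.\<close>
  define \<rho> where "\<rho> = 1 / (2 * C\<^sup>2 + 2)"
  have C2: "2 * C\<^sup>2 + 2 > 0" by (rule add_nonneg_pos) auto
  have \<rho>: "0 < \<rho>" "\<rho> \<le> 1/2" using C2 by (auto simp: \<rho>_def field_simps)
  have "C\<^sup>2 * \<rho> \<le> 1/2" using C2 by (simp add: \<rho>_def field_simps)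
  then have "\<rho> * (C\<^sup>2 * \<rho>) \<le> \<rho> * (1/2)" using \<rho> by (intro mult_left_mono) auto
  then have \<rho>C: "\<rho>\<^sup>2 * C\<^sup>2 \<le> \<rho> / 2" by (simp add: power2_eq_square mult_ac)
  define l where "l = 1 - \<rho> / 2"
  have l: "0 < l" "l < 1" using \<rho> by (auto simp: l_def)
  \<comment> \<open>The norm contracts by the square root of \<open>l\<close>. One more root is
    taken because \<open>Lp_bound_series\<close> expects a ratio of the form \<mu> \<mu>.\<close>
  define \<mu> where "\<mu> = sqrt (sqrt l)"
  have \<mu>: "0 < \<mu>" "\<mu> < 1" "(\<mu> * \<mu>)\<^sup>2 = l" using l by (auto simp: \<mu>_def)
  have "Lp_bound 2 \<sigma> (\<mu> * \<mu> * a0) (\<lambda>t. (1 - \<rho>) *\<^sub>R d t - \<rho> *\<^sub>R feedback q d t)"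
    if d: "Lp_bound q 0 b d" "Lp_bound 2 \<sigma> a0 d" for d a0 b
  proof -
    define I where "I = (\<integral>t. (exp (\<sigma> * t) * norm (d t))\<^sup>2 \<partial>lborel)"
    define a where "a = sqrt I"
    have I0: "I \<ge> 0" unfolding I_def by simp
    then have a: "a \<ge> 0" "a\<^sup>2 = I" by (auto simp: a_def)
    have d2: "Lp_bound 2 \<sigma> a d" using Lp_bound_2D(3)[OF d(2)] unfolding a_def I_def .
    have Kd: "Lp_bound 2 \<sigma> (C * a) (feedback q d)" by (rule C(2)[OF d(1) d2])
    note D = Lp_boundD[OF d2] Lp_boundD[OF Kd]
    have [measurable]: "d \<in> borel_measurable borel" "feedback q d \<in> borel_measurable borel" using D by auto
    note A = Lp_bound_2D(1,2)[OF d2] and E = Lp_bound_2D(1,2)[OF Kd]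
    note B = co[unfolded coercive_at_def, rule_format, OF d(1) d2]
    have pw: "(exp (\<sigma> * t) * norm ((1 - \<rho>) *\<^sub>R d t - \<rho> *\<^sub>R feedback q d t))\<^sup>2
        = (1 - \<rho>)\<^sup>2 * (exp (\<sigma> * t) * norm (d t))\<^sup>2 - 2 * \<rho> * (1 - \<rho>) * inner (feedback q d t) (exp (2 * \<sigma> * t) *\<^sub>R d t)
          + \<rho>\<^sup>2 * (exp (\<sigma> * t) * norm (feedback q d t))\<^sup>2" for t
    proof -
      have "(norm (x *\<^sub>R v - y *\<^sub>R z))\<^sup>2 = x\<^sup>2 * (norm v)\<^sup>2 - 2 * y * x * inner z v + y\<^sup>2 * (norm z)\<^sup>2" for x y and v z :: 'u
        unfolding power2_norm_eq_inner
        by (simp add: inner_diff_left inner_diff_right inner_commute power2_eq_square algebra_simps)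
      then have "(exp (\<sigma> * t) * norm ((1 - \<rho>) *\<^sub>R d t - \<rho> *\<^sub>R feedback q d t))\<^sup>2 = (exp (\<sigma> * t))\<^sup>2 *
          ((1 - \<rho>)\<^sup>2 * (norm (d t))\<^sup>2 - 2 * \<rho> * (1 - \<rho>) * inner (feedback q d t) (d t) + \<rho>\<^sup>2 * (norm (feedback q d t))\<^sup>2)"
        by (simp only: power_mult_distrib)
      moreover have "exp (2 * \<sigma> * t) = (exp (\<sigma> * t))\<^sup>2"
        unfolding power2_eq_square exp_add[symmetric] by (simp add: algebra_simps)
      ultimately show ?thesis by (simp add: power_mult_distrib algebra_simps)
    qed
    have int: "integrable lborel (\<lambda>t. (exp (\<sigma> * t) * norm ((1 - \<rho>) *\<^sub>R d t - \<rho> *\<^sub>R feedback q d t))\<^sup>2)"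
      unfolding pw using A E B by auto
    have "(\<integral>t. (exp (\<sigma> * t) * norm ((1 - \<rho>) *\<^sub>R d t - \<rho> *\<^sub>R feedback q d t))\<^sup>2 \<partial>lborel)
        = (1 - \<rho>)\<^sup>2 * I - 2 * \<rho> * (1 - \<rho>) * (\<integral>t. inner (feedback q d t) (exp (2 * \<sigma> * t) *\<^sub>R d t) \<partial>lborel)
          + \<rho>\<^sup>2 * (\<integral>t. (exp (\<sigma> * t) * norm (feedback q d t))\<^sup>2 \<partial>lborel)"
      unfolding pw I_def using A E B by simp
    also have "\<dots> \<le> (1 - \<rho>)\<^sup>2 * I + \<rho> * (1 - \<rho>) * I + \<rho>\<^sup>2 * (C\<^sup>2 * I)"
    proof -
      have "2 * \<rho> * (1 - \<rho>) * (- (1/2) * I)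
          \<le> 2 * \<rho> * (1 - \<rho>) * (\<integral>t. inner (feedback q d t) (exp (2 * \<sigma> * t) *\<^sub>R d t) \<partial>lborel)"
        using B \<rho> unfolding I_def by (intro mult_left_mono) auto
      moreover have "\<rho>\<^sup>2 * (\<integral>t. (exp (\<sigma> * t) * norm (feedback q d t))\<^sup>2 \<partial>lborel) \<le> \<rho>\<^sup>2 * (C\<^sup>2 * I)"
        using E(2) a by (intro mult_left_mono) (auto simp: power_mult_distrib)
      ultimately show ?thesis by simp
    qed
    also have "\<dots> = (1 - \<rho> + \<rho>\<^sup>2 * C\<^sup>2) * I" by (simp add: power2_eq_square algebra_simps)
    also have "\<dots> \<le> l * I" using \<rho>C I0 by (intro mult_right_mono) (auto simp: l_def)
    also have "\<dots> \<le> (\<mu> * \<mu> * a0)\<^sup>2"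
    proof -
      have "l * I \<le> l * a0\<^sup>2" using Lp_bound_2D(2)[OF d(2)] l unfolding I_def by (intro mult_left_mono) auto
      then show ?thesis by (simp only: power_mult_distrib[of "\<mu> * \<mu>"] \<mu>(3))
    qed
    finally have le: "(\<integral>t. (exp (\<sigma> * t) * norm ((1 - \<rho>) *\<^sub>R d t - \<rho> *\<^sub>R feedback q d t))\<^sup>2 \<partial>lborel) \<le> (\<mu> * \<mu> * a0)\<^sup>2" .
    show ?thesis
      using int le D \<mu> Lp_boundD(3)[OF d(2)] by (subst Lp_bound_2_iff) auto
  qed
  then show ?thesis using \<rho> \<mu> by blast
qed

section \<open>Solving the equation, in \<open>L\<^sup>2\<close> and then in
  \<open>L\<^sup>q\<close>\<close>

lemma feedback_zero:
  assumes q: "q > 1"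
  shows "AE t in lborel. feedback q (\<lambda>t. 0) t = 0"
  using feedback_lincomb[OF q Lp_bound_zero Lp_bound_zero, of "-1"] q by simp

text \<open>Neumann series for \<rho>(I + K) = I - \<open>T\<close>, with terms \<open>T\<close>^n
  applied to \<rho> f. As \<open>T\<close> is linear only almost everywhere, operator identities are
  replaced by an estimate: the residual of the limit is bounded by the remainders of the partial
  sums.\<close>

lemma feedback_solve_L2:
  assumes q: "1 < q" "q < 2" and \<sigma>: "0 < \<sigma>" "\<sigma> < \<omega>"
    and co: "coercive_at q \<sigma>"
  shows "\<exists>C\<ge>0. \<forall>f a. Lp_bound 2 \<sigma> a f \<longrightarrow>
    (\<exists>w. Lp_bound 2 \<sigma> (C * a) w \<and> (AE t in lborel. w t + feedback q w t = f t))"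
proof -
  have \<sigma>0: "0 \<le> \<sigma>" and q1: "q \<ge> 1" and two: "(1::real) \<le> 2" using \<sigma> q by auto
  \<comment> \<open>\<open>feedback q\<close> acts on the unweighted L^q, and \<sigma> > 0 is what
    places the weighted L^2 inside it.\<close>
  obtain Ce where emb: "\<And>a (f::real\<Rightarrow>'u). Lp_bound 2 \<sigma> a f \<Longrightarrow> Lp_bound q 0 (Ce * a) f"
    using Lp_bound_embed[OF q \<sigma>(1)] by blast
  obtain \<rho> \<mu> where \<rho>: "0 < \<rho>" and \<mu>: "0 < \<mu>" "\<mu> < 1"
    and con: "\<And>d a b. Lp_bound q 0 b d \<Longrightarrow> Lp_bound 2 \<sigma> a d \<Longrightarrow>
      Lp_bound 2 \<sigma> (\<mu> * \<mu> * a) (\<lambda>t. (1 - \<rho>) *\<^sub>R d t - \<rho> *\<^sub>R feedback q d t)"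
    using feedback_contraction[OF q(1) \<sigma>0 \<sigma>(2) co] by blast
  define T where "T d t = (1 - \<rho>) *\<^sub>R d t - \<rho> *\<^sub>R feedback q d t" for d t
  have T: "Lp_bound 2 \<sigma> (\<mu> * \<mu> * a) (T d)" if "Lp_bound 2 \<sigma> a d" for d a
    using con[OF emb[OF that] that] by (simp add: T_def[abs_def])
  have T_lin: "AE t in lborel. T (\<lambda>t. c *\<^sub>R d t + e t) t = c *\<^sub>R T d t + T e t"
    if "Lp_bound 2 \<sigma> a d" "Lp_bound 2 \<sigma> b e" for a b c d e
    using feedback_lincomb[OF q(1) emb[OF that(1)] emb[OF that(2)], of c]
    by eventually_elim (simp add: T_def algebra_simps)
  have "\<exists>w. Lp_bound 2 \<sigma> (\<rho> / (1 - \<mu>)\<^sup>2 * a) w \<and> (AE t in lborel. w t + feedback q w t = f t)"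
    if f: "Lp_bound 2 \<sigma> a f" for f a
  proof -
    define d where "d = rec_nat (\<lambda>t. \<rho> *\<^sub>R f t) (\<lambda>_. T)"
    have d0: "d 0 = (\<lambda>t. \<rho> *\<^sub>R f t)" and dS: "d (Suc n) = T (d n)" for n by (simp_all add: d_def)
    have d: "Lp_bound 2 \<sigma> (\<rho> * a * (\<mu> * \<mu>) ^ n) (d n)" for n
    proof (induction n)
      case 0
      show ?case using Lp_bound_scaleR[OF f two, of \<rho>] \<rho> by (simp add: d0)
    next
      case (Suc n)
      show ?case using T[OF Suc] by (simp add: dS mult_ac)
    qed
    obtain x where x: "\<And>n. Lp_bound 2 \<sigma> (\<rho> * a / (1 - \<mu>)\<^sup>2 * \<mu> ^ n) (\<lambda>t. x t - (\<Sum>i<n. d i t))"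
      using Lp_bound_series[OF d two \<mu>] by blast
    define S where "S n t = (\<Sum>i<n. d i t)" for n t
    have S: "\<exists>b. Lp_bound 2 \<sigma> b (S n)" for n
    proof (induction n)
      case 0
      show ?case using Lp_bound_zero[OF two] by (auto simp: S_def)
    next
      case (Suc n)
      then show ?case using Lp_bound_add[OF _ d two] by (fastforce simp: S_def)
    qed
    have TS: "AE t in lborel. S (Suc n) t = T (S n) t + \<rho> *\<^sub>R f t" for n
    proof (induction n)
      case 0
      show ?case using feedback_zero[OF q(1)] by eventually_elim (simp add: S_def[abs_def] T_def d0)
    next
      case (Suc n)
      obtain b where b: "Lp_bound 2 \<sigma> b (S n)" using S by blast
      have "S (Suc n) = (\<lambda>t. 1 *\<^sub>R S n t + d n t)" by (simp add: S_def fun_eq_iff)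
      then have "AE t in lborel. T (S (Suc n)) t = 1 *\<^sub>R T (S n) t + T (d n) t" using T_lin[OF b d[of n], of 1] by simp
      with Suc show ?case
      proof eventually_elim
        case (elim t)
        have "S (Suc (Suc n)) t = S (Suc n) t + T (d n) t" by (simp add: S_def dS)
        with elim show ?case by simp
      qed
    qed
    have x0: "Lp_bound 2 \<sigma> (\<rho> / (1 - \<mu>)\<^sup>2 * a) x" using x[of 0] by simp
    define e where "e t = x t - T x t - \<rho> *\<^sub>R f t" for t
    let ?c = "\<rho> * a / (1 - \<mu>)\<^sup>2"
    \<comment> \<open>With \<open>?y\<close> the remainder after n terms, the recursion for the
      partial sums turns the residual into (x - \<open>S (Suc n)\<close>) - \<open>T ?y\<close>, a
      difference of two functions that are both small for large n.\<close>
    have e: "Lp_bound 2 \<sigma> (2 * (?c * \<mu> ^ Suc n + \<mu> * \<mu> * (?c * \<mu> ^ n))) e" for n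
    proof -
      let ?y = "\<lambda>t. x t - S n t"
      have y: "Lp_bound 2 \<sigma> (?c * \<mu> ^ n) ?y" using x[of n] by (simp add: S_def)
      obtain b where b: "Lp_bound 2 \<sigma> b (S n)" using S by blast
      have "(\<lambda>t. (-1) *\<^sub>R S n t + x t) = ?y" by (simp add: fun_eq_iff)
      then have lin: "AE t in lborel. T ?y t = (-1) *\<^sub>R T (S n) t + T x t" using T_lin[OF b x0, of "-1"] by simp
      have "Lp_bound 2 \<sigma> (2 * (?c * \<mu> ^ Suc n + \<mu> * \<mu> * (?c * \<mu> ^ n))) (\<lambda>t. (x t - S (Suc n) t) - T ?y t)"
        by (rule Lp_bound_diff[OF _ T[OF y] two]) (use x[of "Suc n"] in \<open>simp add: S_def\<close>)
      then show ?thesis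
      proof (rule Lp_bound_cong_AE)
        note D = Lp_boundD[OF x0] Lp_boundD[OF f] Lp_boundD[OF T[OF x0]]
        show "e \<in> borel_measurable borel" using D unfolding e_def[abs_def] by measurable
        show "e t = 0" if "t \<le> 0" for t using D that by (simp add: e_def)
        show "AE t in lborel. 0 < t \<longrightarrow> norm (e t) = norm ((x t - S (Suc n) t) - T ?y t)"
          using TS[of n] lin
        proof eventually_elim
          case (elim t)
          then have "e t = (x t - S (Suc n) t) - T ?y t" by (simp add: e_def algebra_simps)
          then show ?case by simp
        qed
      qed
    qed
    have "(\<lambda>n. 2 * (?c * \<mu> ^ Suc n + \<mu> * \<mu> * (?c * \<mu> ^ n))) \<longlonglongrightarrow> 2 * (?c * 0 + \<mu> * \<mu> * (?c * 0))"
      using \<mu> by (intro tendsto_intros LIMSEQ_Suc LIMSEQ_realpow_zero) auto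
    then have "AE t in lborel. e t = 0" by (intro Lp_bound_tendsto_0[OF e _ two]) simp
    then have "AE t in lborel. x t + feedback q x t = f t"
    proof eventually_elim
      case (elim t)
      have "e t = \<rho> *\<^sub>R (x t + feedback q x t - f t)" by (simp add: e_def T_def algebra_simps)
      then show ?case using elim \<rho> by simp
    qed
    with x0 show ?thesis by blast
  qed
  moreover have "\<rho> / (1 - \<mu>)\<^sup>2 \<ge> 0" using \<rho> by simp
  ultimately show ?thesis by blast
qed

text \<open>If \<open>g\<close> solves the equation for \<open>- K h\<close>, then \<open>h + g\<close> solves it for \<open>h\<close>, and \<open>K h\<close> is more integrable
  than \<open>h\<close>.\<close>

lemma feedback_solve_step:
  assumes q: "q > 1" and p: "p > 1" and r: "r \<ge> 1" "\<gamma> * r < 1" and \<sigma>: "0 \<le> \<sigma>'" "\<sigma>' \<le> \<sigma>" "\<sigma> < \<omega>"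
    and solve: "\<exists>C\<ge>0. \<forall>h a. Lp_bound q \<sigma> a h \<longrightarrow> Lp_bound (p * r) \<sigma> a h \<longrightarrow>
      (\<exists>g. Lp_bound q \<sigma>' (C * a) g \<and> (AE t in lborel. g t + feedback q g t = h t))"
  shows "\<exists>C\<ge>0. \<forall>h a. Lp_bound q \<sigma> a h \<longrightarrow> Lp_bound p \<sigma> a h \<longrightarrow>
      (\<exists>g. Lp_bound q \<sigma>' (C * a) g \<and> (AE t in lborel. g t + feedback q g t = h t))"
proof -
  have q1: "q \<ge> 1" and \<sigma>0: "0 \<le> \<sigma>" using q \<sigma> by auto
  have "p * 1 \<le> p * r" using p r by (intro mult_left_mono) auto
  then have pr: "p * r \<ge> 1" using p by linarith
  obtain C where C: "C \<ge> 0" and sol: "\<And>h a. Lp_bound q \<sigma> a h \<Longrightarrow> Lp_bound (p * r) \<sigma> a h \<Longrightarrow>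
      \<exists>g. Lp_bound q \<sigma>' (C * a) g \<and> (AE t in lborel. g t + feedback q g t = h t)"
    using solve by blast
  obtain C1 where C1: "C1 \<ge> 0" "\<And>g a b. Lp_bound q 0 b g \<Longrightarrow> Lp_bound p \<sigma> a g \<Longrightarrow> Lp_bound (p * r) \<sigma> (C1 * a) (feedback q g)"
    using feedback_gain[OF q p r \<sigma>0 \<sigma>(3)] by blast
  \<comment> \<open>The gain lemma with r = 1 keeps K h in L^q at weight \<sigma>; the assumed
    solvability asks for both exponents.\<close>
  have "\<gamma> * 1 < 1" using \<gamma> by simp
  then obtain C2 where C2: "C2 \<ge> 0" "\<And>g a b. Lp_bound q 0 b g \<Longrightarrow> Lp_bound q \<sigma> a g \<Longrightarrow> Lp_bound (q * 1) \<sigma> (C2 * a) (feedback q g)"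
    using feedback_gain[OF q q, of 1 \<sigma>] \<sigma>0 \<sigma> by (metis order_refl)
  define K where "K = max C1 C2"
  have "\<exists>g. Lp_bound q \<sigma>' (2 * (1 + C * K) * a) g \<and> (AE t in lborel. g t + feedback q g t = h t)"
    if h: "Lp_bound q \<sigma> a h" "Lp_bound p \<sigma> a h" for h a
  proof -
    have a: "a \<ge> 0" using Lp_boundD(3)[OF h(1)] .
    have h0: "Lp_bound q 0 a h" by (rule Lp_bound_weight_mono[OF h(1) \<sigma>0 q1])
    have "C1 * a \<le> K * a" "C2 * a \<le> K * a" using a by (auto simp: K_def intro!: mult_right_mono)
    then have "Lp_bound q \<sigma> (K * a) (feedback q h)" "Lp_bound (p * r) \<sigma> (K * a) (feedback q h)"
      using Lp_bound_mono[OF C2(2)[OF h0 h(1)]] Lp_bound_mono[OF C1(2)[OF h0 h(2)]] q1 pr by simp_all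
    from Lp_bound_scaleR[OF this(1) q1, of "-1"] Lp_bound_scaleR[OF this(2) pr, of "-1"]
    have "Lp_bound q \<sigma> (K * a) (\<lambda>t. - feedback q h t)" "Lp_bound (p * r) \<sigma> (K * a) (\<lambda>t. - feedback q h t)" by simp_all
    from sol[OF this] obtain g where g: "Lp_bound q \<sigma>' (C * (K * a)) g" "AE t in lborel. g t + feedback q g t = - feedback q h t"
      by blast
    have g0: "Lp_bound q 0 (C * (K * a)) g" by (rule Lp_bound_weight_mono[OF g(1) \<sigma>(1) q1])
    have "Lp_bound q \<sigma>' (2 * (a + C * (K * a))) (\<lambda>t. h t + g t)"
      by (rule Lp_bound_add[OF Lp_bound_weight_mono[OF h(1) \<sigma>(2) q1] g(1) q1])
    then have 1: "Lp_bound q \<sigma>' (2 * (1 + C * K) * a) (\<lambda>t. h t + g t)" by (simp add: algebra_simps)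
    have "AE t in lborel. (h t + g t) + feedback q (\<lambda>t. h t + g t) t = h t"
      using g(2) feedback_lincomb[OF q h0 g0, of 1]
    proof eventually_elim
      case (elim t)
      have "(h t + g t) + (feedback q h t + feedback q g t) = h t + ((g t + feedback q g t) + feedback q h t)"
        by (simp add: algebra_simps)
      then show ?case using elim by simp
    qed
    with 1 show ?thesis by blast
  qed
  moreover have "2 * (1 + C * K) \<ge> 0" using C C1 by (simp add: K_def le_max_iff_disj)
  ultimately show ?thesis by blast
qed

text \<open>Descending induction on the exponent: each step divides by r the integrability required
  of the data, from p r^n down to p.\<close>

lemma feedback_solve:
  assumes q: "1 < q" and p: "1 < p" and r: "r \<ge> 1" "\<gamma> * r < 1" and \<sigma>: "0 \<le> \<sigma>'" "\<sigma>' \<le> \<sigma>" "\<sigma> < \<omega>"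
    and base: "\<exists>C\<ge>0. \<forall>h a. Lp_bound q \<sigma> a h \<longrightarrow> Lp_bound (p * r ^ n) \<sigma> a h \<longrightarrow>
      (\<exists>g. Lp_bound q \<sigma>' (C * a) g \<and> (AE t in lborel. g t + feedback q g t = h t))"
  shows "\<exists>C\<ge>0. \<forall>h a. Lp_bound q \<sigma> a h \<longrightarrow> Lp_bound p \<sigma> a h \<longrightarrow>
      (\<exists>g. Lp_bound q \<sigma>' (C * a) g \<and> (AE t in lborel. g t + feedback q g t = h t))"
  using p base
proof (induction n arbitrary: p)
  case 0
  then show ?case by simp
next
  case (Suc n)
  have "p * 1 \<le> p * r" using Suc.prems r by (intro mult_left_mono) auto
  then have "1 < p * r" using Suc.prems by linarith
  from Suc.IH[OF this] Suc.prems(2) show ?case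
    by (intro feedback_solve_step[OF q Suc.prems(1) r \<sigma>]) (simp add: mult.assoc)
qed

text \<open>From d = - K d every application of the gain multiplies the exponent by r. This serves
  uniqueness, which is decided in the unweighted L^2.\<close>

lemma feedback_bootstrap:
  assumes q: "1 < q" and p: "1 < p" and r: "r \<ge> 1" "\<gamma> * r < 1"
    and d: "Lp_bound q 0 b d" "Lp_bound p 0 a d" and eq: "AE t in lborel. d t + feedback q d t = 0"
  shows "\<exists>a. Lp_bound (p * r ^ n) 0 a d"
  using p d(2)
proof (induction n arbitrary: p a)
  case 0
  then show ?case by auto
next
  case (Suc n)
  have "p * 1 \<le> p * r" using Suc.prems r by (intro mult_left_mono) auto
  then have pr: "1 < p * r" using Suc.prems by linarith
  obtain C where "Lp_bound (p * r) 0 (C * a) (feedback q d)"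
    using feedback_gain[OF q Suc.prems(1) r order_refl \<omega>] d(1) Suc.prems(2) by blast
  then have "Lp_bound (p * r) 0 (C * a) d"
  proof (rule Lp_bound_cong_AE)
    show "AE t in lborel. 0 < t \<longrightarrow> norm (d t) = norm (feedback q d t)"
      using eq by eventually_elim (metis add_eq_0_iff norm_minus_cancel)
  qed (use Lp_boundD[OF d(1)] in auto)
  from Suc.IH[OF pr this] show ?case by (simp add: mult.assoc)
qed

theorem feedback_resolvent:
  assumes q: "1 < q" "q < 2" and \<delta>: "0 < \<delta>" "\<delta> < \<omega>"
  shows "\<exists>\<tau> C. 0 < \<tau> \<and> \<tau> < \<delta> \<and> 0 \<le> C \<and>
    (\<forall>h a. Lp_bound q \<delta> a h \<longrightarrow> (\<exists>g. Lp_bound q \<tau> (C * a) g \<and> (AE t in lborel. g t + feedback q g t = h t))) \<and>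
    (\<forall>g g' a a'. Lp_bound q \<tau> a g \<longrightarrow> Lp_bound q \<tau> a' g' \<longrightarrow>
      (AE t in lborel. g t + feedback q g t = g' t + feedback q g' t) \<longrightarrow> (AE t in lborel. g t = g' t))"
proof -
  have q1: "q \<ge> 1" and two: "(1::real) \<le> 2" using q by auto
  obtain \<sigma>\<^sub>1 where \<sigma>1: "\<sigma>\<^sub>1 > 0" "\<sigma>\<^sub>1 < \<omega>" and co: "\<And>\<sigma>. 0 \<le> \<sigma> \<Longrightarrow> \<sigma> \<le> \<sigma>\<^sub>1 \<Longrightarrow> coercive_at q \<sigma>"
    using feedback_coercive[OF q(1)] by blast
  \<comment> \<open>The weight has to stay below both the coercivity threshold and \<delta>; its
    half \<open>\<tau>\<close> then leaves room for the embedding of L^2 into L^q.\<close>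
  define \<sigma> where "\<sigma> = min \<sigma>\<^sub>1 \<delta>"
  have \<sigma>: "0 < \<sigma>" "\<sigma> \<le> \<sigma>\<^sub>1" "\<sigma> \<le> \<delta>" "\<sigma> < \<omega>" using \<sigma>1 \<delta> by (auto simp: \<sigma>_def)
  define \<tau> where "\<tau> = \<sigma> / 2"
  have \<tau>: "0 < \<tau>" "\<tau> < \<sigma>" "0 \<le> \<tau>" "\<tau> \<le> \<sigma>" "\<tau> < \<delta>" using \<sigma> by (auto simp: \<tau>_def)
  \<comment> \<open>A factor r with q r^n = 2 exactly and \<gamma> r < 1 is wanted: the n-th roots
    of 2/q tend to 1, which is below 1/\<gamma>. Reaching 2 exactly avoids interpolation between
    exponents.\<close>
  have "(\<lambda>n. (2 / q) powr (1 / real (Suc n))) \<longlonglongrightarrow> (2 / q) powr 0"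
    using q LIMSEQ_inverse_real_of_nat by (intro tendsto_intros) (auto simp: inverse_eq_divide)
  then have "(\<lambda>n. (2 / q) powr (1 / real (Suc n))) \<longlonglongrightarrow> 1" using q by simp
  moreover have "1 < 1 / \<gamma>" using \<gamma> by simp
  ultimately have "eventually (\<lambda>n. (2 / q) powr (1 / real (Suc n)) < 1 / \<gamma>) sequentially"
    by (rule order_tendstoD)
  then obtain n0 where n0: "(2 / q) powr (1 / real (Suc n0)) < 1 / \<gamma>" by (auto simp: eventually_sequentially)
  define n where "n = Suc n0"
  define r where "r = (2 / q) powr (1 / real n)"
  have r: "r \<ge> 1" "\<gamma> * r < 1"
    using n0 q \<gamma> ge_one_powr_ge_zero[of "2 / q" "1 / real n"] by (auto simp: r_def n_def field_simps)
  have rn: "q * r ^ n = 2"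
    using q by (simp add: r_def powr_realpow[symmetric] powr_powr n_def del: power_Suc)
  obtain Ce where emb: "Ce \<ge> 0" "\<And>a (f::real\<Rightarrow>'u). Lp_bound 2 \<sigma> a f \<Longrightarrow> Lp_bound q \<tau> (Ce * a) f"
    using Lp_bound_embed[OF q \<tau>(2)] by blast
  obtain C2 where C2: "C2 \<ge> 0" "\<And>f a. Lp_bound 2 \<sigma> a f \<Longrightarrow>
    \<exists>w. Lp_bound 2 \<sigma> (C2 * a) w \<and> (AE t in lborel. w t + feedback q w t = f t)"
    using feedback_solve_L2[OF q \<sigma>(1,4) co[OF less_imp_le[OF \<sigma>(1)] \<sigma>(2)]] by blast
  have "\<exists>C\<ge>0. \<forall>h a. Lp_bound q \<sigma> a h \<longrightarrow> Lp_bound (q * r ^ n) \<sigma> a h \<longrightarrow>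
      (\<exists>g. Lp_bound q \<tau> (C * a) g \<and> (AE t in lborel. g t + feedback q g t = h t))"
  proof (intro exI[of _ "Ce * C2"] conjI allI impI)
    fix h :: "real \<Rightarrow> 'u" and a assume "Lp_bound (q * r ^ n) \<sigma> a h"
    then obtain w where "Lp_bound 2 \<sigma> (C2 * a) w" "AE t in lborel. w t + feedback q w t = h t"
      using C2(2) unfolding rn by blast
    then show "\<exists>g. Lp_bound q \<tau> (Ce * C2 * a) g \<and> (AE t in lborel. g t + feedback q g t = h t)"
      using emb(2)[of "C2 * a" w] by (auto simp: mult.assoc)
  qed (use emb C2 in simp)
  from feedback_solve[OF q(1) q(1) r \<tau>(3,4) \<sigma>(4) this]
  obtain C where C: "C \<ge> 0" "\<And>h a. Lp_bound q \<sigma> a h \<Longrightarrow>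
      \<exists>g. Lp_bound q \<tau> (C * a) g \<and> (AE t in lborel. g t + feedback q g t = h t)" by blast
  have ex: "\<exists>g. Lp_bound q \<tau> (C * a) g \<and> (AE t in lborel. g t + feedback q g t = h t)" if "Lp_bound q \<delta> a h" for h a
    by (rule C(2)[OF Lp_bound_weight_mono[OF that \<sigma>(3) q1]])
  have un: "AE t in lborel. g t = g' t"
    if g: "Lp_bound q \<tau> a g" "Lp_bound q \<tau> a' g'" and eq: "AE t in lborel. g t + feedback q g t = g' t + feedback q g' t" for g g' a a'
  proof -
    \<comment> \<open>The difference of two solutions satisfies d = - K d. Once it is in L^2,
      coercivity at weight 0 gives -|d|^2 = <K d, d> \<ge> -|d|^2 / 2 for the L^2 norm, hence d =
      0.\<close>
    define d where "d t = (-1) *\<^sub>R g' t + g t" for t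
    have g0: "Lp_bound q 0 a g" "Lp_bound q 0 a' g'" using g Lp_bound_weight_mono[OF _ \<tau>(3) q1] by auto
    from Lp_bound_add[OF Lp_bound_scaleR[OF g0(2) q1] g0(1) q1, of "-1"] obtain b where d: "Lp_bound q 0 b d"
      unfolding d_def[abs_def] by blast
    have de: "AE t in lborel. d t + feedback q d t = 0"
      using eq feedback_lincomb[OF q(1) g0(2,1), of "-1"]
    proof eventually_elim
      case (elim t)
      have "d = (\<lambda>t. (-1) *\<^sub>R g' t + g t)" by (simp add: fun_eq_iff d_def)
      then have "feedback q d t = - feedback q g' t + feedback q g t" using elim(2) by simp
      then have "d t + feedback q d t = (g t + feedback q g t) - (g' t + feedback q g' t)"
        by (simp add: d_def)
      then show ?case using elim(1) by simp
    qed
    obtain c where d2: "Lp_bound 2 0 c d"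
      using feedback_bootstrap[OF q(1) q(1) r d d de, of n] unfolding rn by blast
    let ?I = "\<integral>t. (exp (0 * t) * norm (d t))\<^sup>2 \<partial>lborel"
    have [measurable]: "d \<in> borel_measurable borel" using Lp_boundD[OF d] by simp
    have co0: "integrable lborel (\<lambda>t. inner (feedback q d t) (exp (2 * 0 * t) *\<^sub>R d t))"
      "- (1/2) * ?I \<le> (\<integral>t. inner (feedback q d t) (exp (2 * 0 * t) *\<^sub>R d t) \<partial>lborel)"
      using co[OF order_refl less_imp_le[OF \<sigma>1(1)]] d d2 unfolding coercive_at_def by blast+
    have "(\<integral>t. inner (feedback q d t) (exp (2 * 0 * t) *\<^sub>R d t) \<partial>lborel) = (\<integral>t. - ((exp (0 * t) * norm (d t))\<^sup>2) \<partial>lborel)"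
    proof (rule integral_cong_AE)
      show "AE t in lborel. inner (feedback q d t) (exp (2 * 0 * t) *\<^sub>R d t) = - ((exp (0 * t) * norm (d t))\<^sup>2)"
        using de
      proof eventually_elim
        case (elim t)
        then have "feedback q d t = - d t" by (simp add: add_eq_0_iff)
        then show ?case by (simp add: dot_square_norm)
      qed
    qed (use borel_measurable_integrable[OF co0(1)] in measurable)
    also have "\<dots> = - ?I" by simp
    finally have "?I \<le> 0" using co0(2) by simp
    moreover have "?I \<ge> 0" by simp
    ultimately have "?I = 0" by linarith
    then have "Lp_bound 2 0 0 d" using Lp_bound_2D(3)[OF d2] by simp
    from Lp_bound_tendsto_0[OF this tendsto_const two] show ?thesis
      by eventually_elim (simp add: d_def)
  qed
  show ?thesis using \<tau>(1,5) C(1) ex un by blast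
qed

end

section \<open>Adjoints in complex Hilbert spaces\<close>

lemma cinner_scaleC_right: "cinner x (c *\<^sub>C y) = cnj c * cinner x y"
  by (metis cinner_commute cinner_scaleC_left complex_cnj_mult)

lemma Im_cinner: "Im (cinner x y) = - inner (\<i> *\<^sub>C x) y"
  by (simp add: Re_cinner[symmetric] cinner_scaleC_left)

lemma Im_cinner': "Im (cinner x y) = inner x (\<i> *\<^sub>C y)"
  by (simp add: Re_cinner[symmetric] cinner_scaleC_right)

lemma inner_eqI:
  fixes u v :: "'a::real_inner"
  assumes "\<And>x. inner x u = inner x v"
  shows "u = v"
proof -
  have "inner (u - v) (u - v) = 0" using assms[of "u - v"] by (simp add: inner_diff_right)
  then show ?thesis by simp
qed

lemma cinner_eqI:
  fixes u v :: "'a::complex_hilbert"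
  assumes "\<And>x. cinner x u = cinner x v"
  shows "u = v"
proof (rule inner_eqI)
  fix x show "inner x u = inner x v" using assms[of x] by (metis Re_cinner)
qed

lemma scaleC_0_left: "0 *\<^sub>C x = (0::'a::complex_hilbert)"
  using scaleC_of_real[of 0 x] by simp

lemma scaleC_1: "1 *\<^sub>C x = (x::'a::complex_hilbert)"
  using scaleC_of_real[of 1 x] by simp

lemma clinear_onD:
  assumes T: "clinear_on D T"
  shows clinear_on_zero: "0 \<in> D" "T 0 = 0"
    and clinear_on_add: "x \<in> D \<Longrightarrow> y \<in> D \<Longrightarrow> x + y \<in> D" "x \<in> D \<Longrightarrow> y \<in> D \<Longrightarrow> T (x + y) = T x + T y"
    and clinear_on_scaleC: "x \<in> D \<Longrightarrow> c *\<^sub>C x \<in> D" "x \<in> D \<Longrightarrow> T (c *\<^sub>C x) = c *\<^sub>C T x"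
    and clinear_on_scaleR: "x \<in> D \<Longrightarrow> r *\<^sub>R x \<in> D" "x \<in> D \<Longrightarrow> T (r *\<^sub>R x) = r *\<^sub>R T x"
proof -
  have z: "0 \<in> D" and lin: "\<And>c x y. x \<in> D \<Longrightarrow> y \<in> D \<Longrightarrow> c *\<^sub>C x + y \<in> D \<and> T (c *\<^sub>C x + y) = c *\<^sub>C T x + T y"
    using T by (auto simp: clinear_on_def)
  show "0 \<in> D" by fact
  show T0: "T 0 = 0" using lin[OF z z, of 1] by (simp add: scaleC_1)
  show "x + y \<in> D" "T (x + y) = T x + T y" if "x \<in> D" "y \<in> D" for x y
    using lin[OF that, of 1] by (auto simp: scaleC_1)
  show *: "c *\<^sub>C x \<in> D" "T (c *\<^sub>C x) = c *\<^sub>C T x" if "x \<in> D" for c x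
    using lin[OF that z, of c] T0 by auto
  show "r *\<^sub>R x \<in> D" "T (r *\<^sub>R x) = r *\<^sub>R T x" if "x \<in> D" for r x
    using *[OF that, of "complex_of_real r"] by (auto simp: scaleC_of_real)
qed

lemma bounded_clinear_imp_bounded_linear:
  assumes "bounded_clinear T"
  shows "bounded_linear T"
proof -
  have c: "clinear_on UNIV T" and "\<exists>C. \<forall>x. norm (T x) \<le> C * norm x" using assms by (auto simp: bounded_clinear_def)
  then obtain C where C: "\<And>x. norm (T x) \<le> C * norm x" by blast
  show ?thesis
    by (rule bounded_linear_intro[of _ C])
      (auto simp: clinear_on_add[OF c] clinear_on_scaleR[OF c] C mult.commute)
qed

text \<open>The Riesz vector is found for the real inner product; replacing x by \<i> x recovers the
  imaginary parts.\<close>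

lemma adj_bounded_char:
  assumes T: "bounded_clinear T"
  shows "cinner (T x) y = cinner x (adj UNIV T y)"
proof -
  have c: "clinear_on UNIV T" using T by (simp add: bounded_clinear_def)
  obtain C where C: "\<And>x. norm (T x) \<le> norm x * C" "C \<ge> 0"
    using bounded_linear.nonneg_bounded[OF bounded_clinear_imp_bounded_linear[OF T]] by blast
  have lin: "linear (\<lambda>x. inner (T x) y)"
    by (rule linearI) (auto simp: clinear_on_add[OF c] clinear_on_scaleR[OF c] inner_add_left)
  have bnd: "\<bar>inner (T x) y\<bar> \<le> (C * norm y) * norm (id x)" for x
  proof -
    have "\<bar>inner (T x) y\<bar> \<le> norm (T x) * norm y" by (rule Cauchy_Schwarz_ineq2)
    also have "\<dots> \<le> (norm x * C) * norm y" by (intro mult_right_mono C) auto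
    finally show ?thesis by (simp add: mult_ac)
  qed
  have "C * norm y \<ge> 0" using C by simp
  then obtain z where z: "\<And>x. inner z (id x) = inner (T x) y"
    using Riesz_representation[OF linear_id lin bnd] by blast
  have cz: "cinner (T x) y = cinner x z" for x
  proof (rule complex_eqI)
    show "Re (cinner (T x) y) = Re (cinner x z)" using z[of x] by (simp add: Re_cinner inner_commute)
    show "Im (cinner (T x) y) = Im (cinner x z)"
      using z[of "\<i> *\<^sub>C x"] clinear_on_scaleC(2)[OF c, of x \<i>] by (simp add: Im_cinner inner_commute)
  qed
  have "adj UNIV T y = z" unfolding adj_def
  proof (rule the_equality)
    fix z' assume "\<forall>x\<in>UNIV. cinner (T x) y = cinner x z'"
    then have "inner x z' = inner x z" for x using cz[of x] by (metis Re_cinner UNIV_I)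
    then show "z' = z" by (rule inner_eqI)
  qed (use cz in simp)
  then show ?thesis using cz by simp
qed

lemma adj_bounded_inner:
  assumes T: "bounded_clinear T"
  shows "inner (T x) y = inner x (adj UNIV T y)"
  using adj_bounded_char[OF assms, of x y] by (metis Re_cinner)

text \<open>The adjoint relation alone forces linearity, and |T' y|^2 = <T (T' y), y> gives the same
  constant. It is meant for adjoints that are only specified pointwise.\<close>

lemma real_adjoint_bounded_linear:
  fixes T :: "'a::real_inner \<Rightarrow> 'b::real_inner"
  assumes ad: "\<And>x y. inner (T x) y = inner x (T' y)" and C: "\<And>x. norm (T x) \<le> C * norm x" "C \<ge> 0"
  shows "bounded_linear T'" "norm (T' y) \<le> C * norm y"
proof -
  have b: "norm (T' y) \<le> C * norm y" for y
  proof (cases "T' y = 0")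
    case False
    have "norm (T' y) * norm (T' y) = inner (T (T' y)) y" by (simp add: ad dot_square_norm power2_eq_square)
    also have "\<dots> \<le> norm (T (T' y)) * norm y" by (rule norm_cauchy_schwarz)
    also have "\<dots> \<le> (C * norm (T' y)) * norm y" by (intro mult_right_mono C) auto
    finally have "norm (T' y) * norm (T' y) \<le> norm (T' y) * (C * norm y)" by (simp add: mult_ac)
    then show ?thesis using False by simp
  qed (use C in simp)
  show "norm (T' y) \<le> C * norm y" by (rule b)
  show "bounded_linear T'"
  proof (rule bounded_linear_intro[of _ C])
    show "T' (x + y) = T' x + T' y" for x y
      by (rule inner_eqI) (simp add: ad[symmetric] inner_add_right)
    show "T' (r *\<^sub>R x) = r *\<^sub>R T' x" for r x
      by (rule inner_eqI) (simp add: ad[symmetric])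
    show "norm (T' x) \<le> norm x * C" for x using b[of x] by (simp add: mult.commute)
  qed
qed

text \<open>The Riesz vector of the pairing with x is the projection of x to the closure of the
  range; the remainder is orthogonal to the range and hence 0.\<close>

lemma dense_of_orthogonal:
  fixes J :: "'v::real_vector \<Rightarrow> 'h::{real_inner, banach}"
  assumes J: "linear J" and orth: "\<And>v. (\<And>y. inner v (J y) = 0) \<Longrightarrow> v = 0"
  shows "closure (range J) = UNIV"
proof -
  have "x \<in> closure (range J)" for x
  proof -
    have "linear (\<lambda>y. inner x (J y))"
      by (rule linearI) (auto simp: linear_add[OF J] linear_scale[OF J] inner_add_right)
    then obtain l where l: "\<And>y. inner l (J y) = inner x (J y)" "l \<in> closure (range J)"
      using Riesz_representation[OF J _ Cauchy_Schwarz_ineq2 norm_ge_zero] by blast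
    have "l - x = 0" by (rule orth) (simp add: inner_diff_left l)
    then show ?thesis using l by simp
  qed
  then show ?thesis by auto
qed

lemma integral_segment_bound:
  fixes f :: "real \<Rightarrow> 'a::{banach, second_countable_topology}"
  assumes i: "integrable lborel (\<lambda>r. indicator {0..<h} r *\<^sub>R f r)" and h: "h \<ge> 0"
    and b: "\<And>r. 0 \<le> r \<Longrightarrow> r < h \<Longrightarrow> norm (f r) \<le> e"
  shows "norm (\<integral>r. indicator {0..<h} r *\<^sub>R f r \<partial>lborel) \<le> e * h"
proof (cases "h = 0")
  case False
  have e0: "e \<ge> 0" using b[of 0] norm_ge_zero[of "f 0"] False h by linarith
  have "norm (\<integral>r. indicator {0..<h} r *\<^sub>R f r \<partial>lborel) \<le> (\<integral>r. indicator {0..<h} r *\<^sub>R e \<partial>lborel)"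
  proof (rule Bochner_Integration.integral_norm_bound_integral[OF i])
    show "integrable lborel (\<lambda>r. indicator {0..<h} r *\<^sub>R e)" using h by (intro integrable_indicator) auto
    show "norm (indicator {0..<h} r *\<^sub>R f r) \<le> indicator {0..<h} r *\<^sub>R e" for r
      using b[of r] by (auto simp: indicator_def)
  qed
  also have "\<dots> = e * h" using h by simp
  finally show ?thesis .
qed simp

section \<open>The adjoint of the generator of a stable semigroup\<close>

locale stable_semigroup =
  fixes D :: "'y::{complex_hilbert, second_countable_topology} set" and A :: "'y \<Rightarrow> 'y"
    and S :: "real \<Rightarrow> 'y \<Rightarrow> 'y" and M \<omega> :: real
  assumes A_lin: "clinear_on D A" and gen: "generates D A S" and M1: "M \<ge> 1" and \<omega>: "\<omega> > 0"
    and S_onorm: "\<And>t. t \<ge> 0 \<Longrightarrow> onorm (S t) \<le> M * exp (- \<omega> * t)"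
begin

lemma S_bc: "t \<ge> 0 \<Longrightarrow> bounded_clinear (S t)"
  using gen by (simp add: generates_def C0_semigroup_def)

lemma S_bl: "t \<ge> 0 \<Longrightarrow> bounded_linear (S t)"
  by (intro bounded_clinear_imp_bounded_linear S_bc)

lemma S_0 [simp]: "S 0 x = x"
  using gen by (simp add: generates_def C0_semigroup_def)

lemma S_add: "s \<ge> 0 \<Longrightarrow> t \<ge> 0 \<Longrightarrow> S (s + t) x = S s (S t x)"
  using gen by (simp add: generates_def C0_semigroup_def)

lemma S_lim: "((\<lambda>t. S t x) \<longlongrightarrow> x) (at_right 0)"
  using gen by (simp add: generates_def C0_semigroup_def)

lemma S_bound: "t \<ge> 0 \<Longrightarrow> norm (S t x) \<le> M * exp (- \<omega> * t) * norm x"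
  using onorm[OF S_bl, of t x] S_onorm[of t] by (meson mult_right_mono norm_ge_zero order_trans)

lemma S_bound_M: "t \<ge> 0 \<Longrightarrow> norm (S t x) \<le> M * norm x"
proof -
  assume t: "t \<ge> 0"
  have "M * exp (- \<omega> * t) * norm x \<le> M * 1 * norm x"
    using t \<omega> M1 by (intro mult_right_mono mult_left_mono) auto
  then show ?thesis using S_bound[OF t, of x] by simp
qed

lemma S_diff_bound:
  assumes "0 \<le> s" "s \<le> t"
  shows "norm (S t x - S s x) \<le> M * norm (S (t - s) x - x)"
proof -
  have "S t x = S s (S (t - s) x)" using S_add[of s "t - s" x] assms by simp
  then have "S t x - S s x = S s (S (t - s) x - x)"
    using S_bl[OF assms(1)] by (simp add: bounded_linear.linear linear_diff)
  then show ?thesis using S_bound_M[OF assms(1)] by simp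
qed

text \<open>Right continuity at 0 and uniform boundedness give continuity from both sides: the
  increment from s to t is \<open>S s\<close> applied to an increment starting at 0.\<close>

lemma S_continuous: "continuous_on {0..} (\<lambda>t. S t x)"
  unfolding continuous_on_iff
proof (intro ballI allI impI)
  fix t e :: real assume t: "t \<in> {0..}" and e: "e > 0"
  have "eventually (\<lambda>h. dist (S h x) x < e / M) (at_right 0)"
    using S_lim[of x] e M1 by (intro tendstoD) auto
  then obtain d where d: "d > 0" "\<And>h. 0 < h \<Longrightarrow> h < d \<Longrightarrow> dist (S h x) x < e / M"
    unfolding eventually_at_right_field by auto
  have "dist (S s x) (S t x) < e" if s: "s \<ge> 0" "dist s t < d" for s
  proof (cases s t rule: linorder_cases)
    case less
    have "norm (S t x - S s x) \<le> M * norm (S (t - s) x - x)" using less s by (intro S_diff_bound) auto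
    also have "\<dots> < M * (e / M)" using d(2)[of "t - s"] less s M1 by (intro mult_strict_left_mono) (auto simp: dist_norm)
    finally show ?thesis using M1 by (simp add: dist_norm norm_minus_commute)
  next
    case greater
    have "norm (S s x - S t x) \<le> M * norm (S (s - t) x - x)" using greater t by (intro S_diff_bound) auto
    also have "\<dots> < M * (e / M)" using d(2)[of "s - t"] greater s M1 by (intro mult_strict_left_mono) (auto simp: dist_norm)
    finally show ?thesis using M1 by (simp add: dist_norm)
  qed (use e in simp)
  then show "\<exists>d>0. \<forall>s\<in>{0..}. dist s t < d \<longrightarrow> dist (S s x) (S t x) < e" using d(1) by auto
qed

lemma S_measurable [measurable]: "(\<lambda>t. indicator {0..} t *\<^sub>R S t x) \<in> borel_measurable borel"
  using S_continuous by (intro borel_measurable_continuous_on_indicator) auto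

lemma S_nn_bound: "(\<integral>\<^sup>+t. ennreal (norm (indicator {0..} t *\<^sub>R S t x)) \<partial>lborel) \<le> ennreal (M * norm x * (1 / \<omega>))"
proof -
  have "(\<integral>\<^sup>+t. ennreal (norm (indicator {0..} t *\<^sub>R S t x)) \<partial>lborel)
      \<le> (\<integral>\<^sup>+t. ennreal (M * norm x) * ennreal (indicator {0<..} t * exp (- \<omega> * t)) \<partial>lborel)"
  proof (rule nn_integral_mono_AE, use AE_lborel_singleton[of 0] in eventually_elim)
    case (elim t)
    show ?case
    proof (cases "t > 0")
      case True
      then show ?thesis using S_bound[of t x] M1
        by (simp add: ennreal_mult[symmetric] mult_ac)
    qed (use elim in simp)
  qed
  also have "\<dots> = ennreal (M * norm x) * (\<integral>\<^sup>+t. ennreal (indicator {0<..} t * exp (- \<omega> * t)) \<partial>lborel)"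
    by (rule nn_integral_cmult) measurable
  also have "\<dots> = ennreal (M * norm x * (1 / \<omega>))"
    unfolding nn_integral_exp_neg[OF \<omega>] using M1 \<omega> by (intro ennreal_mult[symmetric]) auto
  finally show ?thesis .
qed

lemma S_integrable: "integrable lborel (\<lambda>t. indicator {0..} t *\<^sub>R S t x)"
  by (rule integrableI_bounded) (use S_nn_bound[of x] in \<open>auto intro: le_less_trans\<close>)

text \<open>The operator \<open>- A\<^sup>-\<^sup>1\<close>.\<close>

definition P :: "'y \<Rightarrow> 'y" where
  "P z = (\<integral>t. indicator {0..} t *\<^sub>R S t z \<partial>lborel)"

lemma S_add_right: "t \<ge> 0 \<Longrightarrow> S t (x + y) = S t x + S t y"
  using S_bl by (simp add: bounded_linear.linear linear_add)

lemma S_scaleR_right: "t \<ge> 0 \<Longrightarrow> S t (r *\<^sub>R x) = r *\<^sub>R S t x"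
  using S_bl by (simp add: bounded_linear.linear linear_scale)

lemma S_zero_right [simp]: "t \<ge> 0 \<Longrightarrow> S t 0 = 0"
  using S_scaleR_right[of t 0 0] by simp

lemma P_bl: "bounded_linear P"
proof (rule bounded_linear_intro[of _ "M / \<omega>"])
  show "P (x + y) = P x + P y" for x y
  proof -
    have "indicator {0..} t *\<^sub>R S t (x + y) = indicator {0..} t *\<^sub>R S t x + indicator {0..} t *\<^sub>R S t y" for t
      by (cases "t \<ge> 0") (simp_all add: S_add_right)
    then show ?thesis unfolding P_def using S_integrable by simp
  qed
  show "P (r *\<^sub>R x) = r *\<^sub>R P x" for r x
  proof -
    have "indicator {0..} t *\<^sub>R S t (r *\<^sub>R x) = r *\<^sub>R (indicator {0..} t *\<^sub>R S t x)" for t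
      by (cases "t \<ge> 0") (simp_all add: S_scaleR_right)
    then show ?thesis unfolding P_def by (simp only: integral_scaleR_right)
  qed
  show "norm (P x) \<le> norm x * (M / \<omega>)" for x
  proof -
    have "ennreal (norm (P x)) \<le> (\<integral>\<^sup>+t. norm (indicator {0..} t *\<^sub>R S t x) \<partial>lborel)"
      unfolding P_def by (rule integral_norm_bound_ennreal[OF S_integrable])
    also note S_nn_bound
    finally show ?thesis using M1 \<omega> by (simp add: mult_ac)
  qed
qed

lemma P_S: "t \<ge> 0 \<Longrightarrow> P (S t z) = S t (P z)"
proof -
  assume t: "t \<ge> 0"
  have "indicator {0..} r *\<^sub>R S r (S t z) = S t (indicator {0..} r *\<^sub>R S r z)" for r
    using S_add[of r t z] S_add[of t r z] t by (cases "r \<ge> 0") (simp_all add: S_scaleR_right add.commute)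
  then have "P (S t z) = (\<integral>r. S t (indicator {0..} r *\<^sub>R S r z) \<partial>lborel)" by (simp add: P_def)
  also have "\<dots> = S t (P z)" unfolding P_def by (rule integral_bounded_linear[OF S_bl[OF t] S_integrable])
  finally show ?thesis .
qed

text \<open>By the semigroup law and translation, S h (P z) is the integral over [h, \<infinity>),
  so only [0, h) is left in the difference.\<close>

lemma P_shift:
  assumes h: "h \<ge> 0"
  shows "integrable lborel (\<lambda>r. indicator {0..<h} r *\<^sub>R S r z)"
    "P z - S h (P z) = (\<integral>r. indicator {0..<h} r *\<^sub>R S r z \<partial>lborel)"
proof -
  have i: "integrable lborel (\<lambda>r. indicator {h..} r *\<^sub>R (indicator {0..} r *\<^sub>R S r z))"
    by (rule integrable_mult_indicator[OF _ S_integrable]) simp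
  have "S h (P z) = (\<integral>r. indicator {0..} r *\<^sub>R S r (S h z) \<partial>lborel)" using P_S[OF h, of z] by (simp add: P_def)
  also have "\<dots> = (\<integral>r. (indicator {h..} (h + 1 * r) *\<^sub>R (indicator {0..} (h + 1 * r) *\<^sub>R S (h + 1 * r) z)) \<partial>lborel)"
  proof (rule Bochner_Integration.integral_cong[OF refl])
    fix r
    show "indicator {0..} r *\<^sub>R S r (S h z)
        = indicator {h..} (h + 1 * r) *\<^sub>R (indicator {0..} (h + 1 * r) *\<^sub>R S (h + 1 * r) z)"
      using S_add[of r h z] h by (cases "r \<ge> 0") (simp_all add: add.commute)
  qed
  also have "\<dots> = (\<integral>r. indicator {h..} r *\<^sub>R (indicator {0..} r *\<^sub>R S r z) \<partial>lborel)"
    using lborel_integral_real_affine[of 1 "\<lambda>r. indicator {h..} r *\<^sub>R (indicator {0..} r *\<^sub>R S r z)" h] by simp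
  finally have "P z - S h (P z) = (\<integral>r. indicator {0..} r *\<^sub>R S r z - indicator {h..} r *\<^sub>R (indicator {0..} r *\<^sub>R S r z) \<partial>lborel)"
    using S_integrable i by (simp add: P_def)
  moreover have e: "indicator {0..} r *\<^sub>R S r z - indicator {h..} r *\<^sub>R (indicator {0..} r *\<^sub>R S r z) = indicator {0..<h} r *\<^sub>R S r z" for r
    using h by (auto simp: indicator_def)
  ultimately show "P z - S h (P z) = (\<integral>r. indicator {0..<h} r *\<^sub>R S r z \<partial>lborel)" by simp
  show "integrable lborel (\<lambda>r. indicator {0..<h} r *\<^sub>R S r z)"
    using Bochner_Integration.integrable_diff[OF S_integrable[of z] i] unfolding e .
qed

lemma P_average: "((\<lambda>h. (P z - S h (P z)) /\<^sub>R h) \<longlongrightarrow> z) (at_right 0)"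
proof (rule tendstoI)
  fix e :: real assume e: "e > 0"
  have "eventually (\<lambda>h. dist (S h z) z < e / 2) (at_right 0)" using S_lim[of z] e by (intro tendstoD) auto
  then obtain d where d: "d > 0" "\<And>h. 0 < h \<Longrightarrow> h < d \<Longrightarrow> dist (S h z) z < e / 2"
    unfolding eventually_at_right_field by auto
  have "dist ((P z - S h (P z)) /\<^sub>R h) z < e" if h: "0 < h" "h < d" for h
  proof -
    have h0: "h \<ge> 0" using h by simp
    have iz: "integrable lborel (\<lambda>r. indicator {0..<h} r *\<^sub>R z)" using h by (intro integrable_indicator) auto
    have eq: "indicator {0..<h} r *\<^sub>R (S r z - z) = indicator {0..<h} r *\<^sub>R S r z - indicator {0..<h} r *\<^sub>R z" for r
      by (simp add: scaleR_diff_right)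
    have i: "integrable lborel (\<lambda>r. indicator {0..<h} r *\<^sub>R (S r z - z))"
      unfolding eq using P_shift(1)[OF h0] iz by simp
    have "(\<integral>r. indicator {0..<h} r *\<^sub>R (S r z - z) \<partial>lborel) = (P z - S h (P z)) - h *\<^sub>R z"
      unfolding eq using P_shift[OF h0, of z] iz h by simp
    moreover have "norm (\<integral>r. indicator {0..<h} r *\<^sub>R (S r z - z) \<partial>lborel) \<le> (e / 2) * h"
    proof (rule integral_segment_bound[OF i h0])
      fix r assume "0 \<le> r" "r < h"
      then show "norm (S r z - z) \<le> e / 2" using d(2)[of r] h e by (cases "r = 0") (auto simp: dist_norm)
    qed
    ultimately have "norm ((P z - S h (P z)) - h *\<^sub>R z) \<le> (e / 2) * h" by simp
    moreover have "(P z - S h (P z)) /\<^sub>R h - z = ((P z - S h (P z)) - h *\<^sub>R z) /\<^sub>R h"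
      using h by (simp add: scaleR_diff_right)
    ultimately have "dist ((P z - S h (P z)) /\<^sub>R h) z \<le> e / 2"
      using h by (simp add: dist_norm divide_simps mult.commute)
    then show ?thesis using e by simp
  qed
  then show "eventually (\<lambda>h. dist ((P z - S h (P z)) /\<^sub>R h) z < e) (at_right 0)"
    unfolding eventually_at_right_field using d(1) by auto
qed

lemma P_generator: "P z \<in> D" "A (P z) = - z"
proof -
  have "((\<lambda>h. - ((P z - S h (P z)) /\<^sub>R h)) \<longlongrightarrow> - z) (at_right 0)" by (intro tendsto_minus P_average)
  moreover have "- ((P z - S h (P z)) /\<^sub>R h) = (S h (P z) - P z) /\<^sub>R h" for h
    by (simp add: scaleR_minus_right[symmetric] del: scaleR_minus_right)
  ultimately have l: "((\<lambda>h. (S h (P z) - P z) /\<^sub>R h) \<longlongrightarrow> - z) (at_right 0)" by simp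
  then show d: "P z \<in> D" using gen by (auto simp: generates_def)
  then have "((\<lambda>h. (S h (P z) - P z) /\<^sub>R h) \<longlongrightarrow> A (P z)) (at_right 0)" using gen by (auto simp: generates_def)
  then show "A (P z) = - z" using l by (intro tendsto_unique[OF trivial_limit_at_right_real])
qed

text \<open>\<open>P\<close> commutes with the semigroup and hence with difference quotients; those
  of \<open>P z\<close> are negative averages of the orbit of z and tend to -z.\<close>

lemma P_A:
  assumes z: "z \<in> D"
  shows "P (A z) = - z"
proof -
  have "((\<lambda>h. P ((S h z - z) /\<^sub>R h)) \<longlongrightarrow> P (A z)) (at_right 0)"
    using z gen by (intro bounded_linear.tendsto[OF P_bl]) (auto simp: generates_def)
  moreover have "eventually (\<lambda>h. P ((S h z - z) /\<^sub>R h) = - ((P z - S h (P z)) /\<^sub>R h)) (at_right 0)"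
    unfolding eventually_at_right_field
  proof (intro exI[of _ 1] conjI allI impI)
    fix h :: real assume "0 < h" "h < 1"
    then have "P ((S h z - z) /\<^sub>R h) = (S h (P z) - P z) /\<^sub>R h"
      using P_bl by (simp add: bounded_linear.linear linear_diff linear_scale P_S)
    then show "P ((S h z - z) /\<^sub>R h) = - ((P z - S h (P z)) /\<^sub>R h)"
      by (simp add: scaleR_minus_right[symmetric] del: scaleR_minus_right)
  qed simp
  ultimately have "((\<lambda>h. - ((P z - S h (P z)) /\<^sub>R h)) \<longlongrightarrow> P (A z)) (at_right 0)"
    by (rule Lim_transform_eventually)
  moreover have "((\<lambda>h. - ((P z - S h (P z)) /\<^sub>R h)) \<longlongrightarrow> - z) (at_right 0)" by (intro tendsto_minus P_average)
  ultimately show ?thesis by (rule tendsto_unique[OF trivial_limit_at_right_real])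
qed

text \<open>The domain is dense: the averages tending to v are combinations of P v and P (S h v),
  both of which lie in the domain.\<close>

lemma D_orthogonal:
  assumes "\<And>x. x \<in> D \<Longrightarrow> inner x v = 0"
  shows "v = 0"
proof -
  have "((\<lambda>h. inner ((P v - S h (P v)) /\<^sub>R h) v) \<longlongrightarrow> inner v v) (at_right 0)"
    by (intro tendsto_inner P_average tendsto_const)
  moreover have "eventually (\<lambda>h. inner ((P v - S h (P v)) /\<^sub>R h) v = 0) (at_right 0)"
    unfolding eventually_at_right_field
  proof (intro exI[of _ 1] conjI allI impI)
    fix h :: real assume "0 < h" "h < 1"
    then have "inner (P v - S h (P v)) v = inner (P v) v - inner (P (S h v)) v" by (simp add: inner_diff_left P_S)
    then show "inner ((P v - S h (P v)) /\<^sub>R h) v = 0" using assms P_generator(1) by simp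
  qed simp
  ultimately have "((\<lambda>h. 0) \<longlongrightarrow> inner v v) (at_right (0::real))" by (rule Lim_transform_eventually)
  then have "inner v v = 0" by (intro tendsto_unique[OF trivial_limit_at_right_real _ tendsto_const])
  then show ?thesis by simp
qed

text \<open>\<open>P\<close> turns strong continuity into a Lipschitz bound in operator norm, which
  survives the passage to adjoints.\<close>

lemma P_S_Lipschitz:
  assumes "0 \<le> s" "s \<le> t"
  shows "norm (P (S t w) - P (S s w)) \<le> M * (M * norm w) * (t - s)"
proof -
  have ts: "t - s \<ge> 0" using assms by simp
  have "S t w = S (t - s) (S s w)" using S_add[of "t - s" s w] assms by simp
  then have "P (S s w) - P (S t w) = P (S s w) - S (t - s) (P (S s w))" using P_S[OF ts] by simp
  also have "\<dots> = (\<integral>r. indicator {0..<t - s} r *\<^sub>R S r (S s w) \<partial>lborel)" by (rule P_shift(2)[OF ts])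
  also have "norm \<dots> \<le> M * (M * norm w) * (t - s)"
  proof (rule integral_segment_bound[OF P_shift(1)[OF ts] ts])
    fix r :: real assume "0 \<le> r"
    then have "norm (S r (S s w)) \<le> M * norm (S s w)" by (rule S_bound_M)
    also have "\<dots> \<le> M * (M * norm w)" using S_bound_M[OF assms(1)] M1 by (intro mult_left_mono) auto
    finally show "norm (S r (S s w)) \<le> M * (M * norm w)" .
  qed
  finally show ?thesis by (simp add: norm_minus_commute)
qed

abbreviation E :: "real \<Rightarrow> 'y \<Rightarrow> 'y" where "E \<equiv> adj_semigroup S"

lemma E_inner: "t \<ge> 0 \<Longrightarrow> inner (S t x) y = inner x (E t y)"
  unfolding adj_semigroup_def by (intro adj_bounded_inner S_bc)

lemma E_bl: "t \<ge> 0 \<Longrightarrow> bounded_linear (E t)"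
  using M1 by (intro real_adjoint_bounded_linear(1)[OF E_inner S_bound]) auto

lemma E_bound: "t \<ge> 0 \<Longrightarrow> norm (E t y) \<le> M * exp (- \<omega> * t) * norm y"
  using M1 by (intro real_adjoint_bounded_linear(2)[OF E_inner S_bound]) auto

lemma E_bound_M: "t \<ge> 0 \<Longrightarrow> norm (E t y) \<le> M * norm y"
  using M1 by (intro real_adjoint_bounded_linear(2)[OF E_inner S_bound_M]) auto

lemma E_add: "s \<ge> 0 \<Longrightarrow> t \<ge> 0 \<Longrightarrow> E (s + t) y = E s (E t y)"
  by (rule inner_eqI) (simp add: E_inner[symmetric] S_add[symmetric] add.commute)

text \<open>The inverse of the adjoint generator, obtained as the adjoint of -P, the inverse of
  \<open>A\<close>.\<close>

definition J :: "'y \<Rightarrow> 'y" where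
  "J y = (SOME z. \<forall>x. inner x z = - inner (P x) y)"

lemma J_inner: "inner x (J y) = - inner (P x) y"
proof -
  obtain C where C: "\<And>x. norm (P x) \<le> norm x * C" "C \<ge> 0" using bounded_linear.nonneg_bounded[OF P_bl] by blast
  have lin: "linear (\<lambda>x. - inner (P x) y)"
    using P_bl by (intro linearI) (auto simp: bounded_linear.linear linear_add linear_scale inner_add_left)
  have bnd: "\<bar>- inner (P x) y\<bar> \<le> (C * norm y) * norm (id x)" for x
  proof -
    have "\<bar>inner (P x) y\<bar> \<le> norm (P x) * norm y" by (rule Cauchy_Schwarz_ineq2)
    also have "\<dots> \<le> (norm x * C) * norm y" by (intro mult_right_mono C) auto
    finally show ?thesis by (simp add: mult_ac)
  qed
  have "C * norm y \<ge> 0" using C by simp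
  then obtain z where "\<And>x. inner z (id x) = - inner (P x) y"
    using Riesz_representation[OF linear_id lin bnd] by blast
  then have "\<forall>x. inner x z = - inner (P x) y" by (simp add: inner_commute)
  then have "\<forall>x. inner x (J y) = - inner (P x) y" unfolding J_def by (rule someI)
  then show ?thesis by simp
qed

lemma J_bl: "bounded_linear J"
proof -
  obtain C where C: "\<And>x. norm (P x) \<le> norm x * C" "C \<ge> 0" using bounded_linear.nonneg_bounded[OF P_bl] by blast
  show ?thesis
    by (rule real_adjoint_bounded_linear(1)[of "\<lambda>x. - P x" J C]) (use C in \<open>auto simp: J_inner mult.commute\<close>)
qed

lemma E_J: "t \<ge> 0 \<Longrightarrow> E t (J y) = J (E t y)"
  by (rule inner_eqI) (simp add: E_inner[symmetric] J_inner P_S)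

text \<open>A vector orthogonal to the range of \<open>J\<close> is annihilated by \<open>P\<close>,
  which is injective because A P = - I.\<close>

lemma J_dense: "closure (range J) = UNIV"
proof (rule dense_of_orthogonal)
  show "linear J" using J_bl by (rule bounded_linear.linear)
  fix v assume "\<And>y. inner v (J y) = 0"
  then have "inner (P v) (P v) = 0" by (simp add: J_inner)
  then have "P v = 0" by simp
  then have "- v = A 0" using P_generator(2)[of v] by simp
  then show "v = 0" using clinear_on_zero(2)[OF A_lin] by simp
qed

lemma adj_char:
  assumes "\<forall>x\<in>D. cinner (A x) y = cinner x z"
  shows "adj D A y = z"
  unfolding adj_def
proof (rule the_equality)
  fix z' assume z': "\<forall>x\<in>D. cinner (A x) y = cinner x z'"
  have "z' - z = 0"
  proof (rule D_orthogonal)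
    fix x assume "x \<in> D"
    then have "cinner x z' = cinner x z" using assms z' by simp
    then have "inner x z' = inner x z" by (metis Re_cinner)
    then show "inner x (z' - z) = 0" by (simp add: inner_diff_right)
  qed
  then show "z' = z" by simp
qed fact

lemma J_adj: "J y \<in> adj_dom D A" "adj D A (J y) = y"
proof -
  have re: "inner (A x) (J y) = inner x y" if "x \<in> D" for x using that by (simp add: J_inner P_A)
  have "cinner (A x) (J y) = cinner x y" if x: "x \<in> D" for x
  proof (rule complex_eqI)
    show "Re (cinner (A x) (J y)) = Re (cinner x y)" using re[OF x] by (simp add: Re_cinner)
    show "Im (cinner (A x) (J y)) = Im (cinner x y)"
      using re[OF clinear_on_scaleC(1)[OF A_lin x, of \<i>]] clinear_on_scaleC(2)[OF A_lin x, of \<i>] by (simp add: Im_cinner)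
  qed
  then show "J y \<in> adj_dom D A" "adj D A (J y) = y" by (auto simp: adj_dom_def intro: adj_char)
qed

lemma adj_J:
  assumes "x \<in> adj_dom D A"
  shows "J (adj D A x) = x"
proof -
  obtain z where z: "\<forall>w\<in>D. cinner (A w) x = cinner w z" using assms by (auto simp: adj_dom_def)
  have "inner w (J z) = inner w x" for w
  proof -
    have "cinner (A (P w)) x = cinner (P w) z" using z P_generator(1) by blast
    then have "inner (A (P w)) x = inner (P w) z" by (metis Re_cinner)
    then show ?thesis by (simp add: P_generator(2) J_inner)
  qed
  then have "J z = x" by (rule inner_eqI)
  then show ?thesis using adj_char[OF z] by simp
qed

lemma adj_dom_eq: "adj_dom D A = range J"
  using J_adj(1) adj_J by (auto intro: range_eqI[OF sym])

text \<open>Continuity of the adjoint semigroup in time has to be derived. On the range of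
  \<open>J\<close> it follows from the estimate for \<open>P\<close> by pairing the increment with
  itself.\<close>

lemma E_J_Lipschitz:
  assumes "0 \<le> s" "s \<le> t"
  shows "norm (E t (J y) - E s (J y)) \<le> (M * M * (t - s)) * norm y"
proof -
  have t: "0 \<le> t" using assms by simp
  let ?v = "E t (J y) - E s (J y)"
  have "norm ?v * norm ?v = inner ?v (E t (J y)) - inner ?v (E s (J y))"
    by (simp add: inner_diff_right[symmetric] dot_square_norm power2_eq_square)
  also have "\<dots> = inner (P (S s ?v) - P (S t ?v)) y"
    using E_inner[OF t, of ?v "J y"] E_inner[OF assms(1), of ?v "J y"] by (simp add: J_inner inner_diff_left)
  also have "\<dots> \<le> norm (P (S s ?v) - P (S t ?v)) * norm y" by (rule norm_cauchy_schwarz)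
  also have "\<dots> \<le> (M * (M * norm ?v) * (t - s)) * norm y"
    using P_S_Lipschitz[OF assms, of ?v] by (intro mult_right_mono) (auto simp: norm_minus_commute)
  finally have "norm ?v * norm ?v \<le> norm ?v * ((M * M * (t - s)) * norm y)" by (simp add: mult_ac)
  then show ?thesis using assms M1 by (cases "?v = 0") simp_all
qed

text \<open>Wanted for the joint measurability of the kernel. The Lipschitz bound on the dense range
  of \<open>J\<close> and the uniform bound \<open>M\<close> are combined through a point
  \<open>J x\<close> near y.\<close>

lemma E_joint_continuous: "continuous_on ({0..} \<times> UNIV) (\<lambda>z. E (fst z) (snd z))"
  unfolding continuous_on_iff
proof (intro ballI allI impI)
  fix z :: "real \<times> 'y" and e :: real assume z: "z \<in> {0..} \<times> UNIV" and e: "e > 0"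
  obtain t y where zt: "z = (t, y)" by (cases z)
  have t: "t \<ge> 0" using z zt by simp
  have "y \<in> closure (range J)" using J_dense by simp
  then obtain x where x: "dist (J x) y < e / (4 * M)"
    unfolding closure_approachable using e M1 by (metis divide_pos_pos mult_pos_pos rangeE zero_less_numeral less_le_trans zero_less_one)
  \<comment> \<open>The two terms keep the change of the vector and the change of time along
    \<open>J x\<close> within e/4 each; the two replacements of y by \<open>J x\<close> take the
    remaining quarters. The summand 1 avoids division by 0.\<close>
  define d where "d = min (e / (4 * M)) (e / (4 * (M * M * (norm x + 1))))"
  have nx: "norm x + 1 > 0" using norm_ge_zero[of x] by linarith
  have d: "d > 0" using e M1 nx by (auto simp: d_def)
  have "dist (E (fst w) (snd w)) (E (fst z) (snd z)) < e" if w: "w \<in> {0..} \<times> UNIV" "dist w z < d" for w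
  proof -
    obtain s u where ws: "w = (s, u)" by (cases w)
    have s: "s \<ge> 0" using w ws by simp
    have ds: "dist s t < d" "dist u y < d" using w(2) dist_fst_le[of w z] dist_snd_le[of w z] by (auto simp: ws zt)
    have 1: "norm (E s u - E s y) \<le> M * norm (u - y)"
      using E_bound_M[OF s, of "u - y"] E_bl[OF s] by (simp add: bounded_linear.linear linear_diff)
    have 2: "norm (E s y - E s (J x)) \<le> M * norm (y - J x)"
      using E_bound_M[OF s, of "y - J x"] E_bl[OF s] by (simp add: bounded_linear.linear linear_diff)
    have 3: "norm (E t (J x) - E t y) \<le> M * norm (J x - y)"
      using E_bound_M[OF t, of "J x - y"] E_bl[OF t] by (simp add: bounded_linear.linear linear_diff)
    have 4: "norm (E s (J x) - E t (J x)) \<le> (M * M * \<bar>s - t\<bar>) * norm x"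
      using E_J_Lipschitz[of s t x] E_J_Lipschitz[of t s x] s t by (cases "s \<le> t") (auto simp: norm_minus_commute)
    have "M * norm (u - y) \<le> e / 4"
      using ds(2) M1 by (simp add: d_def dist_norm field_simps)
    moreover have "M * norm (y - J x) < e / 4" "M * norm (J x - y) < e / 4"
      using x M1 by (simp_all add: dist_norm norm_minus_commute field_simps)
    moreover have "(M * M * \<bar>s - t\<bar>) * norm x \<le> e / 4"
    proof -
      have MM: "M * M > 0" using M1 by simp
      have "\<bar>s - t\<bar> \<le> e / (4 * (M * M * (norm x + 1)))" using ds(1) by (simp add: d_def dist_real_def)
      then have "(M * M * (norm x + 1)) * \<bar>s - t\<bar> \<le> (M * M * (norm x + 1)) * (e / (4 * (M * M * (norm x + 1))))"
        using MM nx by (intro mult_left_mono) auto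
      also have "\<dots> = e / 4"
      proof -
        have g: "X * (e / (4 * X)) = e / 4" if "X > 0" for X using that by simp
        show ?thesis by (rule g[OF mult_pos_pos[OF MM nx]])
      qed
      finally have "(M * M * (norm x + 1)) * \<bar>s - t\<bar> \<le> e / 4" .
      moreover have "(M * M * \<bar>s - t\<bar>) * norm x \<le> (M * M * \<bar>s - t\<bar>) * (norm x + 1)" using MM by (intro mult_left_mono) auto
      moreover have "(M * M * \<bar>s - t\<bar>) * (norm x + 1) = (M * M * (norm x + 1)) * \<bar>s - t\<bar>" by (simp only: mult_ac)
      ultimately show ?thesis by linarith
    qed
    moreover have "norm (E s u - E t y) \<le> norm (E s u - E s y) + norm (E s y - E s (J x)) + norm (E s (J x) - E t (J x)) + norm (E t (J x) - E t y)"
    proof -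
      have "E s u - E t y = ((E s u - E s y) + (E s y - E s (J x)) + (E s (J x) - E t (J x))) + (E t (J x) - E t y)" by simp
      then show ?thesis by (metis norm_triangle_mono order_refl)
    qed
    ultimately show ?thesis using 1 2 3 4 by (simp add: ws zt dist_norm)
  qed
  then show "\<exists>d>0. \<forall>w\<in>{0..} \<times> UNIV. dist w z < d \<longrightarrow> dist (E (fst w) (snd w)) (E (fst z) (snd z)) < e"
    using d by blast
qed

lemma E_pair_measurable: "(\<lambda>z. indicator {0..} (fst z) *\<^sub>R E (fst z) (snd z)) \<in> borel_measurable (borel \<Otimes>\<^sub>M borel)"
proof -
  have "(\<lambda>z. indicator ({0..} \<times> UNIV) z *\<^sub>R E (fst z) (snd z)) \<in> borel_measurable borel"
    by (intro borel_measurable_continuous_on_indicator E_joint_continuous) (auto intro: closed_Times borel_closed)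
  moreover have "indicator ({0..} \<times> UNIV) z = (indicator {0..} (fst z) :: real)" for z :: "real \<times> 'y"
    by (simp add: indicator_def mem_Times_iff)
  ultimately show ?thesis by (simp add: borel_prod)
qed

end

section \<open>The kernel of the input map\<close>

text \<open>A Borel function is substituted for the norm of \<open>f\<close> only, because
  \<open>f\<close> enters the kernel estimate through its norm.\<close>

lemma Lp_space_norm_bound:
  fixes f :: "real \<Rightarrow> 'a::{complex_hilbert, second_countable_topology}"
  assumes f: "f \<in> Lp_space p I" and I: "I \<in> sets borel" and p: "p \<ge> 1" and le: "Lp_norm p I f \<le> C" "C \<ge> 0"
  obtains \<psi> where "\<psi> \<in> borel_measurable borel" "\<And>t. \<psi> t \<ge> 0"
    "AE t in lborel. t \<in> I \<longrightarrow> \<psi> t = norm (f t)"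
    "(\<integral>\<^sup>+t. ennreal (\<psi> t powr p) \<partial>lborel) \<le> ennreal (C powr p)"
proof -
  have IL: "I \<in> sets lebesgue" using I by auto
  have fm: "f \<in> borel_measurable (lebesgue_on I)" and fi: "integrable (lebesgue_on I) (\<lambda>t. norm (f t) powr p)"
    using f by (auto simp: Lp_space_def)
  have "(\<lambda>t. norm (f t)) \<in> borel_measurable (lebesgue_on I)" using fm by simp
  then have "(\<lambda>t. if t \<in> I then norm (f t) else 0) \<in> borel_measurable lebesgue"
    using IL by (subst (asm) borel_measurable_if[symmetric]) auto
  then obtain \<psi>0 where \<psi>0: "\<psi>0 \<in> borel_measurable lborel" "AE t in lborel. (if t \<in> I then norm (f t) else 0) = \<psi>0 t"
    using completion_ex_borel_measurable_real by blast
  define \<psi> where "\<psi> t = \<bar>\<psi>0 t\<bar>" for t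
  have \<psi>: "AE t in lborel. \<psi> t = (if t \<in> I then norm (f t) else 0)"
    using \<psi>0(2)
  proof eventually_elim
    case (elim t)
    from elim[symmetric] show ?case by (simp add: \<psi>_def)
  qed
  have [measurable]: "\<psi> \<in> borel_measurable borel" using \<psi>0(1) by (simp add: \<psi>_def[abs_def])
  have "(\<integral>\<^sup>+t. ennreal (\<psi> t powr p) \<partial>lborel) = (\<integral>\<^sup>+t. ennreal (\<psi> t powr p) \<partial>lebesgue)"
    by (simp add: nn_integral_completion)
  also have "\<dots> = (\<integral>\<^sup>+t. ennreal (norm (f t) powr p) * indicator I t \<partial>lebesgue)"
  proof (rule nn_integral_cong_AE)
    show "AE t in lebesgue. ennreal (\<psi> t powr p) = ennreal (norm (f t) powr p) * indicator I t"
      using AE_completion[OF \<psi>] by eventually_elim (use p in auto)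
  qed
  also have "\<dots> = (\<integral>\<^sup>+t. ennreal (norm (f t) powr p) \<partial>lebesgue_on I)"
    using IL by (subst nn_integral_restrict_space) auto
  also have "\<dots> = ennreal (LINT t|lebesgue_on I. norm (f t) powr p)"
    by (rule nn_integral_eq_integral[OF fi]) auto
  also have "\<dots> \<le> ennreal (C powr p)"
  proof (rule ennreal_leI)
    let ?L = "LINT t|lebesgue_on I. norm (f t) powr p"
    have "?L \<ge> 0" by simp
    then have "?L = (?L powr (1/p)) powr p" using p by (simp add: powr_powr)
    also have "\<dots> \<le> C powr p" using le p unfolding Lp_norm_def by (intro powr_mono2) auto
    finally show "?L \<le> C powr p" .
  qed
  finally have b: "(\<integral>\<^sup>+t. ennreal (\<psi> t powr p) \<partial>lborel) \<le> ennreal (C powr p)" .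
  show ?thesis
  proof (rule that[OF _ _ _ b])
    show "AE t in lborel. t \<in> I \<longrightarrow> \<psi> t = norm (f t)" using \<psi> by eventually_elim simp
  qed (auto simp: \<psi>_def[symmetric], simp add: \<psi>_def)
qed

locale control_system = stable_semigroup D A S M \<omega>
  for D :: "'y::{complex_hilbert, second_countable_topology} set" and A S M \<omega> +
  fixes B :: "'u::{complex_hilbert, second_countable_topology} \<Rightarrow> 'y \<Rightarrow> complex"
    and F G :: "real \<Rightarrow> 'y \<Rightarrow> 'u" and \<gamma> N T :: real
  assumes B: "control_operator D A B"
    and FG: "\<And>t x. t > 0 \<Longrightarrow> x \<in> adj_dom D A \<Longrightarrow> control_adj B (adj_semigroup S t x) = F t x + G t x"
    and \<gamma>: "0 < \<gamma>" "\<gamma> < 1" and N: "N > 0" and T: "T > 0"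
    and F_bound: "\<And>t x. t > 0 \<Longrightarrow> norm (F t x) \<le> N * t powr (- \<gamma>) * norm x"
    and G_ext: "\<And>p. p \<ge> 1 \<Longrightarrow> extends_to_Lp (adj_dom D A) (\<lambda>x t. G t x) p {0<..<T}"
begin

lemma control_adj_char:
  assumes x: "x \<in> adj_dom D A"
  shows "B u x = cinner u (control_adj B x)"
proof -
  obtain C where C: "\<And>u. cmod (B u x) \<le> C * norm u * graph_norm (adj D A) x"
    using B x unfolding control_operator_def by blast
  have lin: "B (c *\<^sub>C u + v) x = c * B u x + B v x" for c u v using B x by (auto simp: control_operator_def)
  have B0: "B 0 x = 0" using lin[of 1 0 0] by (simp add: scaleC_1)
  have Bs: "B (c *\<^sub>C u) x = c * B u x" for c u using lin[of c u 0] B0 by simp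
  have f: "linear (\<lambda>u. Re (B u x))"
  proof (rule linearI)
    show "Re (B (u + v) x) = Re (B u x) + Re (B v x)" for u v using lin[of 1 u v] by (simp add: scaleC_1)
    show "Re (B (r *\<^sub>R u) x) = r *\<^sub>R Re (B u x)" for r u using Bs[of "complex_of_real r" u] by (simp add: scaleC_of_real)
  qed
  have b: "\<bar>Re (B u x)\<bar> \<le> \<bar>C * graph_norm (adj D A) x\<bar> * norm (id u)" for u
  proof -
    have "\<bar>Re (B u x)\<bar> \<le> C * norm u * graph_norm (adj D A) x" using abs_Re_le_cmod C by (rule order_trans)
    also have "\<dots> = (C * graph_norm (adj D A) x) * norm u" by (simp add: mult_ac)
    also have "\<dots> \<le> \<bar>C * graph_norm (adj D A) x\<bar> * norm u" by (intro mult_right_mono) auto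
    finally show ?thesis by simp
  qed
  obtain v where v: "\<And>u. inner v (id u) = Re (B u x)"
    using Riesz_representation[OF linear_id f b abs_ge_zero] by blast
  have cv: "B u x = cinner u v" for u
  proof (rule complex_eqI)
    show "Re (B u x) = Re (cinner u v)" using v[of u] by (simp add: Re_cinner inner_commute)
    show "Im (B u x) = Im (cinner u v)" using v[of "\<i> *\<^sub>C u"] Bs[of \<i> u] by (simp add: Im_cinner inner_commute)
  qed
  have "control_adj B x = v" unfolding control_adj_def
  proof (rule the_equality)
    fix v' assume "\<forall>u. B u x = cinner u v'"
    then have "inner u v' = inner u v" for u using cv[of u] by (metis Re_cinner)
    then show "v' = v" by (rule inner_eqI)
  qed (use cv in simp)
  then show ?thesis using cv by simp
qed

text \<open>\<open>B\<^sup>*\<close> composed with the inverse of the adjoint generator, that is,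
  the bounded adjoint of \<open>A\<^sup>-\<^sup>1 B\<close>.\<close>

definition cJ :: "'y \<Rightarrow> 'u" where "cJ y = control_adj B (J y)"

lemma cJ_inner: "inner u (cJ y) = Re (B u (J y))"
  unfolding cJ_def control_adj_char[OF J_adj(1)] by (rule Re_cinner[symmetric])

lemma cJ_bl: "bounded_linear cJ"
proof -
  obtain CJ where CJ: "\<And>y. norm (J y) \<le> norm y * CJ" "CJ \<ge> 0" using bounded_linear.nonneg_bounded[OF J_bl] by blast
  obtain C where C: "\<And>u x. x \<in> adj_dom D A \<Longrightarrow> cmod (B u x) \<le> C * norm u * graph_norm (adj D A) x"
    using B unfolding control_operator_def by blast
  have conj: "B u (c *\<^sub>C x + z) = cnj c * B u x + B u z" if "x \<in> adj_dom D A" "z \<in> adj_dom D A" for c x z u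
    using B that by (auto simp: control_operator_def pivot_dual_def)
  have Jl: "J (x + y) = J x + J y" "J (r *\<^sub>R x) = r *\<^sub>R J x" "J 0 = 0" for x y r
    using J_bl by (auto simp: bounded_linear.linear linear_add linear_scale linear_0)
  have z: "0 \<in> adj_dom D A" using J_adj(1)[of 0] Jl by simp
  have B0: "B u 0 = 0" for u using conj[OF z z, of u 1] by (simp add: scaleC_1)
  show ?thesis
  proof (rule bounded_linear_intro[of _ "\<bar>C\<bar> * (CJ + 1)"])
    show "cJ (x + y) = cJ x + cJ y" for x y
    proof (rule inner_eqI)
      fix u show "inner u (cJ (x + y)) = inner u (cJ x + cJ y)"
        using conj[OF J_adj(1)[of x] J_adj(1)[of y], of u 1] by (simp add: inner_add_right cJ_inner Jl scaleC_1)
    qed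
    show "cJ (r *\<^sub>R x) = r *\<^sub>R cJ x" for r x
    proof (rule inner_eqI)
      fix u show "inner u (cJ (r *\<^sub>R x)) = inner u (r *\<^sub>R cJ x)"
        using conj[OF J_adj(1)[of x] z, of u "complex_of_real r"] by (simp add: cJ_inner Jl scaleC_of_real B0)
    qed
    show "norm (cJ y) \<le> norm y * (\<bar>C\<bar> * (CJ + 1))" for y
    proof (cases "cJ y = 0")
      case False
      have "norm (cJ y) * norm (cJ y) = Re (B (cJ y) (J y))" by (simp add: cJ_inner[symmetric] dot_square_norm power2_eq_square)
      also have "\<dots> \<le> cmod (B (cJ y) (J y))" by (rule complex_Re_le_cmod)
      also have "\<dots> \<le> C * norm (cJ y) * graph_norm (adj D A) (J y)" by (rule C[OF J_adj(1)])
      also have "\<dots> \<le> \<bar>C\<bar> * norm (cJ y) * (norm y * (CJ + 1))"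
        using CJ(1)[of y] by (intro mult_mono) (auto simp: graph_norm_def J_adj algebra_simps)
      finally have "norm (cJ y) * norm (cJ y) \<le> norm (cJ y) * (norm y * (\<bar>C\<bar> * (CJ + 1)))" by (simp add: mult_ac)
      then show ?thesis using False by simp
    qed (use CJ in simp)
  qed
qed

text \<open>The kernel at time \<open>a\<close> on \<open>J y\<close>. Since \<open>J\<close>
  commutes with the adjoint semigroup, it is moved next to \<open>B\<^sup>*\<close>, which leaves a
  bounded operator at every time; the indicator extends it by 0 to negative times.\<close>

definition kk :: "real \<Rightarrow> 'y \<Rightarrow> 'u" where
  "kk a y = cJ (indicator {0..} a *\<^sub>R E a y)"

lemma kk_nonneg: "a \<ge> 0 \<Longrightarrow> kk a y = control_adj B (E a (J y))"
  by (simp add: kk_def cJ_def E_J)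

lemma kk_neg: "a < 0 \<Longrightarrow> kk a y = 0"
  using cJ_bl by (simp add: kk_def bounded_linear.linear linear_0)

lemma kk_linear: "linear (kk a)"
proof (cases "a \<ge> 0")
  case True
  then show ?thesis using cJ_bl E_bl[OF True]
    by (intro linearI) (simp_all add: kk_def bounded_linear.linear linear_add linear_scale)
qed (auto intro!: linearI simp: kk_neg)

lemma kk_pair: "(\<lambda>(a, y). kk a y) \<in> borel_measurable (borel \<Otimes>\<^sub>M borel)"
proof -
  have "cJ \<in> borel_measurable borel"
    using cJ_bl by (intro borel_measurable_continuous_onI linear_continuous_on)
  from measurable_compose[OF E_pair_measurable this] show ?thesis
    by (simp add: kk_def case_prod_beta)
qed

lemma kk_bound: "\<exists>C. \<forall>a y. norm (kk a y) \<le> C * exp (- \<omega> * a) * norm y"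
proof -
  obtain C where C: "\<And>y. norm (cJ y) \<le> norm y * C" "C \<ge> 0" using bounded_linear.nonneg_bounded[OF cJ_bl] by blast
  have "norm (kk a y) \<le> (C * M) * exp (- \<omega> * a) * norm y" for a y
  proof (cases "a \<ge> 0")
    case True
    have "norm (kk a y) \<le> norm (E a y) * C" using C(1)[of "E a y"] True by (simp add: kk_def)
    also have "\<dots> \<le> (M * exp (- \<omega> * a) * norm y) * C" using E_bound[OF True] C by (intro mult_right_mono)
    finally show ?thesis by (simp add: mult_ac)
  qed (use C M1 in \<open>simp add: kk_neg\<close>)
  then show ?thesis by blast
qed

lemma kk_measurable1 [measurable]: "(\<lambda>a. kk a y) \<in> borel_measurable borel"
  using measurable_compose[OF _ kk_pair, of "\<lambda>a. (a, y)" borel] by simp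

lemma kk_add: "a \<ge> 0 \<Longrightarrow> b \<ge> 0 \<Longrightarrow> kk (a + b) y = kk a (E b y)"
  by (simp add: kk_def E_add)

text \<open>The two parts of the kernel call for different inequalities. \<open>F\<close> is bounded
  by a power, and Jensen is applied with that power as density. Of \<open>G\<close> only the L^{p'}
  norm of its action on a vector is known, so Hoelder is used, and the summand 1 of the weight
  supplies the L^p norm of w.\<close>

lemma kernel_base:
  assumes p: "p > 1"
  shows "\<exists>C\<ge>0. \<forall>w y W. w \<in> borel_measurable borel \<longrightarrow> (\<forall>a. 0 \<le> w a) \<longrightarrow> 0 \<le> W \<longrightarrow>
        (\<integral>\<^sup>+a. ennreal (indicator {0<..<T} a * (a powr (- \<gamma>) + 1) * w a powr p) \<partial>lborel) \<le> ennreal (W powr p) \<longrightarrow>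
        (\<integral>\<^sup>+a. ennreal (indicator {0<..<T} a * w a * norm (kk a y)) \<partial>lborel) \<le> ennreal (C * W * norm (J y))"
proof -
  define p' where "p' = p / (p - 1)"
  have p': "p' > 1" "1/p + 1/p' = 1" using conjugate_exponent[OF p] by (auto simp: p'_def)
  obtain \<Phi> C1' where \<Phi>: "\<And>x. \<Phi> x \<in> Lp_space p' {0<..<T}" "\<And>x. Lp_norm p' {0<..<T} (\<Phi> x) \<le> C1' * norm x"
    "\<And>x. x \<in> adj_dom D A \<Longrightarrow> AE t in lebesgue_on {0<..<T}. \<Phi> x t = G t x"
    using G_ext[OF less_imp_le[OF p'(1)]] unfolding extends_to_Lp_def by blast
  define C1 where "C1 = \<bar>C1'\<bar>"
  have C1: "C1 \<ge> 0" "\<And>x. Lp_norm p' {0<..<T} (\<Phi> x) \<le> C1 * norm x"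
    using order_trans[OF \<Phi>(2) mult_right_mono[of C1' "\<bar>C1'\<bar>"]] by (auto simp: C1_def)
  define A0 where "A0 = T powr (1 - \<gamma>) / (1 - \<gamma>)"
  have A0: "A0 \<ge> 0" using \<gamma> by (simp add: A0_def)
  define C where "C = N * A0 powr (1 - 1/p) + C1"
  have "(\<integral>\<^sup>+a. ennreal (indicator {0<..<T} a * w a * norm (kk a y)) \<partial>lborel) \<le> ennreal (C * W * norm (J y))"
    if [measurable]: "w \<in> borel_measurable borel" and w: "\<forall>a. 0 \<le> w a" and W: "0 \<le> W"
      and le: "(\<integral>\<^sup>+a. ennreal (indicator {0<..<T} a * (a powr (- \<gamma>) + 1) * w a powr p) \<partial>lborel) \<le> ennreal (W powr p)"
    for w y W
  proof -
    let ?x = "J y"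
    have x: "?x \<in> adj_dom D A" by (rule J_adj)
    have I: "{0<..<T} \<in> sets borel" and p'1: "p' \<ge> 1" and nn: "C1 * norm ?x \<ge> 0" using p' C1 by auto
    obtain \<psi> where [measurable]: "\<psi> \<in> borel_measurable borel" and \<psi>: "\<And>t. \<psi> t \<ge> 0"
      "AE t in lborel. t \<in> {0<..<T} \<longrightarrow> \<psi> t = norm (\<Phi> ?x t)"
      "(\<integral>\<^sup>+t. ennreal (\<psi> t powr p') \<partial>lborel) \<le> ennreal ((C1 * norm ?x) powr p')"
      using Lp_space_norm_bound[OF \<Phi>(1)[of ?x] I p'1 C1(2)[of ?x] nn] by blast
    have "AE t in lebesgue. t \<in> {0<..<T} \<longrightarrow> \<Phi> ?x t = G t ?x"
      using \<Phi>(3)[OF x] by (subst (asm) AE_restrict_space_iff) auto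
    then have GA: "AE t in lborel. t \<in> {0<..<T} \<longrightarrow> \<Phi> ?x t = G t ?x" by (simp add: AE_completion_iff)
    let ?I = "\<lambda>a. indicator {0<..<T} a :: real"
    have "(\<integral>\<^sup>+a. ennreal (?I a * w a * norm (kk a y)) \<partial>lborel)
        \<le> (\<integral>\<^sup>+a. ennreal (N * norm ?x) * ennreal ((?I a * a powr (- \<gamma>)) * w a) + ennreal ((?I a * w a) * \<psi> a) \<partial>lborel)"
    proof (rule nn_integral_mono_AE, use \<psi>(2) GA in eventually_elim)
      case (elim a)
      show ?case
      proof (cases "a \<in> {0<..<T}")
        case True
        then have "kk a y = F a ?x + G a ?x" using FG[OF _ x, of a] by (simp add: kk_nonneg)
        then have "norm (kk a y) \<le> norm (F a ?x) + norm (G a ?x)" by (simp add: norm_triangle_ineq)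
        also have "\<dots> \<le> N * a powr (- \<gamma>) * norm ?x + \<psi> a" using True elim F_bound[of a ?x] by auto
        finally have "w a * norm (kk a y) \<le> w a * (N * a powr (- \<gamma>) * norm ?x + \<psi> a)" using w by (intro mult_left_mono) auto
        also have "\<dots> = N * norm ?x * (a powr (- \<gamma>) * w a) + w a * \<psi> a" by (simp add: algebra_simps)
        finally have "ennreal (w a * norm (kk a y)) \<le> ennreal (N * norm ?x * (a powr (- \<gamma>) * w a) + w a * \<psi> a)" by (rule ennreal_leI)
        also have "\<dots> = ennreal (N * norm ?x) * ennreal (a powr (- \<gamma>) * w a) + ennreal (w a * \<psi> a)"
          using N w \<psi>(1)[of a] by (simp add: ennreal_plus ennreal_mult)
        finally show ?thesis using True by simp
      qed simp
    qed
    also have "\<dots> = ennreal (N * norm ?x) * (\<integral>\<^sup>+a. ennreal ((?I a * a powr (- \<gamma>)) * w a) \<partial>lborel)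
        + (\<integral>\<^sup>+a. ennreal ((?I a * w a) * \<psi> a) \<partial>lborel)"
      by (subst nn_integral_add) (auto simp: nn_integral_cmult)
    also have "\<dots> \<le> ennreal (N * norm ?x) * ennreal (A0 powr (1 - 1/p) * W) + ennreal (W * (C1 * norm ?x))"
    proof (intro add_mono mult_left_mono)
      have "(\<integral>\<^sup>+a. ennreal ((?I a * a powr (- \<gamma>)) * w a) \<partial>lborel) \<le> ennreal (A0 powr (1 - 1/p) * (W powr p) powr (1/p))"
      proof (rule nn_integral_Jensen)
        show "(\<integral>\<^sup>+a. ennreal (?I a * a powr (- \<gamma>)) \<partial>lborel) \<le> ennreal A0"
          using nn_integral_powr_interval[OF T \<gamma>(2)] by (simp add: A0_def)
        have "(\<integral>\<^sup>+a. ennreal ((?I a * a powr (- \<gamma>)) * w a powr p) \<partial>lborel)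
            \<le> (\<integral>\<^sup>+a. ennreal (?I a * (a powr (- \<gamma>) + 1) * w a powr p) \<partial>lborel)"
          by (intro nn_integral_mono ennreal_leI mult_right_mono mult_left_mono) auto
        then show "(\<integral>\<^sup>+a. ennreal ((?I a * a powr (- \<gamma>)) * w a powr p) \<partial>lborel) \<le> ennreal (W powr p)"
          using le by (rule order_trans)
      qed (use w A0 p in auto)
      then show "(\<integral>\<^sup>+a. ennreal ((?I a * a powr (- \<gamma>)) * w a) \<partial>lborel) \<le> ennreal (A0 powr (1 - 1/p) * W)"
        using p W by (simp add: powr_powr)
      show "(\<integral>\<^sup>+a. ennreal ((?I a * w a) * \<psi> a) \<partial>lborel) \<le> ennreal (W * (C1 * norm ?x))"
      proof (rule nn_integral_Hoelder[OF _ _ _ \<psi>(1) p p'(2) W _ _ \<psi>(3)])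
        have "(\<integral>\<^sup>+a. ennreal ((?I a * w a) powr p) \<partial>lborel)
            \<le> (\<integral>\<^sup>+a. ennreal (?I a * (a powr (- \<gamma>) + 1) * w a powr p) \<partial>lborel)"
        proof (intro nn_integral_mono ennreal_leI)
          fix a
          have "1 * w a powr p \<le> (a powr (- \<gamma>) + 1) * w a powr p" by (intro mult_right_mono) auto
          then show "(?I a * w a) powr p \<le> ?I a * (a powr (- \<gamma>) + 1) * w a powr p"
            using p by (simp add: indicator_def)
        qed
        then show "(\<integral>\<^sup>+a. ennreal ((?I a * w a) powr p) \<partial>lborel) \<le> ennreal (W powr p)" using le by (rule order_trans)
      qed (use w C1 in auto)
    qed simp
    also have "\<dots> = ennreal (N * norm ?x * (A0 powr (1 - 1/p) * W) + W * (C1 * norm ?x))"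
      using N A0 C1 W by (simp add: ennreal_plus ennreal_mult)
    also have "N * norm ?x * (A0 powr (1 - 1/p) * W) + W * (C1 * norm ?x) = C * W * norm ?x"
      by (simp add: C_def algebra_simps)
    finally show ?thesis .
  qed
  moreover have "C \<ge> 0" using N C1 by (simp add: C_def)
  ultimately show ?thesis by blast
qed

text \<open>Beyond time \<open>T\<close>, the semigroup property moves each block of length \<open>T / 2\<close> to \<open>[T / 2, T)\<close>, where
  the singularity of the kernel at \<open>0\<close> is not felt.\<close>

lemma kernel_estimate:
  assumes p: "p > 1" and \<beta>: "0 \<le> \<beta>" "\<beta> < \<omega>"
  shows "\<exists>C\<ge>0. \<forall>w y W. w \<in> borel_measurable borel \<longrightarrow> (\<forall>a. 0 \<le> w a) \<longrightarrow> 0 \<le> W \<longrightarrow>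
        (\<integral>\<^sup>+a. ennreal (kernel_weight \<gamma> (p * \<beta>) a * w a powr p) \<partial>lborel) \<le> ennreal (W powr p) \<longrightarrow>
        (\<integral>\<^sup>+a. ennreal (w a * norm (kk a y)) \<partial>lborel) \<le> ennreal (C * W * norm (J y))"
proof -
  obtain C where C: "C \<ge> 0" and base: "\<And>w y W. w \<in> borel_measurable borel \<Longrightarrow> (\<forall>a. 0 \<le> w a) \<Longrightarrow> 0 \<le> W \<Longrightarrow>
        (\<integral>\<^sup>+a. ennreal (indicator {0<..<T} a * (a powr (- \<gamma>) + 1) * w a powr p) \<partial>lborel) \<le> ennreal (W powr p) \<Longrightarrow>
        (\<integral>\<^sup>+a. ennreal (indicator {0<..<T} a * w a * norm (kk a y)) \<partial>lborel) \<le> ennreal (C * W * norm (J y))"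
    using kernel_base[OF p] by blast
  define \<tau> where "\<tau> = T / 2"
  have \<tau>: "\<tau> > 0" "T = 2 * \<tau>" using T by (auto simp: \<tau>_def)
  define g where "g = \<tau> powr (- \<gamma>) + 1"
  have g: "g \<ge> 1" by (simp add: g_def)
  \<comment> \<open>Ratio of consecutive blocks: one more shift gains e^{-\<omega>\<tau>} from the
    semigroup and loses e^{\<beta>\<tau>} to the weight, so \<beta> < \<omega> makes the series over
    the blocks geometric.\<close>
  define \<rho> where "\<rho> = exp (- (\<omega> - \<beta>) * \<tau>)"
  have "0 < (\<omega> - \<beta>) * \<tau>" using \<beta> \<tau> by (intro mult_pos_pos) auto
  then have "- (\<omega> - \<beta>) * \<tau> < 0" by (simp only: mult_minus_left)
  then have \<rho>: "0 < \<rho>" "\<rho> < 1" unfolding \<rho>_def by (simp_all only: exp_less_one_iff exp_gt_zero)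
  define C0 where "C0 = C * exp (\<beta> * T)"
  define K where "K = C * g * exp (\<beta> * T) * M"
  have K: "C0 \<ge> 0" "K \<ge> 0" using C g M1 by (auto simp: C0_def K_def)
  have "(\<integral>\<^sup>+a. ennreal (w a * norm (kk a y)) \<partial>lborel) \<le> ennreal ((C0 + K / (1 - \<rho>)) * W * norm (J y))"
    if [measurable]: "w \<in> borel_measurable borel" and w: "\<forall>a. 0 \<le> w a" and W: "0 \<le> W"
      and le: "(\<integral>\<^sup>+a. ennreal (kernel_weight \<gamma> (p * \<beta>) a * w a powr p) \<partial>lborel) \<le> ennreal (W powr p)"
    for w y W
  proof -
    have expp: "exp (\<beta> * s) powr p = exp (p * \<beta> * s)" for s unfolding exp_powr_real by (simp add: mult_ac)
    have b0: "(\<integral>\<^sup>+a. ennreal (indicator {0<..<T} a * w a * norm (kk a y)) \<partial>lborel) \<le> ennreal (C0 * W * norm (J y))"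
    proof -
      have "(\<integral>\<^sup>+a. ennreal (indicator {0<..<T} a * (a powr (- \<gamma>) + 1) * w a powr p) \<partial>lborel)
          \<le> (\<integral>\<^sup>+a. ennreal (exp (p * \<beta> * T)) * ennreal (kernel_weight \<gamma> (p * \<beta>) a * w a powr p) \<partial>lborel)"
      proof (rule nn_integral_mono)
        fix a
        have "indicator {0<..<T} a * (a powr (- \<gamma>) + 1) \<le> exp (p * \<beta> * T) * kernel_weight \<gamma> (p * \<beta>) a"
        proof (cases "a \<in> {0<..<T}")
          case True
          have "p * \<beta> * a \<le> p * \<beta> * T" using True p \<beta> by (intro mult_left_mono) auto
          then have "1 \<le> exp (p * \<beta> * T) * exp (- (p * \<beta>) * a)" unfolding exp_add[symmetric] by simp
          then have "(a powr (- \<gamma>) + 1) * 1 \<le> (a powr (- \<gamma>) + 1) * (exp (p * \<beta> * T) * exp (- (p * \<beta>) * a))"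
            by (intro mult_left_mono) (auto simp: add_nonneg_nonneg)
          then show ?thesis using True by (simp add: kernel_weight_def mult_ac)
        qed (simp add: kernel_weight_nonneg)
        then have "indicator {0<..<T} a * (a powr (- \<gamma>) + 1) * w a powr p \<le> (exp (p * \<beta> * T) * kernel_weight \<gamma> (p * \<beta>) a) * w a powr p"
          by (intro mult_right_mono) auto
        then show "ennreal (indicator {0<..<T} a * (a powr (- \<gamma>) + 1) * w a powr p)
            \<le> ennreal (exp (p * \<beta> * T)) * ennreal (kernel_weight \<gamma> (p * \<beta>) a * w a powr p)"
          unfolding ennreal_mult'[OF exp_ge_zero, symmetric] by (intro ennreal_leI) (simp add: mult.assoc)
      qed
      also have "\<dots> = ennreal (exp (p * \<beta> * T)) * (\<integral>\<^sup>+a. ennreal (kernel_weight \<gamma> (p * \<beta>) a * w a powr p) \<partial>lborel)"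
        by (rule nn_integral_cmult) measurable
      also have "\<dots> \<le> ennreal (exp (p * \<beta> * T)) * ennreal (W powr p)" using le by (intro mult_left_mono) auto
      also have "\<dots> = ennreal ((exp (\<beta> * T) * W) powr p)"
        unfolding powr_mult expp by (simp add: ennreal_mult)
      finally have "(\<integral>\<^sup>+a. ennreal (indicator {0<..<T} a * w a * norm (kk a y)) \<partial>lborel) \<le> ennreal (C * (exp (\<beta> * T) * W) * norm (J y))"
        using w W by (intro base) auto
      then show ?thesis by (simp add: C0_def mult_ac)
    qed
    define I where "I j a = (indicator {T + real j * \<tau>..<T + real (Suc j) * \<tau>} a :: real)" for j a
    have [measurable]: "I j \<in> borel_measurable borel" for j unfolding I_def[abs_def] by measurable
    have bj: "(\<integral>\<^sup>+a. ennreal (I j a * w a * norm (kk a y)) \<partial>lborel) \<le> ennreal (K * W * norm (J y) * \<rho> ^ j)" for j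
    proof -
      \<comment> \<open>Since T = 2 \<tau>, a shift by j + 1 lengths \<tau> moves the block from T +
        j \<tau> to T + (j+1) \<tau> onto [\<tau>, T).\<close>
      define s where "s = real (Suc j) * \<tau>"
      have s0: "s \<ge> 0" using \<tau> by (simp add: s_def)
      define w' where "w' b = indicator {\<tau>..<T} b * w (b + s)" for b
      have [measurable]: "w' \<in> borel_measurable borel" unfolding w'_def by measurable
      have Is: "I j (b + s) = indicator {\<tau>..<T} b" for b
        using \<tau> by (auto simp: I_def s_def indicator_def algebra_simps)
      have "(\<integral>\<^sup>+a. ennreal (I j a * w a * norm (kk a y)) \<partial>lborel)
          = (\<integral>\<^sup>+b. ennreal (I j (b + s) * w (b + s) * norm (kk (b + s) y)) \<partial>lborel)"
        using nn_integral_lborel_shift[of "\<lambda>a. ennreal (I j a * w a * norm (kk a y))" "- s"] by simp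
      also have "\<dots> = (\<integral>\<^sup>+b. ennreal (indicator {0<..<T} b * w' b * norm (kk b (E s y))) \<partial>lborel)"
      proof (rule nn_integral_cong)
        fix b
        show "ennreal (I j (b + s) * w (b + s) * norm (kk (b + s) y)) = ennreal (indicator {0<..<T} b * w' b * norm (kk b (E s y)))"
          unfolding Is w'_def using \<tau> kk_add[of b s y] s0 by (auto simp: indicator_def)
      qed
      also have "\<dots> \<le> ennreal (C * (g * exp (\<beta> * (T + s)) * W) * norm (J (E s y)))"
      proof (rule base)
        show "(\<integral>\<^sup>+b. ennreal (indicator {0<..<T} b * (b powr (- \<gamma>) + 1) * w' b powr p) \<partial>lborel)
            \<le> ennreal ((g * exp (\<beta> * (T + s)) * W) powr p)"
        proof -
          have "(\<integral>\<^sup>+b. ennreal (indicator {0<..<T} b * (b powr (- \<gamma>) + 1) * w' b powr p) \<partial>lborel)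
              \<le> (\<integral>\<^sup>+b. ennreal (g powr p * exp (p * \<beta> * (T + s))) * ennreal (kernel_weight \<gamma> (p * \<beta>) (b + s) * w (b + s) powr p) \<partial>lborel)"
          proof (rule nn_integral_mono)
            fix b
            have "indicator {0<..<T} b * (b powr (- \<gamma>) + 1) * w' b powr p
                \<le> (g powr p * exp (p * \<beta> * (T + s))) * (kernel_weight \<gamma> (p * \<beta>) (b + s) * w (b + s) powr p)"
            proof (cases "b \<in> {\<tau>..<T}")
              case True
              have bs: "b + s > 0" using True \<tau> s0 by simp
              have "b powr (- \<gamma>) \<le> \<tau> powr (- \<gamma>)" using True \<tau> \<gamma> by (intro powr_mono2') auto
              then have "b powr (- \<gamma>) + 1 \<le> g" by (simp add: g_def)
              \<comment> \<open>The constant is enlarged to a p-th power so that it can be absorbed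
                into the bound W; the summand 1 of the kernel weight bounds it below by the pure
                exponential.\<close>
              also have "g \<le> g powr p" using powr_mono[of 1 p g] g p by simp
              also have "g powr p * 1 \<le> g powr p * (exp (p * \<beta> * (T + s)) * kernel_weight \<gamma> (p * \<beta>) (b + s))"
              proof (intro mult_left_mono)
                have "p * \<beta> * (b + s) \<le> p * \<beta> * (T + s)" using True p \<beta> by (intro mult_left_mono) auto
                then have 1: "1 \<le> exp (p * \<beta> * (T + s)) * exp (- (p * \<beta>) * (b + s))" unfolding exp_add[symmetric] by simp
                have "exp (- (p * \<beta>) * (b + s)) \<le> kernel_weight \<gamma> (p * \<beta>) (b + s)"
                  using bs by (simp add: kernel_weight_def)
                then have "exp (p * \<beta> * (T + s)) * exp (- (p * \<beta>) * (b + s)) \<le> exp (p * \<beta> * (T + s)) * kernel_weight \<gamma> (p * \<beta>) (b + s)"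
                  by (intro mult_left_mono) auto
                with 1 show "1 \<le> exp (p * \<beta> * (T + s)) * kernel_weight \<gamma> (p * \<beta>) (b + s)" by (rule order_trans)
              qed simp
              finally have "b powr (- \<gamma>) + 1 \<le> g powr p * (exp (p * \<beta> * (T + s)) * kernel_weight \<gamma> (p * \<beta>) (b + s))" by simp
              then have "(b powr (- \<gamma>) + 1) * w (b + s) powr p \<le> (g powr p * (exp (p * \<beta> * (T + s)) * kernel_weight \<gamma> (p * \<beta>) (b + s))) * w (b + s) powr p"
                by (intro mult_right_mono) auto
              then show ?thesis using True \<tau> by (simp add: w'_def mult_ac)
            next
              case False
              then have "w' b = 0" by (simp add: w'_def)
              then show ?thesis using p kernel_weight_nonneg by simp
            qed
            then show "ennreal (indicator {0<..<T} b * (b powr (- \<gamma>) + 1) * w' b powr p)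
                \<le> ennreal (g powr p * exp (p * \<beta> * (T + s))) * ennreal (kernel_weight \<gamma> (p * \<beta>) (b + s) * w (b + s) powr p)"
              by (subst ennreal_mult[symmetric]) (auto intro!: ennreal_leI mult_nonneg_nonneg kernel_weight_nonneg)
          qed
          also have "\<dots> = ennreal (g powr p * exp (p * \<beta> * (T + s))) * (\<integral>\<^sup>+b. ennreal (kernel_weight \<gamma> (p * \<beta>) (b + s) * w (b + s) powr p) \<partial>lborel)"
            by (rule nn_integral_cmult) measurable
          also have "(\<integral>\<^sup>+b. ennreal (kernel_weight \<gamma> (p * \<beta>) (b + s) * w (b + s) powr p) \<partial>lborel)
              = (\<integral>\<^sup>+a. ennreal (kernel_weight \<gamma> (p * \<beta>) a * w a powr p) \<partial>lborel)"
            using nn_integral_lborel_shift[of "\<lambda>a. ennreal (kernel_weight \<gamma> (p * \<beta>) a * w a powr p)" "- s"] by simp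
          also have "ennreal (g powr p * exp (p * \<beta> * (T + s))) * \<dots> \<le> ennreal (g powr p * exp (p * \<beta> * (T + s))) * ennreal (W powr p)"
            using le by (intro mult_left_mono) auto
          also have "\<dots> = ennreal ((g * exp (\<beta> * (T + s)) * W) powr p)"
            unfolding powr_mult expp by (simp add: ennreal_mult)
          finally show ?thesis .
        qed
        show "\<forall>a. 0 \<le> w' a" using w by (simp add: w'_def)
        show "0 \<le> g * exp (\<beta> * (T + s)) * W" using g W by simp
      qed measurable
      also have "\<dots> \<le> ennreal (K * W * norm (J y) * \<rho> ^ j)"
      proof (rule ennreal_leI)
        have n: "norm (J (E s y)) \<le> M * exp (- \<omega> * s) * norm (J y)" using E_bound[OF s0, of "J y"] by (simp add: E_J[OF s0])
        have "\<rho> ^ Suc j = exp (real (Suc j) * (- (\<omega> - \<beta>) * \<tau>))" unfolding \<rho>_def by (rule exp_of_nat_mult[symmetric])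
        also have "\<dots> = exp (\<beta> * s) * exp (- \<omega> * s)" unfolding exp_add[symmetric] s_def by (simp add: algebra_simps)
        finally have \<rho>s: "exp (\<beta> * s) * exp (- \<omega> * s) = \<rho> ^ Suc j" by simp
        have "C * (g * exp (\<beta> * (T + s)) * W) * norm (J (E s y)) \<le> C * (g * exp (\<beta> * (T + s)) * W) * (M * exp (- \<omega> * s) * norm (J y))"
          using C g W by (intro mult_left_mono n) auto
        also have "\<dots> = (K * W * norm (J y)) * (exp (\<beta> * s) * exp (- \<omega> * s))"
          by (simp add: K_def distrib_left exp_add mult_ac)
        also have "\<dots> \<le> (K * W * norm (J y)) * \<rho> ^ j"
          unfolding \<rho>s using K W \<rho> by (intro mult_left_mono power_decreasing) auto
        finally show "C * (g * exp (\<beta> * (T + s)) * W) * norm (J (E s y)) \<le> K * W * norm (J y) * \<rho> ^ j" .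
      qed
      finally show ?thesis .
    qed
    have "(\<integral>\<^sup>+a. ennreal (w a * norm (kk a y)) \<partial>lborel)
        \<le> (\<integral>\<^sup>+a. ennreal (indicator {0<..<T} a * w a * norm (kk a y)) + (\<Sum>j. ennreal (I j a * w a * norm (kk a y))) \<partial>lborel)"
    proof (rule nn_integral_mono_AE, use AE_lborel_singleton[of 0] in eventually_elim)
      case (elim a)
      consider "a < 0" | "a \<in> {0<..<T}" | "a \<ge> T" using elim by force
      then show ?case
      proof cases
        case 3
        define j where "j = nat \<lfloor>(a - T) / \<tau>\<rfloor>"
        have "(a - T) / \<tau> \<ge> 0" using 3 \<tau> by simp
        then have "real j \<le> (a - T) / \<tau>" "(a - T) / \<tau> < real j + 1" unfolding j_def by linarith+
        then have "I j a = 1" using \<tau> by (auto simp: I_def indicator_def field_simps)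
        then have "ennreal (w a * norm (kk a y)) = ennreal (I j a * w a * norm (kk a y))" by simp
        also have "\<dots> \<le> (\<Sum>j. ennreal (I j a * w a * norm (kk a y)))"
          by (rule suminf_ge_term[of "\<lambda>j. ennreal (I j a * w a * norm (kk a y))"])
        finally show ?thesis by (simp add: add_increasing)
      qed (simp_all add: kk_neg add_increasing2)
    qed
    also have "\<dots> = (\<integral>\<^sup>+a. ennreal (indicator {0<..<T} a * w a * norm (kk a y)) \<partial>lborel)
        + (\<integral>\<^sup>+a. (\<Sum>j. ennreal (I j a * w a * norm (kk a y))) \<partial>lborel)"
      by (rule nn_integral_add) measurable
    also have "(\<integral>\<^sup>+a. (\<Sum>j. ennreal (I j a * w a * norm (kk a y))) \<partial>lborel)
        = (\<Sum>j. \<integral>\<^sup>+a. ennreal (I j a * w a * norm (kk a y)) \<partial>lborel)"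
      by (rule nn_integral_suminf) measurable
    also have "(\<integral>\<^sup>+a. ennreal (indicator {0<..<T} a * w a * norm (kk a y)) \<partial>lborel) + \<dots>
        \<le> ennreal (C0 * W * norm (J y)) + (\<Sum>j. ennreal (K * W * norm (J y) * \<rho> ^ j))"
      by (intro add_mono b0 suminf_le bj) auto
    also have "(\<Sum>j. ennreal (K * W * norm (J y) * \<rho> ^ j)) = ennreal (\<Sum>j. K * W * norm (J y) * \<rho> ^ j)"
      using \<rho> K W by (intro suminf_ennreal2) (auto intro!: summable_mult)
    also have "(\<Sum>j. K * W * norm (J y) * \<rho> ^ j) = K * W * norm (J y) / (1 - \<rho>)"
      using \<rho> by (subst suminf_mult) (auto simp: suminf_geometric)
    also have "ennreal (C0 * W * norm (J y)) + ennreal (K * W * norm (J y) / (1 - \<rho>))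
        = ennreal (C0 * W * norm (J y) + K * W * norm (J y) / (1 - \<rho>))"
      using K W \<rho> by (intro ennreal_plus[symmetric]) auto
    also have "C0 * W * norm (J y) + K * W * norm (J y) / (1 - \<rho>) = (C0 + K / (1 - \<rho>)) * W * norm (J y)"
      by (simp add: algebra_simps)
    finally show ?thesis .
  qed
  moreover have "C0 + K / (1 - \<rho>) \<ge> 0" using K \<rho> by simp
  ultimately show ?thesis by blast
qed

end

section \<open>Borel representatives of Lebesgue measurable functions\<close>

lemma AE_half_line: "(AE t in lebesgue_on {0<..}. Q t) \<longleftrightarrow> (AE t in lborel. 0 < t \<longrightarrow> Q t)"
  for Q :: "real \<Rightarrow> bool"
  by (subst AE_restrict_space_iff) (auto simp: AE_completion_iff)

lemma completion_measurable_AE_cong: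
  fixes f g :: "'a \<Rightarrow> 'b::topological_space"
  assumes g: "g \<in> borel_measurable (completion M)" and eq: "AE t in completion M. f t = g t"
  shows "f \<in> borel_measurable (completion M)"
proof (rule borel_measurableI)
  fix X :: "'b set" assume X: "open X"
  show "f -` X \<inter> space (completion M) \<in> sets (completion M)"
  proof (rule completion.in_sets_AE)
    show "g -` X \<inter> space (completion M) \<in> sets (completion M)" by (rule measurable_sets[OF g borel_open[OF X]])
    show "AE x in completion M. x \<in> g -` X \<inter> space (completion M) \<longleftrightarrow> x \<in> f -` X \<inter> space (completion M)"
      using eq by eventually_elim simp
  qed simp
qed

lemma lebesgue_integral_eq_lborel:
  fixes f g :: "real \<Rightarrow> 'b::{banach, second_countable_topology}"
  assumes g: "g \<in> borel_measurable borel" and eq: "AE t in lborel. f t = g t"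
  shows "(LINT t|lebesgue. f t) = (\<integral>t. g t \<partial>lborel)"
proof -
  have gl: "g \<in> borel_measurable lebesgue" using g by (intro measurable_completion) simp
  have "(LINT t|lebesgue. f t) = (LINT t|lebesgue. g t)"
    using completion_measurable_AE_cong[OF gl AE_completion[OF eq]] gl AE_completion[OF eq]
    by (rule integral_cong_AE)
  also have "\<dots> = (\<integral>t. g t \<partial>lborel)" using g by (intro integral_completion) simp
  finally show ?thesis .
qed

lemma half_line_measurable_AE_cong:
  fixes f g :: "real \<Rightarrow> 'b::{second_countable_topology, real_normed_vector}"
  assumes g: "g \<in> borel_measurable borel" and eq: "AE t in lebesgue_on {0<..}. f t = g t"
  shows "f \<in> borel_measurable (lebesgue_on {0<..})"
proof -
  have "(\<lambda>t. if 0 < t then g t else 0) \<in> borel_measurable borel" using g by simp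
  then have "(\<lambda>t. if 0 < t then g t else 0) \<in> borel_measurable lebesgue"
    by (intro measurable_completion) simp
  moreover have "AE t in lebesgue. (if 0 < t then f t else 0) = (if 0 < t then g t else 0)"
    using AE_completion[OF eq[unfolded AE_half_line]] by eventually_elim simp
  ultimately have m: "(\<lambda>t. if 0 < t then f t else 0) \<in> borel_measurable lebesgue"
    by (rule completion_measurable_AE_cong)
  have "(\<lambda>t. if 0 < t then f t else 0) \<in> borel_measurable (lebesgue_on {0<..})"
    using m by (rule measurable_restrict_space1)
  then show ?thesis by (rule measurable_cong[THEN iffD1, rotated]) (simp add: space_restrict_space)
qed

text \<open>Each of countably many simple approximants agrees with a Borel simple function off a
  null set. Off one common Borel null set \<open>Z\<close> they all agree, and setting the limit to
  0 on \<open>Z\<close> makes it Borel.\<close>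

lemma Borel_representative:
  fixes f :: "real \<Rightarrow> 'b::{second_countable_topology, real_normed_vector}"
  assumes f: "f \<in> borel_measurable (lebesgue_on {0<..})"
  obtains g where "g \<in> borel_measurable borel" "\<And>t. t \<le> 0 \<Longrightarrow> g t = 0" "AE t in lebesgue_on {0<..}. f t = g t"
proof -
  define h where "h t = (if 0 < t then f t else 0)" for t
  have "h \<in> borel_measurable lebesgue"
  proof -
    have "f \<in> borel_measurable (restrict_space lebesgue {t. 0 < t})" using f by (simp add: greaterThan_def)
    then show ?thesis unfolding h_def by (intro measurable_If_restrict_space_iff[THEN iffD2]) auto
  qed
  from borel_measurable_implies_sequence_metric[OF this, of 0]
  obtain s where s: "\<And>i. simple_function lebesgue (s i)" "\<And>t. (\<lambda>i. s i t) \<longlonglongrightarrow> h t" by auto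
  have "\<exists>s'. simple_function lborel s' \<and> (AE t in lborel. s i t = s' t)" for i
    by (rule completion_ex_simple_function[OF s(1)])
  then obtain s' where s': "\<And>i. simple_function lborel (s' i)" "\<And>i. AE t in lborel. s i t = s' i t" by metis
  have "AE t in lborel. \<forall>i. s i t = s' i t" using s'(2) by (simp add: AE_all_countable)
  then obtain Z where Z: "Z \<in> null_sets lborel" "{t \<in> space lborel. \<not> (\<forall>i. s i t = s' i t)} \<subseteq> Z"
    unfolding eventually_ae_filter by auto
  have ZB: "Z \<in> sets borel" using Z(1) by auto
  have AEZ: "AE t in lborel. t \<notin> Z" using Z(1) by (rule AE_not_in)
  define g where "g t = (if t \<in> Z \<or> t \<le> 0 then 0 else h t)" for t
  have gm: "g \<in> borel_measurable borel"
  proof (rule borel_measurable_LIMSEQ_metric)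
    fix i
    have [measurable]: "s' i \<in> borel_measurable borel" using borel_measurable_simple_function[OF s'(1)[of i]] by simp
    show "(\<lambda>t. if t \<in> Z \<or> t \<le> 0 then 0 else s' i t) \<in> borel_measurable borel" using ZB by measurable
  next
    fix t
    show "(\<lambda>i. if t \<in> Z \<or> t \<le> 0 then 0 else s' i t) \<longlonglongrightarrow> g t"
    proof (cases "t \<in> Z \<or> t \<le> 0")
      case False
      then have "s i t = s' i t" for i using Z(2) by auto
      then show ?thesis using s(2)[of t] False by (simp add: g_def)
    qed (auto simp: g_def)
  qed
  show ?thesis
  proof (rule that[OF gm])
    show "AE t in lebesgue_on {0<..}. f t = g t"
      unfolding AE_half_line using AEZ by eventually_elim (simp add: g_def h_def)
  qed (simp add: g_def)
qed

text \<open>The dictionary between Lebesgue measurable functions on the half-line and Borel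
  representatives on the line. Measurability of \<open>f\<close> is inherited from \<open>g\<close>
  by completeness, so both directions only compare integrals.\<close>

lemma weighted_Lp_bound_iff:
  fixes f g :: "real \<Rightarrow> 'b::{complex_hilbert, second_countable_topology}"
  assumes g: "g \<in> borel_measurable borel" "\<And>t. t \<le> 0 \<Longrightarrow> g t = 0"
    and eq: "AE t in lebesgue_on {0<..}. f t = g t" and p: "p \<ge> 1" and a: "a \<ge> 0"
  shows "f \<in> weighted_Lp p \<delta> \<and> weighted_Lp_norm p \<delta> f \<le> a \<longleftrightarrow> Lp_bound p \<delta> a g"
proof -
  let ?h = "\<lambda>t. (exp (\<delta> * t) * norm (g t)) powr p"
  have [measurable]: "g \<in> borel_measurable borel" by fact
  have fm: "f \<in> borel_measurable (lebesgue_on {0<..})" by (rule half_line_measurable_AE_cong[OF g(1) eq])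
  have expm: "(\<lambda>t. exp (\<delta> * t)) \<in> borel_measurable (lebesgue_on {0<..})"
    by (intro measurable_restrict_space1 measurable_completion) simp
  have efm: "(\<lambda>t. exp (\<delta> * t) *\<^sub>R f t) \<in> borel_measurable (lebesgue_on {0<..})"
    using expm fm by (rule borel_measurable_scaleR)
  have hm: "?h \<in> borel_measurable (lebesgue_on {0<..})"
    by (intro measurable_restrict_space1 measurable_completion) simp
  have efm2: "(\<lambda>t. norm (exp (\<delta> * t) *\<^sub>R f t) powr p) \<in> borel_measurable (lebesgue_on {0<..})"
    using efm by measurable
  have ae: "AE t in lebesgue_on {0<..}. norm (exp (\<delta> * t) *\<^sub>R f t) powr p = ?h t"
    using eq by eventually_elim simp
  have nn: "(\<integral>\<^sup>+t. ennreal (?h t) \<partial>lebesgue_on {0<..}) = (\<integral>\<^sup>+t. ennreal (?h t) \<partial>lborel)"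
  proof -
    have "(\<integral>\<^sup>+t. ennreal (?h t) \<partial>lebesgue_on {0<..}) = (\<integral>\<^sup>+t. ennreal (?h t) * indicator {0<..} t \<partial>lebesgue)"
      by (rule nn_integral_restrict_space) auto
    also have "\<dots> = (\<integral>\<^sup>+t. ennreal (?h t) \<partial>lebesgue)"
      by (rule nn_integral_cong) (use g p in \<open>auto simp: indicator_def not_less\<close>)
    finally show ?thesis by (simp add: nn_integral_completion)
  qed
  have int: "integrable (lebesgue_on {0<..}) (\<lambda>t. norm (exp (\<delta> * t) *\<^sub>R f t) powr p) \<longleftrightarrow> integrable (lebesgue_on {0<..}) ?h"
    by (rule integrable_cong_AE[OF efm2 hm ae])
  have val: "(LINT t|lebesgue_on {0<..}. norm (exp (\<delta> * t) *\<^sub>R f t) powr p) = (LINT t|lebesgue_on {0<..}. ?h t)"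
    by (rule integral_cong_AE[OF efm2 hm ae])
  let ?L = "LINT t|lebesgue_on {0<..}. ?h t"
  have L0: "?L \<ge> 0" by simp
  have w: "f \<in> weighted_Lp p \<delta> \<longleftrightarrow> integrable (lebesgue_on {0<..}) ?h" "weighted_Lp_norm p \<delta> f = ?L powr (1/p)"
    unfolding weighted_Lp_def Lp_space_def weighted_Lp_norm_def Lp_norm_def using efm int val by auto
  show ?thesis
  proof
    assume *: "f \<in> weighted_Lp p \<delta> \<and> weighted_Lp_norm p \<delta> f \<le> a"
    then have i: "integrable (lebesgue_on {0<..}) ?h" and le: "?L powr (1/p) \<le> a" using w by auto
    have "?L = (?L powr (1/p)) powr p" using p L0 by (simp add: powr_powr)
    also have "\<dots> \<le> a powr p" using le p by (intro powr_mono2) auto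
    finally have "ennreal ?L \<le> ennreal (a powr p)" by (rule ennreal_leI)
    moreover have "(\<integral>\<^sup>+t. ennreal (?h t) \<partial>lebesgue_on {0<..}) = ennreal ?L" by (rule nn_integral_eq_integral[OF i]) auto
    ultimately show "Lp_bound p \<delta> a g" using g a nn by (intro Lp_boundI) auto
  next
    assume "Lp_bound p \<delta> a g"
    then have b: "(\<integral>\<^sup>+t. ennreal (?h t) \<partial>lebesgue_on {0<..}) \<le> ennreal (a powr p)" using Lp_boundD(4) nn by metis
    have i: "integrable (lebesgue_on {0<..}) ?h"
      by (rule integrableI_bounded[OF hm]) (use b in \<open>auto intro: le_less_trans\<close>)
    have "ennreal ?L \<le> ennreal (a powr p)" using b nn_integral_eq_integral[OF i] by simp
    then have "?L \<le> a powr p" by simp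
    then have "?L powr (1/p) \<le> (a powr p) powr (1/p)" using p L0 by (intro powr_mono2) auto
    then have "?L powr (1/p) \<le> a" using p a by (simp add: powr_powr)
    with i show "f \<in> weighted_Lp p \<delta> \<and> weighted_Lp_norm p \<delta> f \<le> a" using w by simp
  qed
qed

lemma weighted_Lp_0: "Lp_space p {0<..} = weighted_Lp p 0" "Lp_norm p {0<..} f = weighted_Lp_norm p 0 f"
  by (simp_all add: weighted_Lp_def weighted_Lp_norm_def)

lemma weighted_Lp_norm_nonneg: "weighted_Lp_norm p \<delta> f \<ge> 0"
  by (simp add: weighted_Lp_norm_def Lp_norm_def)

lemma weighted_Lp_representative:
  fixes f :: "real \<Rightarrow> 'b::{complex_hilbert, second_countable_topology}"
  assumes f: "f \<in> weighted_Lp p \<delta>" and p: "p \<ge> 1"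
  obtains g where "AE t in lebesgue_on {0<..}. f t = g t" "Lp_bound p \<delta> (weighted_Lp_norm p \<delta> f) g"
proof -
  have e: "(\<lambda>t. exp (\<delta> * t) *\<^sub>R f t) \<in> borel_measurable (lebesgue_on {0<..})"
    using f by (simp add: weighted_Lp_def Lp_space_def)
  have "(\<lambda>t. exp (- \<delta> * t)) \<in> borel_measurable (lebesgue_on {0<..})"
    by (intro measurable_restrict_space1 measurable_completion) simp
  from borel_measurable_scaleR[OF this e] have "f \<in> borel_measurable (lebesgue_on {0<..})"
    by (simp add: exp_add[symmetric])
  then obtain g where g: "g \<in> borel_measurable borel" "\<And>t. t \<le> 0 \<Longrightarrow> g t = 0" "AE t in lebesgue_on {0<..}. f t = g t"
    using Borel_representative by blast
  show ?thesis
    by (rule that[OF g(3)]) (use weighted_Lp_bound_iff[OF g p weighted_Lp_norm_nonneg] f in blast)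
qed

lemma Lp_tendsto_representative:
  fixes fs :: "nat \<Rightarrow> real \<Rightarrow> 'b::{complex_hilbert, second_countable_topology}"
  assumes l: "Lp_tendsto q {0<..} fs f" and q: "q \<ge> 1" and m: "\<And>n. fs' n \<in> borel_measurable borel" "\<And>n t. t \<le> 0 \<Longrightarrow> fs' n t = 0"
    and eq: "\<And>n. AE t in lebesgue_on {0<..}. fs n t = fs' n t"
    and f': "Lp_bound q 0 a f'" "AE t in lebesgue_on {0<..}. f t = f' t"
  obtains e where "\<And>n. Lp_bound q 0 (e n) (\<lambda>t. f' t - fs' n t)" "e \<longlonglongrightarrow> 0"
proof (rule that)
  let ?e = "\<lambda>n. Lp_norm q {0<..} (\<lambda>t. fs n t - f t)"
  show "?e \<longlonglongrightarrow> 0" using l by (simp add: Lp_tendsto_def)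
  fix n
  have fn: "fs n \<in> weighted_Lp q 0" using l by (simp add: Lp_tendsto_def weighted_Lp_0)
  have d1: "Lp_bound q 0 (weighted_Lp_norm q 0 (fs n)) (fs' n)"
    using weighted_Lp_bound_iff[OF m(1)[of n] m(2) eq[of n] q weighted_Lp_norm_nonneg[of q 0 "fs n"], of 0] fn by blast
  have d: "Lp_bound q 0 (2 * (weighted_Lp_norm q 0 (fs n) + a)) (\<lambda>t. fs' n t - f' t)"
    by (rule Lp_bound_diff[OF d1 f'(1) q])
  have ae: "AE t in lebesgue_on {0<..}. fs n t - f t = fs' n t - f' t"
    using eq[of n] f'(2) by eventually_elim simp
  have *: "(\<lambda>t. fs n t - f t) \<in> weighted_Lp q 0"
    using weighted_Lp_bound_iff[OF Lp_boundD(1,2)[OF d] ae q Lp_boundD(3)[OF d]] d by blast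
  have "Lp_bound q 0 (?e n) (\<lambda>t. fs' n t - f' t)"
    unfolding weighted_Lp_0 using weighted_Lp_bound_iff[OF Lp_boundD(1,2)[OF d] ae q weighted_Lp_norm_nonneg] * by blast
  from Lp_bound_scaleR[OF this q, of "-1"] show "Lp_bound q 0 (?e n) (\<lambda>t. f' t - fs' n t)" by simp
qed

lemma Lp_tendsto_of_bounds:
  fixes fs' :: "nat \<Rightarrow> real \<Rightarrow> 'b::{complex_hilbert, second_countable_topology}"
  assumes q: "q \<ge> 1" and fs': "\<And>n. Lp_bound q 0 (b n) (fs' n)" and f': "Lp_bound q 0 a f'"
    and eq: "\<And>n. AE t in lebesgue_on {0<..}. fs n t = fs' n t" "AE t in lebesgue_on {0<..}. f t = f' t"
    and e: "\<And>n. Lp_bound q 0 (e n) (\<lambda>t. f' t - fs' n t)" "e \<longlonglongrightarrow> 0"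
  shows "Lp_tendsto q {0<..} fs f"
  unfolding Lp_tendsto_def weighted_Lp_0
proof (intro conjI allI)
  show "fs n \<in> weighted_Lp q 0" for n
    using weighted_Lp_bound_iff[OF Lp_boundD(1,2)[OF fs'] eq(1) q Lp_boundD(3)[OF fs']] fs' by blast
  show "f \<in> weighted_Lp q 0"
    using weighted_Lp_bound_iff[OF Lp_boundD(1,2)[OF f'] eq(2) q Lp_boundD(3)[OF f']] f' by blast
  have "weighted_Lp_norm q 0 (\<lambda>t. fs n t - f t) \<le> e n" for n
  proof -
    have d: "Lp_bound q 0 (e n) (\<lambda>t. fs' n t - f' t)" using Lp_bound_scaleR[OF e(1)[of n] q, of "-1"] by simp
    have ae: "AE t in lebesgue_on {0<..}. fs n t - f t = fs' n t - f' t" using eq(1)[of n] eq(2) by eventually_elim simp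
    show ?thesis using weighted_Lp_bound_iff[OF Lp_boundD(1,2)[OF d] ae q Lp_boundD(3)[OF d]] d by blast
  qed
  then show "(\<lambda>n. weighted_Lp_norm q 0 (\<lambda>t. fs n t - f t)) \<longlonglongrightarrow> 0"
    by (intro tendsto_sandwich[OF _ _ tendsto_const e(2)]) (auto simp: weighted_Lp_norm_nonneg)
qed

section \<open>The operator \<open>\<Lambda>\<close> in terms of the kernel\<close>

locale controlled_cost = control_system D A S M \<omega> B F G \<gamma> N T
  for D :: "'y::{complex_hilbert, second_countable_topology} set" and A S M \<omega>
    and B :: "'u::{complex_hilbert, second_countable_topology} \<Rightarrow> 'y \<Rightarrow> complex" and F G \<gamma> N T +
  fixes R :: "'y \<Rightarrow> 'z::complex_hilbert"
  assumes R: "bounded_clinear R"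
begin

definition Q :: "'y \<Rightarrow> 'y" where "Q x = adj UNIV R (R x)"

lemma Q_inner: "inner (Q x) y = inner (R x) (R y)"
  using adj_bounded_inner[OF R, of y "R x"] by (simp add: Q_def inner_commute)

lemma Q_bl: "bounded_linear Q"
proof -
  have Rl: "bounded_linear R" by (rule bounded_clinear_imp_bounded_linear[OF R])
  obtain C where C: "\<And>x. norm (R x) \<le> norm x * C" "C \<ge> 0" using bounded_linear.nonneg_bounded[OF Rl] by blast
  have "bounded_linear (adj UNIV R)"
    by (rule real_adjoint_bounded_linear(1)[OF adj_bounded_inner[OF R], of C]) (use C in \<open>auto simp: mult.commute\<close>)
  from bounded_linear_compose[OF this Rl] show ?thesis by (simp add: Q_def[abs_def])
qed

sublocale K: control_kernel J kk Q \<gamma> \<omega>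
proof (rule control_kernel.intro)
  show "bounded_linear J" by (rule J_bl)
  show "closure (range J) = UNIV" by (rule J_dense)
  show "linear (kk a)" for a by (rule kk_linear)
  show "(\<lambda>(a, y). kk a y) \<in> borel_measurable (borel \<Otimes>\<^sub>M borel)" by (rule kk_pair)
  show "\<And>a y. a < 0 \<Longrightarrow> kk a y = 0" by (rule kk_neg)
  show "\<exists>C. \<forall>a y. norm (kk a y) \<le> C * exp (- \<omega> * a) * norm y" by (rule kk_bound)
  show "0 < \<gamma>" "\<gamma> < 1" "0 < \<omega>" using \<gamma> \<omega> by auto
  show "bounded_linear Q" by (rule Q_bl)
  show "inner (Q x) y = inner x (Q y)" for x y
    using Q_inner[of x y] Q_inner[of y x] by (simp add: inner_commute)
  show "0 \<le> inner (Q x) x" for x by (simp add: Q_inner)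
qed (rule kernel_estimate)

text \<open>\<open>J\<close> was chosen through the real inner product, so complex homogeneity has
  to be derived: c J y lies in the domain of the adjoint generator, which sends it to c y.\<close>

lemma J_scaleC: "J (c *\<^sub>C y) = c *\<^sub>C J y"
proof -
  have "cinner (A x) (c *\<^sub>C J y) = cinner x (c *\<^sub>C y)" if x: "x \<in> D" for x
  proof -
    have "inner (A v) (J y) = inner v y" if "v \<in> D" for v using that by (simp add: J_inner P_A)
    from this[OF x] this[OF clinear_on_scaleC(1)[OF A_lin x, of \<i>]]
    have "cinner (A x) (J y) = cinner x y"
      by (intro complex_eqI) (simp_all add: Re_cinner Im_cinner clinear_on_scaleC(2)[OF A_lin x])
    then show ?thesis by (simp add: cinner_scaleC_right)
  qed
  then have "c *\<^sub>C J y \<in> adj_dom D A" "adj D A (c *\<^sub>C J y) = c *\<^sub>C y"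
    by (auto simp: adj_dom_def intro: adj_char)
  then show ?thesis using adj_J by metis
qed

lemma kk_scaleC: "kk a (c *\<^sub>C y) = c *\<^sub>C kk a y"
proof (cases "a \<ge> 0")
  case True
  have E: "E a (c *\<^sub>C y) = c *\<^sub>C E a y"
  proof (rule cinner_eqI)
    fix x
    have "cinner (S a x) (c *\<^sub>C y) = cinner x (E a (c *\<^sub>C y))" "cinner (S a x) y = cinner x (E a y)"
      unfolding adj_semigroup_def by (rule adj_bounded_char[OF S_bc[OF True]])+
    then show "cinner x (E a (c *\<^sub>C y)) = cinner x (c *\<^sub>C E a y)" by (simp add: cinner_scaleC_right)
  qed
  have "J 0 = 0" using J_bl by (simp add: bounded_linear.linear linear_0)
  then have z: "0 \<in> adj_dom D A" using J_adj(1)[of 0] by simp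
  have conj: "B u (c *\<^sub>C x + z) = cnj c * B u x + B u z" if "x \<in> adj_dom D A" "z \<in> adj_dom D A" for c x z u
    using B that by (auto simp: control_operator_def pivot_dual_def)
  have B0: "B u 0 = 0" for u using conj[OF z z, of u 1] by (simp add: scaleC_1)
  have "cJ (c *\<^sub>C x) = c *\<^sub>C cJ x" for x
  proof (rule cinner_eqI)
    fix u
    show "cinner u (cJ (c *\<^sub>C x)) = cinner u (c *\<^sub>C cJ x)"
      using conj[OF J_adj(1)[of x] z, of u c] control_adj_char[OF J_adj(1), of u x] control_adj_char[OF J_adj(1), of u "c *\<^sub>C x"]
      by (simp add: cJ_def J_scaleC cinner_scaleC_right B0)
  qed
  then show ?thesis using True E by (simp add: kk_def)
next
  case False
  then have "kk a (c *\<^sub>C y) = 0" "kk a y = 0" by (simp_all add: kk_neg)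
  then show ?thesis using scaleC_add_right[of c "0::'u" 0] by simp
qed

text \<open>\<open>input_map\<close> is described by complex functionals, \<open>is_input\<close> by
  real pairings. The complex integral is assembled from the real ones for y and \<i> y, and density
  of the range of \<open>J\<close> gives uniqueness.\<close>

lemma input_map_eq:
  assumes u: "u' \<in> borel_measurable borel" "\<And>t. t \<le> 0 \<Longrightarrow> u' t = 0" and eq: "AE t in lebesgue_on {0<..}. u t = u' t"
    and l: "K.is_input u' t l" and t: "t > 0"
  shows "input_map D A S B u t = l"
proof -
  have [measurable]: "u' \<in> borel_measurable borel" by fact
  have int: "integrable lborel (\<lambda>s. inner (u' s) (kk (t - s) y))" for y using l by (simp add: K.is_input_def)
  have val: "(\<integral>s. inner (u' s) (kk (t - s) y) \<partial>lborel) = inner l (J y)" for y using l by (simp add: K.is_input_def)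
  have ch: "(LINT s:{0..t}|lebesgue. semigroup_ext S (t - s) (B (u s)) (J y)) = cinner l (J y)" for y
  proof -
    let ?g = "\<lambda>s. complex_of_real (inner (u' s) (kk (t - s) y)) + \<i> * complex_of_real (inner (u' s) (kk (t - s) (\<i> *\<^sub>C y)))"
    have g: "?g s = cinner (u' s) (kk (t - s) y)" for s
      by (rule complex_eqI) (simp_all add: Re_cinner Im_cinner' kk_scaleC)
    \<comment> \<open>The point s = 0 belongs to the interval of integration, but the two inputs are
      only compared for s > 0; it is removed as a null set.\<close>
    have "AE s in lborel. indicator {0..t} s *\<^sub>R semigroup_ext S (t - s) (B (u s)) (J y) = ?g s"
      using eq[unfolded AE_half_line] AE_lborel_singleton[of 0]
    proof eventually_elim
      case (elim s)
      consider "s < 0" | "0 < s" "s \<le> t" | "t < s" using elim(2) by linarith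
      then show ?case
      proof cases
        case 2
        have "semigroup_ext S (t - s) (B (u' s)) (J y) = cinner (u' s) (kk (t - s) y)"
          using 2 E_J[of "t - s" y] control_adj_char[OF J_adj(1)[of "E (t - s) y"], of "u' s"]
          by (simp add: semigroup_ext_def kk_nonneg)
        then show ?thesis using 2 elim(1) unfolding g by simp
      next
        case 1
        then show ?thesis unfolding g using u(2)[of s] scaleC_0_left[of "0::'u"] by (simp add: complex_eq_iff Re_cinner Im_cinner')
      next
        case 3
        then show ?thesis unfolding g by (simp add: kk_neg complex_eq_iff Re_cinner Im_cinner)
      qed
    qed
    then have "(LINT s:{0..t}|lebesgue. semigroup_ext S (t - s) (B (u s)) (J y)) = (\<integral>s. ?g s \<partial>lborel)"
      unfolding set_lebesgue_integral_def by (intro lebesgue_integral_eq_lborel) measurable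
    also have "\<dots> = complex_of_real (inner l (J y)) + \<i> * complex_of_real (inner l (J (\<i> *\<^sub>C y)))"
      using int[of y] int[of "\<i> *\<^sub>C y"] val[of y] val[of "\<i> *\<^sub>C y"] by simp
    also have "\<dots> = cinner l (J y)"
      by (rule complex_eqI) (simp_all add: Re_cinner Im_cinner' J_scaleC)
    finally show ?thesis .
  qed
  show ?thesis unfolding input_map_def
  proof (rule the_equality)
    show "\<forall>x\<in>adj_dom D A. cinner l x = (LINT s:{0..t}|lebesgue. semigroup_ext S (t - s) (B (u s)) x)"
      unfolding adj_dom_eq using ch by auto
    fix l' assume "\<forall>x\<in>adj_dom D A. cinner l' x = (LINT s:{0..t}|lebesgue. semigroup_ext S (t - s) (B (u s)) x)"
    then have "cinner l' (J y) = cinner l (J y)" for y using ch[of y] J_adj(1)[of y] by simp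
    then have "inner l' (J y) = inner l (J y)" for y by (metis Re_cinner)
    then show "l' = l" by (rule K.eq_dense)
  qed
qed

lemma adj_input_integral_eq:
  assumes y': "y' \<in> borel_measurable borel" and eq: "AE t in lebesgue_on {0<..}. v t = J (y' t)" and s: "s > 0"
  shows "adj_input_integral S B v s = K.adj_input y' s"
proof -
  have [measurable]: "y' \<in> borel_measurable borel" by fact
  have "AE t in lborel. indicator {s..} t *\<^sub>R control_adj B (E (t - s) (v t)) = kk (t - s) (y' t)"
    using eq[unfolded AE_half_line]
  proof eventually_elim
    case (elim t)
    then show ?case using s by (cases "s \<le> t") (simp_all add: kk_nonneg kk_neg)
  qed
  then have "adj_input_integral S B v s = (\<integral>t. kk (t - s) (y' t) \<partial>lborel)"
    unfolding adj_input_integral_def set_lebesgue_integral_def by (intro lebesgue_integral_eq_lborel) measurable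
  then show ?thesis using s by (simp add: K.adj_input_def)
qed

text \<open>\<open>adj_input_map\<close> selects some limit along some sequence. The approximation
  result shows that a selection exists. Whatever sequence was selected, the adjoint generator
  applied to its members has representatives \<open>y n\<close> with \<open>vs n\<close> equal to
  \<open>J (y n)\<close> almost everywhere, so \<open>weak_adj_limit\<close> identifies the
  limit.\<close>

lemma adj_input_map_weak:
  assumes q: "q > 1" and v': "Lp_bound q 0 a v'" and eq: "AE t in lebesgue_on {0<..}. v t = v' t"
  obtains w' b where "Lp_bound q 0 b w'" "K.weak_adj v' w'"
    "AE t in lebesgue_on {0<..}. adj_input_map D A S B q v t = w' t"
proof -
  have q1: "q \<ge> 1" using q by simp
  have Jl: "bounded_linear J" by (rule J_bl)
  have [measurable]: "J \<in> borel_measurable borel" by (rule K.J_measurable)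
  have J0: "J 0 = 0" using J_bl by (simp add: bounded_linear.linear linear_0)
  obtain CJ where CJ: "\<And>y. norm (J y) \<le> norm y * CJ" "CJ \<ge> 0" using bounded_linear.nonneg_bounded[OF J_bl] by blast
  have JLp: "Lp_bound q 0 (CJ * b) (\<lambda>t. J (y t))" if y: "Lp_bound q 0 b y" for b y
    by (rule Lp_bound_dominated[OF y q1 CJ(2)]) (use Lp_boundD[OF y] J0 CJ(1) in \<open>auto simp: mult.commute\<close>)
  obtain CI where CI: "\<And>y a b. Lp_bound q 0 b y \<Longrightarrow> Lp_bound q 0 a (\<lambda>t. J (y t)) \<Longrightarrow> Lp_bound q 0 (CI * a) (K.adj_input y)"
    using K.adj_input_bound[OF q] by blast
  let ?ok = "\<lambda>w vs. (\<forall>n. (\<forall>t>0. vs n t \<in> adj_dom D A) \<and> (\<lambda>t. adj D A (vs n t)) \<in> Lp_space q {0<..}) \<and>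
     Lp_tendsto q {0<..} vs v \<and> Lp_tendsto q {0<..} (\<lambda>n. adj_input_integral S B (vs n)) w"
  have "\<exists>w vs. ?ok w vs"
  proof -
    obtain y b w c c' where y: "\<And>n. Lp_bound q 0 (b n) (y n)"
      and e: "\<And>n. Lp_bound q 0 ((1/4) ^ n) (\<lambda>t. v' t - J (y n t))"
      and f: "\<And>n. Lp_bound q 0 (c * (1/2) ^ n) (\<lambda>t. w t - K.adj_input (y n) t)" and w: "Lp_bound q 0 c' w"
      using K.adj_input_approximation[OF q v'] by blast
    have "?ok w (\<lambda>n t. J (y n t))"
    proof (intro conjI allI impI)
      show "J (y n t) \<in> adj_dom D A" for n t by (rule J_adj)
      show "(\<lambda>t. adj D A (J (y n t))) \<in> Lp_space q {0<..}" for n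
        unfolding weighted_Lp_0 J_adj(2)
        using weighted_Lp_bound_iff[OF Lp_boundD(1,2)[OF y[of n]] _ q1 Lp_boundD(3)[OF y[of n]], of "y n" 0] y[of n] by simp
      show "Lp_tendsto q {0<..} (\<lambda>n t. J (y n t)) v"
      proof (rule Lp_tendsto_of_bounds[OF q1 JLp[OF y] v' _ eq e])
        show "(\<lambda>n. (1/4::real) ^ n) \<longlonglongrightarrow> 0" by (rule LIMSEQ_realpow_zero) auto
      qed simp
      show "Lp_tendsto q {0<..} (\<lambda>n. adj_input_integral S B (\<lambda>t. J (y n t))) w"
      proof (rule Lp_tendsto_of_bounds[OF q1 CI[OF y JLp[OF y]] w _ _ f])
        show "AE t in lebesgue_on {0<..}. adj_input_integral S B (\<lambda>t. J (y n t)) t = K.adj_input (y n) t" for n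
          unfolding AE_half_line using adj_input_integral_eq[OF Lp_boundD(1)[OF y[of n]], of "\<lambda>t. J (y n t)"] by simp
        have "(\<lambda>n. c * (1/2) ^ n) \<longlonglongrightarrow> c * 0" by (intro tendsto_mult tendsto_const LIMSEQ_realpow_zero) auto
        then show "(\<lambda>n. c * (1/2) ^ n) \<longlonglongrightarrow> 0" by simp
      qed simp
    qed
    then show ?thesis by (intro exI)
  qed
  from someI_ex[OF this] obtain vs where ok: "?ok (adj_input_map D A S B q v) vs"
    unfolding adj_input_map_def by blast
  define W where "W = adj_input_map D A S B q v"
  have "W \<in> weighted_Lp q 0" using ok by (simp add: Lp_tendsto_def weighted_Lp_0 W_def)
  then obtain w' where w': "AE t in lebesgue_on {0<..}. W t = w' t" "Lp_bound q 0 (weighted_Lp_norm q 0 W) w'"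
    using weighted_Lp_representative q1 by blast
  have "\<exists>y. (AE t in lebesgue_on {0<..}. adj D A (vs n t) = y t) \<and> Lp_bound q 0 (weighted_Lp_norm q 0 (\<lambda>t. adj D A (vs n t))) y" for n
  proof -
    have "(\<lambda>t. adj D A (vs n t)) \<in> weighted_Lp q 0" using ok by (simp add: weighted_Lp_0)
    then show ?thesis using weighted_Lp_representative[OF _ q1] by blast
  qed
  then obtain y where y: "\<And>n. AE t in lebesgue_on {0<..}. adj D A (vs n t) = y n t"
    "\<And>n. Lp_bound q 0 (weighted_Lp_norm q 0 (\<lambda>t. adj D A (vs n t))) (y n)" by metis
  have vy: "AE t in lebesgue_on {0<..}. vs n t = J (y n t)" for n
    using y(1)[of n] unfolding AE_half_line
  proof eventually_elim
    case (elim t)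
    then show ?case using ok adj_J[of "vs n t"] by auto
  qed
  note JD = Lp_boundD[OF JLp[OF y(2)]] and ID = Lp_boundD[OF CI[OF y(2) JLp[OF y(2)]]]
  have t1: "Lp_tendsto q {0<..} vs v" and t2: "Lp_tendsto q {0<..} (\<lambda>n. adj_input_integral S B (vs n)) W"
    using ok by (auto simp: W_def)
  obtain e where e: "\<And>n. Lp_bound q 0 (e n) (\<lambda>t. v' t - J (y n t))" "e \<longlonglongrightarrow> 0"
    using Lp_tendsto_representative[OF t1 q1 JD(1,2) vy v' eq] by blast
  have iy: "AE t in lebesgue_on {0<..}. adj_input_integral S B (vs n) t = K.adj_input (y n) t" for n
    unfolding AE_half_line using adj_input_integral_eq[OF Lp_boundD(1)[OF y(2)] vy] by simp
  obtain f where f: "\<And>n. Lp_bound q 0 (f n) (\<lambda>t. w' t - K.adj_input (y n) t)" "f \<longlonglongrightarrow> 0"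
    using Lp_tendsto_representative[OF t2 q1 ID(1,2) iy w'(2,1)] by blast
  have "K.weak_adj v' w'" by (rule K.weak_adj_limit[OF q v' w'(2) y(2) e f])
  then show ?thesis using w' by (intro that) (auto simp: W_def)
qed

text \<open>The selected adjoint image and \<open>feedback\<close> satisfy the same weak identity,
  so they agree by uniqueness.\<close>

lemma Lambda_op_eq:
  assumes q: "q > 1" and g': "Lp_bound q 0 a g'" and eq: "AE t in lebesgue_on {0<..}. g t = g' t"
  shows "AE t in lebesgue_on {0<..}. Lambda_op D A S B R q g t = g' t + K.feedback q g' t"
proof -
  note fw = K.feedback_weak[OF q g']
  obtain b c where b: "Lp_bound q 0 b (K.feedback q g')" and c: "Lp_bound q 0 c (\<lambda>t. Q (K.input g' t))" using fw by blast
  have "AE t in lborel. K.is_input g' t (K.input g' t)" using fw(4) by (simp add: K.input_defined_def)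
  then have "AE t in lborel. 0 < t \<longrightarrow> adj UNIV R (R (input_map D A S B g t)) = Q (K.input g' t)"
  proof eventually_elim
    case (elim t)
    show ?case using input_map_eq[OF Lp_boundD(1,2)[OF g'] eq elim] by (simp add: Q_def)
  qed
  then have v: "AE t in lebesgue_on {0<..}. adj UNIV R (R (input_map D A S B g t)) = Q (K.input g' t)"
    by (simp add: AE_half_line)
  obtain w' d where w': "Lp_bound q 0 d w'" "K.weak_adj (\<lambda>t. Q (K.input g' t)) w'"
    "AE t in lebesgue_on {0<..}. adj_input_map D A S B q (\<lambda>t. adj UNIV R (R (input_map D A S B g t))) t = w' t"
    using adj_input_map_weak[OF q c v] by blast
  have "AE t in lborel. w' t = K.feedback q g' t" by (rule K.weak_adj_unique[OF q w'(1,2) b fw(2)])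
  then have "AE t in lebesgue_on {0<..}. w' t = K.feedback q g' t" unfolding AE_half_line by eventually_elim simp
  with eq w'(3) show ?thesis by eventually_elim (simp add: Lambda_op_def)
qed

theorem Lambda_op_resolvent:
  assumes q: "1 < q" "q < 2" and \<delta>: "0 < \<delta>" "\<delta> < \<omega>"
  shows "\<exists>\<sigma>\<^sub>0. 0 < \<sigma>\<^sub>0 \<and> \<sigma>\<^sub>0 < \<delta> \<and>
    (\<exists>C. \<forall>h \<in> weighted_Lp q \<delta>. \<exists>g \<in> weighted_Lp q (\<delta> - \<sigma>\<^sub>0).
       (AE t in lebesgue_on {0<..}. Lambda_op D A S B R q g t = h t) \<and>
       (\<forall>g' \<in> weighted_Lp q (\<delta> - \<sigma>\<^sub>0).
          (AE t in lebesgue_on {0<..}. Lambda_op D A S B R q g' t = h t) \<longrightarrow>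
          (AE t in lebesgue_on {0<..}. g' t = g t)) \<and>
       weighted_Lp_norm q (\<delta> - \<sigma>\<^sub>0) g \<le> C * weighted_Lp_norm q \<delta> h)"
proof -
  have q1: "q \<ge> 1" using q by simp
  obtain \<tau> C where \<tau>': "0 < \<tau>" "\<tau> < \<delta>" and C: "0 \<le> C"
    and ex: "\<And>h a. Lp_bound q \<delta> a h \<Longrightarrow> \<exists>g. Lp_bound q \<tau> (C * a) g \<and> (AE t in lborel. g t + K.feedback q g t = h t)"
    and un: "\<And>g g' a a'. Lp_bound q \<tau> a g \<Longrightarrow> Lp_bound q \<tau> a' g' \<Longrightarrow>
      (AE t in lborel. g t + K.feedback q g t = g' t + K.feedback q g' t) \<Longrightarrow> (AE t in lborel. g t = g' t)"
    using K.feedback_resolvent[OF q \<delta>] by blast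
  then have \<tau>: "0 < \<tau>" "\<tau> < \<delta>" "0 \<le> \<tau>" by auto
  have main: "\<exists>g \<in> weighted_Lp q \<tau>. (AE t in lebesgue_on {0<..}. Lambda_op D A S B R q g t = h t) \<and>
       (\<forall>g' \<in> weighted_Lp q \<tau>. (AE t in lebesgue_on {0<..}. Lambda_op D A S B R q g' t = h t) \<longrightarrow>
          (AE t in lebesgue_on {0<..}. g' t = g t)) \<and>
       weighted_Lp_norm q \<tau> g \<le> C * weighted_Lp_norm q \<delta> h" if h: "h \<in> weighted_Lp q \<delta>" for h
  proof -
    obtain h' where h': "AE t in lebesgue_on {0<..}. h t = h' t" "Lp_bound q \<delta> (weighted_Lp_norm q \<delta> h) h'"
      using weighted_Lp_representative[OF h q1] by blast
    obtain g where g: "Lp_bound q \<tau> (C * weighted_Lp_norm q \<delta> h) g" "AE t in lborel. g t + K.feedback q g t = h' t"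
      using ex[OF h'(2)] by blast
    have gw: "g \<in> weighted_Lp q \<tau> \<and> weighted_Lp_norm q \<tau> g \<le> C * weighted_Lp_norm q \<delta> h"
      using weighted_Lp_bound_iff[OF Lp_boundD(1,2)[OF g(1)] _ q1 Lp_boundD(3)[OF g(1)], of g \<tau>] g(1) by simp
    have ge: "AE t in lebesgue_on {0<..}. g t = g t" by simp
    have "AE t in lebesgue_on {0<..}. g t + K.feedback q g t = h' t" unfolding AE_half_line using g(2) by eventually_elim simp
    with Lambda_op_eq[OF q(1) Lp_bound_weight_mono[OF g(1) \<tau>(3) q1] ge] h'(1)
    have sol: "AE t in lebesgue_on {0<..}. Lambda_op D A S B R q g t = h t" by eventually_elim simp
    have "AE t in lebesgue_on {0<..}. k t = g t" if k: "k \<in> weighted_Lp q \<tau>"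
      and ks: "AE t in lebesgue_on {0<..}. Lambda_op D A S B R q k t = h t" for k
    proof -
      obtain k' where k': "AE t in lebesgue_on {0<..}. k t = k' t" "Lp_bound q \<tau> (weighted_Lp_norm q \<tau> k) k'"
        using weighted_Lp_representative[OF k q1] by blast
      have k0: "Lp_bound q 0 (weighted_Lp_norm q \<tau> k) k'" by (rule Lp_bound_weight_mono[OF k'(2) \<tau>(3) q1])
      obtain b where b: "Lp_bound q 0 b (K.feedback q k')" using K.feedback_weak(1)[OF q(1) k0] by blast
      have "AE t in lebesgue_on {0<..}. k' t + K.feedback q k' t = h' t"
        using Lambda_op_eq[OF q(1) k0 k'(1)] ks h'(1) by eventually_elim simp
      \<comment> \<open>For t \<le> 0 all representatives vanish, so the equation on the half-line
        extends to almost every real t, as \<open>un\<close> requires.\<close>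
      then have "AE t in lborel. k' t + K.feedback q k' t = h' t" unfolding AE_half_line
      proof eventually_elim
        case (elim t)
        then show ?case using Lp_boundD(2)[OF k'(2), of t] Lp_boundD(2)[OF b, of t] Lp_boundD(2)[OF h'(2), of t]
          by (cases "t > 0") auto
      qed
      with g(2) have "AE t in lborel. k' t + K.feedback q k' t = g t + K.feedback q g t" by eventually_elim simp
      from un[OF k'(2) g(1) this] have "AE t in lebesgue_on {0<..}. k' t = g t" unfolding AE_half_line by eventually_elim simp
      with k'(1) show ?thesis by eventually_elim simp
    qed
    with gw sol show ?thesis by blast
  qed
  \<comment> \<open>\<sigma>_0 is taken to be the loss \<delta> - \<tau>, which turns the weight
    \<delta> - \<sigma>_0 back into \<open>\<tau>\<close>.\<close>
  have e: "\<delta> - (\<delta> - \<tau>) = \<tau>" by simp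
  show ?thesis
  proof (rule exI[of _ "\<delta> - \<tau>"], unfold e, intro conjI)
    show "0 < \<delta> - \<tau>" "\<delta> - \<tau> < \<delta>" using \<tau> by auto
  qed (rule exI[of _ C], rule ballI, rule main)
qed

end

theorem theorem4p12:
  fixes D :: "'y::{complex_hilbert, second_countable_topology} set"
    and A :: "'y \<Rightarrow> 'y"
    and S :: "real \<Rightarrow> 'y \<Rightarrow> 'y"
    and B :: "'u::{complex_hilbert, second_countable_topology} \<Rightarrow> 'y \<Rightarrow> complex"
    and R :: "'y \<Rightarrow> 'z::{complex_hilbert, second_countable_topology}"
    and F G :: "real \<Rightarrow> 'y \<Rightarrow> 'u"
    and M \<omega> \<gamma> \<eta> N T\<^sub>1 T\<^sub>2 \<epsilon> q \<delta> :: real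
  assumes "closed_clinear D A"
    and "generates D A S"
    and "M \<ge> 1" and "\<omega> > 0"
    and "\<And>t. t \<ge> 0 \<Longrightarrow> onorm (S t) \<le> M * exp (- \<omega> * t)"
    and "control_operator D A B"
    and "bounded_clinear R"
    and "\<And>t x. t > 0 \<Longrightarrow> x \<in> adj_dom D A \<Longrightarrow>
           control_adj B (adj_semigroup S t x) = F t x + G t x"
    and "\<And>t. t > 0 \<Longrightarrow> bounded_clinear (F t)"
    and "\<And>t. t > 0 \<Longrightarrow> clinear_on (adj_dom D A) (G t)"
    and "\<And>t. t > 0 \<Longrightarrow> \<exists>C. \<forall>x\<in>adj_dom D A. norm (G t x) \<le> C * graph_norm (adj D A) x"
    and "0 < \<gamma>" and "\<gamma> < 1" and "\<eta> > 0" and "N > 0"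
    and "\<And>t. t > 0 \<Longrightarrow> onorm (F t) \<le> N * t powr (- \<gamma>) * exp (- \<eta> * t)"
    and "T\<^sub>1 > 0"
    and "\<And>p. p \<ge> 1 \<Longrightarrow> extends_to_Lp (adj_dom D A) (\<lambda>x t. G t x) p {0<..<T\<^sub>1}"
    and "T\<^sub>2 > 0" and "0 < \<epsilon>" and "\<epsilon> < 1"
    and "extends_to_C {x. frac_neg_power (adj_semigroup S) \<epsilon> x \<in> adj_dom D A}
           (\<lambda>x t. G t (frac_neg_power (adj_semigroup S) \<epsilon> x)) T\<^sub>2"
    and "\<And>x. x \<in> frac_dom S \<epsilon> \<Longrightarrow> adj UNIV R (R x) \<in> frac_dom (adj_semigroup S) \<epsilon>"
    and "\<exists>C. \<forall>x\<in>frac_dom S \<epsilon>. graph_norm (frac_power (adj_semigroup S) \<epsilon>) (adj UNIV R (R x))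
           \<le> C * graph_norm (frac_power S \<epsilon>) x"
    and "1 < q" and "q < 2"
    and "extends_to_Lp (frac_dom (adj_semigroup S) (1 + \<epsilon>))
           (\<lambda>x t. control_adj B (adj_semigroup S t (frac_power (adj_semigroup S) \<epsilon> x)))
           q {0<..<T\<^sub>2}"
    and "0 < \<delta>" and "\<delta> < min \<omega> \<eta>"
  shows "\<exists>\<sigma>\<^sub>0. 0 < \<sigma>\<^sub>0 \<and> \<sigma>\<^sub>0 < \<delta> \<and>
    (\<exists>C. \<forall>h \<in> weighted_Lp q \<delta>. \<exists>g \<in> weighted_Lp q (\<delta> - \<sigma>\<^sub>0).
       (AE t in lebesgue_on {0<..}. Lambda_op D A S B R q g t = h t) \<and>
       (\<forall>g' \<in> weighted_Lp q (\<delta> - \<sigma>\<^sub>0).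
          (AE t in lebesgue_on {0<..}. Lambda_op D A S B R q g' t = h t) \<longrightarrow>
          (AE t in lebesgue_on {0<..}. g' t = g t)) \<and>
       weighted_Lp_norm q (\<delta> - \<sigma>\<^sub>0) g \<le> C * weighted_Lp_norm q \<delta> h)"
proof -
  have F: "norm (F t x) \<le> N * t powr (- \<gamma>) * norm x" if t: "t > 0" for t x
  proof -
    have "exp (- \<eta> * t) \<le> 1" using assms(14) t by simp
    then have "N * t powr (- \<gamma>) * exp (- \<eta> * t) \<le> N * t powr (- \<gamma>) * 1"
      using assms(15) by (intro mult_left_mono) auto
    then have "onorm (F t) \<le> N * t powr (- \<gamma>)" using assms(16)[OF t] by simp
    then have "onorm (F t) * norm x \<le> N * t powr (- \<gamma>) * norm x" by (intro mult_right_mono) auto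
    then show ?thesis
      using onorm[OF bounded_clinear_imp_bounded_linear[OF assms(9)[OF t]], of x] by linarith
  qed
  interpret controlled_cost D A S M \<omega> B F G \<gamma> N T\<^sub>1 R
  proof (intro controlled_cost.intro control_system.intro stable_semigroup.intro
      control_system_axioms.intro controlled_cost_axioms.intro)
    show "clinear_on D A" using assms(1) by (simp add: closed_clinear_def)
  qed (fact assms F)+
  have "\<delta> < \<omega>" using assms by simp
  then show ?thesis by (rule Lambda_op_resolvent[OF \<open>1 < q\<close> \<open>q < 2\<close> \<open>0 < \<delta>\<close>])
qed

end
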